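(* Let $N\in\mathbb{N}$ and $u\in C^\beta(\mathbb{S}^N)$ for some $\beta>0$. Then $$\mathscr{P}^{\log}_g u(z):=\left.\frac{d}{ds}\right|_{s=0}[\mathscr{P}^s_g u](z)=c_N\int_{\mathbb{S}^N}\frac{u(z)-u(\zeta)}{|z-\zeta|^N}\,dV_g(\zeta)+A_N u(z),$$ where $c_N:=\pi^{-\frac N2}\Gamma(\tfrac N2)$, $A_N:=2\psi(\tfrac N2)$, and $\psi(x):=\frac{\Gamma'(x)}{\Gamma(x)}$ denotes the Digamma function. Moreover: (i) For $1\le p\le\infty$, we have $\mathscr{P}^{\log}_g u\in L^p(\mathbb{S}^N)$ and $\frac{\mathscr{P}^s_g u-u}{s}\to\mathscr{P}^{\log}_g u$ in $L^p(\mathbb{S}^N)$ as $s\to0^+$. (ii) $\Phi$ is an eigenfunction of the Laplace-Beltrami operator on the sphere associated to the eigenvalue $\lambda$, i.e. $$(-\Delta)_g\Phi=\lambda\Phi\quad\text{on }\mathbb{S}^N,$$ if and only if $\Phi$ is an eigenfunction of $\mathscr{P}^{\log}_g$ associated to the eigenvalue $\varphi_N(\lambda):=2\psi\left(\tfrac12+\sqrt{\tfrac14(N-1)^2+\lambda}\right)$, i.e. $$\mathscr{P}^{\log}_g\Phi=\varphi_N(\lambda)\Phi\quad\text{on }\mathbb{S}^N.$$ Furthermore, the function $\lambda\mapsto\varphi_N(\lambda)$ is strictly increasing in $(0,\infty)$.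
   Context: $\mathbb{S}^N\subset\mathbb{R}^{N+1}$ is the unit sphere with its round metric $g$ and volume element $dV_g$; $|z-\zeta|$ is the Euclidean distance in $\mathbb{R}^{N+1}$; $\Delta_g$ is the Laplace-Beltrami operator on $(\mathbb{S}^N,g)$ and $(-\Delta)_g=-\Delta_g$. $C^\beta(\mathbb{S}^N)$ is the space of $\beta$-Hölder continuous functions on $\mathbb{S}^N$. $\Gamma$ is the Gamma function. For $s\in(0,1)$ the conformal fractional Laplacian on $(\mathbb{S}^N,g)$ is given by $$\mathscr{P}^s_g u(z)=c_{N,s}\,\mathrm{P.V.}\int_{\mathbb{S}^N}\frac{u(z)-u(\zeta)}{|z-\zeta|^{N+2s}}\,dV_g(\zeta)+A_{N,s}u(z),$$ where P.V. denotes the principal value, $A_{N,s}:=\frac{\Gamma(\frac N2+s)}{\Gamma(\frac N2-s)}$ and $c_{N,s}:=4^s\pi^{-\frac N2}\frac{\Gamma(\frac N2+s)}{\Gamma(2-s)}s(1-s)$. For $u\in C^\beta(\mathbb{S}^N)$ this formula is used for $s>0$ sufficiently small. The derivative at $s=0$ is the one-sided limit $\lim_{s\to0^+}\frac{\mathscr{P}^s_g u(z)-u(z)}{s}$. *)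

theory Defs
  imports "HOL-Analysis.Analysis" "HOL-Probability.Essential_Supremum"
begin

text \<open>
  The unit sphere \<open>sphere 0 1\<close> of a Euclidean space \<open>'a\<close> with \<open>DIM('a) = N + 1\<close> plays the role of
  \<open>S^N\<close> in \<open>R^(N+1)\<close>.  Functions on the sphere are functions on \<open>'a\<close> of which only the values on
  \<open>sphere 0 1\<close> are ever used.
\<close>

section \<open>The round sphere\<close>

text \<open>
  The Riemannian volume of the unit sphere, normalised by polar coordinates: the volume of a Borel
  set \<open>A\<close> is \<open>N + 1\<close> times the Lebesgue measure of the cone \<open>{t *\<^sub>R x | 0 < t \<le> 1, x \<in> A}\<close>.
  The underlying space of this measure is the sphere, not the ambient space.
\<close>

definition sphere_volume :: "'a::euclidean_space measure" where
  "sphere_volume =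
     scale_measure (of_nat DIM('a))
       (distr (restrict_space lborel (cball 0 1 - {0})) (restrict_space borel (sphere 0 1))
          (\<lambda>x. x /\<^sub>R norm x))"

lemma space_sphere_volume [simp]: "space sphere_volume = sphere 0 1"
  by (simp add: sphere_volume_def space_restrict_space space_scale_measure)

lemma sets_sphere_volume [simp, measurable_cong]:
  "sets sphere_volume = sets (restrict_space borel (sphere 0 1))"
  by (simp add: sphere_volume_def)

lemma emeasure_sphere_volume:
  fixes A :: "'a::euclidean_space set"
  assumes "A \<in> sets borel" "A \<subseteq> sphere 0 1"
  shows "emeasure sphere_volume A =
    of_nat DIM('a) * emeasure lborel {x \<in> cball 0 1 - {0}. x /\<^sub>R norm x \<in> A}"
proof -
  have ms: "(\<lambda>x. x /\<^sub>R norm x) \<in>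
      restrict_space lborel (cball (0::'a) 1 - {0}) \<rightarrow>\<^sub>M restrict_space borel (sphere 0 1)"
    by (rule measurable_restrict_space2)
       (auto simp: space_restrict_space intro!: measurable_restrict_space1)
  have A: "A \<in> sets (restrict_space borel (sphere 0 1))"
    using assms by (auto simp: sets_restrict_space_iff)
  have "emeasure (distr (restrict_space lborel (cball 0 1 - {0})) (restrict_space borel (sphere 0 1))
          (\<lambda>x. x /\<^sub>R norm x)) A =
        emeasure (restrict_space lborel (cball 0 1 - {0}))
          {x \<in> cball 0 1 - {0}. x /\<^sub>R norm x \<in> A}"
    by (subst emeasure_distr[OF ms A])
       (auto simp: space_restrict_space intro!: arg_cong2[where f = emeasure])
  also have "\<dots> = emeasure lborel {x \<in> cball 0 1 - {0}. x /\<^sub>R norm x \<in> A}"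
    by (rule emeasure_restrict_space) auto
  finally show ?thesis
    by (simp add: sphere_volume_def)
qed

text \<open>
  Differential calculus on the sphere is expressed through the extension that is constant along
  rays.  At a point of the sphere, the derivative of this extension vanishes in the normal direction
  and is the differential of the original function in tangential directions.
\<close>

definition radial_ext :: "('a::euclidean_space \<Rightarrow> 'b) \<Rightarrow> 'a \<Rightarrow> 'b" where
  "radial_ext f x = f (x /\<^sub>R norm x)"

definition sphere_grad :: "('a::euclidean_space \<Rightarrow> real) \<Rightarrow> 'a \<Rightarrow> 'a" where
  "sphere_grad u z = (\<Sum>b\<in>Basis. frechet_derivative (radial_ext u) (at z) b *\<^sub>R b)"

text \<open>
  For a tangential vector field \<open>X\<close>, the trace below is the trace of the covariant derivative of
  \<open>X\<close>: the normal direction does not contribute, and the Levi-Civita connection is the tangential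
  part of the ambient derivative.
\<close>

definition sphere_div :: "('a::euclidean_space \<Rightarrow> 'a) \<Rightarrow> 'a \<Rightarrow> real" where
  "sphere_div X z = (\<Sum>b\<in>Basis. frechet_derivative (radial_ext X) (at z) b \<bullet> b)"

definition laplace_beltrami :: "('a::euclidean_space \<Rightarrow> real) \<Rightarrow> 'a \<Rightarrow> real" where
  "laplace_beltrami u = sphere_div (sphere_grad u)"

definition sphere_C1 :: "('a::euclidean_space \<Rightarrow> 'b::real_normed_vector) set" where
  "sphere_C1 = {f. (\<forall>z\<in>sphere 0 1. radial_ext f differentiable (at z)) \<and>
     (\<forall>v. continuous_on (sphere 0 1) (\<lambda>z. frechet_derivative (radial_ext f) (at z) v))}"

definition sphere_C2 :: "('a::euclidean_space \<Rightarrow> real) set" where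
  "sphere_C2 = {u. u \<in> sphere_C1 \<and> sphere_grad u \<in> sphere_C1}"

definition sphere_holder :: "real \<Rightarrow> ('a::euclidean_space \<Rightarrow> real) set" where
  "sphere_holder \<beta> = {u. \<exists>C. \<forall>x\<in>sphere 0 1. \<forall>y\<in>sphere 0 1. \<bar>u x - u y\<bar> \<le> C * norm (x - y) powr \<beta>}"

section \<open>Lebesgue spaces\<close>

text \<open>The exponent \<open>p\<close> ranges over \<open>[1, \<infinity>]\<close>.\<close>

definition Lp_norm :: "ennreal \<Rightarrow> 'a measure \<Rightarrow> ('a \<Rightarrow> real) \<Rightarrow> ennreal" where
  "Lp_norm p M f =
     (if p = \<infinity> then esssup M (\<lambda>x. ennreal \<bar>f x\<bar>)
      else let I = (\<integral>\<^sup>+x. ennreal (\<bar>f x\<bar> powr enn2real p) \<partial>M)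
           in if I = \<infinity> then \<infinity> else ennreal (enn2real I powr (1 / enn2real p)))"

definition Lp_space :: "ennreal \<Rightarrow> 'a measure \<Rightarrow> ('a \<Rightarrow> real) set" where
  "Lp_space p M = {f \<in> borel_measurable M. Lp_norm p M f < \<infinity>}"

section \<open>The conformal fractional Laplacian and its logarithmic derivative\<close>

definition has_principal_value :: "'a::euclidean_space \<Rightarrow> ('a \<Rightarrow> real) \<Rightarrow> real \<Rightarrow> bool" where
  "has_principal_value z f I \<longleftrightarrow>
     (\<forall>\<epsilon>>0. set_integrable sphere_volume {\<zeta>\<in>sphere 0 1. \<epsilon> < norm (z - \<zeta>)} f) \<and>
     ((\<lambda>\<epsilon>. LINT \<zeta>:{\<zeta>\<in>sphere 0 1. \<epsilon> < norm (z - \<zeta>)}|sphere_volume. f \<zeta>) \<longlongrightarrow> I) (at_right 0)"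

definition principal_value :: "'a::euclidean_space \<Rightarrow> ('a \<Rightarrow> real) \<Rightarrow> real" where
  "principal_value z f = (THE I. has_principal_value z f I)"

definition frac_c :: "nat \<Rightarrow> real \<Rightarrow> real" where
  "frac_c N s = 4 powr s * pi powr (- real N / 2) * (Gamma (real N / 2 + s) / Gamma (2 - s))
     * s * (1 - s)"

definition frac_A :: "nat \<Rightarrow> real \<Rightarrow> real" where
  "frac_A N s = Gamma (real N / 2 + s) / Gamma (real N / 2 - s)"

definition frac_kernel :: "nat \<Rightarrow> real \<Rightarrow> ('a::euclidean_space \<Rightarrow> real) \<Rightarrow> 'a \<Rightarrow> 'a \<Rightarrow> real" where
  "frac_kernel N s u z \<zeta> = (u z - u \<zeta>) / norm (z - \<zeta>) powr (real N + 2 * s)"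

definition conf_frac_laplacian ::
    "nat \<Rightarrow> real \<Rightarrow> ('a::euclidean_space \<Rightarrow> real) \<Rightarrow> 'a \<Rightarrow> real" where
  "conf_frac_laplacian N s u z =
     frac_c N s * principal_value z (frac_kernel N s u z) + frac_A N s * u z"

definition frac_quotient :: "nat \<Rightarrow> real \<Rightarrow> ('a::euclidean_space \<Rightarrow> real) \<Rightarrow> 'a \<Rightarrow> real" where
  "frac_quotient N s u z = (conf_frac_laplacian N s u z - u z) / s"

definition conf_log_laplacian :: "nat \<Rightarrow> ('a::euclidean_space \<Rightarrow> real) \<Rightarrow> 'a \<Rightarrow> real" where
  "conf_log_laplacian N u z = Lim (at_right 0) (\<lambda>s. frac_quotient N s u z)"

definition log_c :: "nat \<Rightarrow> real" where
  "log_c N = pi powr (- real N / 2) * Gamma (real N / 2)"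

definition log_A :: "nat \<Rightarrow> real" where
  "log_A N = 2 * Digamma (real N / 2)"

section \<open>Eigenfunctions\<close>

definition is_eigenfunction ::
    "('a::euclidean_space \<Rightarrow> real) set \<Rightarrow> (('a \<Rightarrow> real) \<Rightarrow> 'a \<Rightarrow> real) \<Rightarrow> real \<Rightarrow> ('a \<Rightarrow> real) \<Rightarrow> bool"
where
  "is_eigenfunction D L \<mu> \<Phi> \<longleftrightarrow>
     \<Phi> \<in> D \<and> (\<exists>z\<in>sphere 0 1. \<Phi> z \<noteq> 0) \<and> (\<forall>z\<in>sphere 0 1. L \<Phi> z = \<mu> * \<Phi> z)"

definition laplace_eigenfunction :: "real \<Rightarrow> ('a::euclidean_space \<Rightarrow> real) \<Rightarrow> bool" where
  "laplace_eigenfunction = is_eigenfunction sphere_C2 (\<lambda>u z. - laplace_beltrami u z)"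

definition log_eigenfunction :: "nat \<Rightarrow> real \<Rightarrow> ('a::euclidean_space \<Rightarrow> real) \<Rightarrow> bool" where
  "log_eigenfunction N = is_eigenfunction (\<Union>\<beta>\<in>{0<..}. sphere_holder \<beta>) (conf_log_laplacian N)"

text \<open>
  The symbol is a real number only if the radicand is nonnegative; \<open>sqrt\<close> is total (and odd) in HOL,
  so this domain has to be recorded separately.
\<close>

definition symbol_radicand :: "nat \<Rightarrow> real \<Rightarrow> real" where
  "symbol_radicand N \<mu> = 1 / 4 * (real N - 1)\<^sup>2 + \<mu>"

definition log_symbol :: "nat \<Rightarrow> real \<Rightarrow> real" where
  "log_symbol N \<mu> = 2 * Digamma (1 / 2 + sqrt (symbol_radicand N \<mu>))"

end

theory Submission
  imports Defs "HOL-Probability.Giry_Monad"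
begin

text \<open>
  For a Hoelder continuous function the kernels \<open>norm (z - \<zeta>) powr (-N - 2 * s)\<close> are uniformly integrable
  against \<open>u z - u \<zeta>\<close>, so the difference quotients converge uniformly on the sphere, hence in every \<open>Lp\<close>.

  For the eigenfunctions, let \<open>Z j\<close> be the coefficient of \<open>r ^ j\<close> in the Poisson kernel, a polynomial in
  \<open>z \<bullet> \<zeta>\<close>. Its differential equation makes \<open>Z j (y \<bullet> _)\<close> an eigenfunction of the Laplace-Beltrami operator, and
  since \<open>norm (z - \<zeta>) powr (-N)\<close> is a superposition of Poisson kernels, it is also an eigenfunction of the
  logarithmic operator, with eigenvalue \<open>2 * Digamma (N / 2 + j)\<close>. Both operators are symmetric, so the
  zonal projection of an eigenfunction \<open>\<Phi>\<close> of either of them vanishes unless \<open>j\<close> carries the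
  same eigenvalue; this happens for at most one \<open>k\<close>. Letting \<open>r\<close> tend to 1 in the Poisson integral then
  identifies \<open>\<Phi>\<close> with its \<open>k\<close>-th projection, which is an eigenfunction of both operators.
\<close>

section \<open>The surface measure\<close>

text \<open>Completeness of the spherical harmonics is never invoked: the Poisson kernel is an
  approximate identity, so Abel summation recovers a continuous function from its zonal projections,
  and a function whose projections all vanish is zero. The obstacle is that an eigenfunction of the
  logarithmic operator is only Hoelder continuous, so it may not be differentiated; in that
  direction all derivatives fall on polynomial kernels, and regularity returns because \<Phi> is a
  multiple of one of its own projections. The polynomials \<open>Z j\<close> come from the Poisson
  kernel and not from the usual Gegenbauer generating function (1 - 2rt + r^2)^(-\<nu>), which
  degenerates to 1 on the circle, where \<nu> = 0. The weight r^(N/2 - 1) / (1 - r) of the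
  superposition is not integrable at r = 1, hence the kernel always acts on differences f z - f
  \<zeta>. On the k-th projection the numerator 1 - r^k cancels the singularity and leaves the sum
  of 1 / (N/2 + i) over i < k, which is \<psi>(N/2 + k) - \<psi>(N/2).\<close>

lemma radial_projection_measurable:
  "(\<lambda>x. x /\<^sub>R norm x) \<in>
     restrict_space lborel (cball (0::'a::euclidean_space) 1 - {0}) \<rightarrow>\<^sub>M restrict_space borel (sphere 0 1)"
  by (rule measurable_restrict_space2)
     (auto simp: space_restrict_space intro!: measurable_restrict_space1)

lemma integral_sphere_volume:
  fixes g :: "'a::euclidean_space \<Rightarrow> real"
  assumes "g \<in> borel_measurable sphere_volume"
  shows "integral\<^sup>L sphere_volume g =
    real DIM('a) * (LINT x:cball 0 1 - {0}|lborel. g (x /\<^sub>R norm x))"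
proof -
  let ?D = "distr (restrict_space lborel (cball (0::'a) 1 - {0})) (restrict_space borel (sphere 0 1))
          (\<lambda>x. x /\<^sub>R norm x)"
  have g: "g \<in> borel_measurable (restrict_space borel (sphere 0 1))"
    using assms by (simp cong: measurable_cong_sets)
  have "sphere_volume = density ?D (\<lambda>_. ennreal (real DIM('a)))"
    by (rule measure_eqI)
       (auto simp: sphere_volume_def emeasure_density_const sets_restrict_space ennreal_of_nat_eq_real_of_nat)
  then have "integral\<^sup>L sphere_volume g = integral\<^sup>L (density ?D (\<lambda>_. ennreal (real DIM('a)))) g"
    by (rule arg_cong)
  also have "\<dots> = integral\<^sup>L ?D (\<lambda>x. real DIM('a) * g x)"
    using g by (subst integral_real_density) (auto cong: measurable_cong_sets)
  also have "\<dots> = real DIM('a) * integral\<^sup>L ?D g"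
    by simp
  also have "integral\<^sup>L ?D g =
      integral\<^sup>L (restrict_space lborel (cball (0::'a) 1 - {0})) (\<lambda>x. g (x /\<^sub>R norm x))"
    by (rule integral_distr[OF radial_projection_measurable g])
  also have "\<dots> = (LINT x:cball 0 1 - {0}|lborel. g (x /\<^sub>R norm x))"
    by (subst integral_restrict_space) (auto simp: set_lebesgue_integral_def)
  finally show ?thesis .
qed

lemma borel_measurable_sphere_volume_continuous:
  fixes f :: "'a::euclidean_space \<Rightarrow> 'b::topological_space"
  assumes "continuous_on (sphere 0 1) f"
  shows "f \<in> borel_measurable sphere_volume"
  using borel_measurable_continuous_on_restrict[OF assms]
  by (simp cong: measurable_cong_sets)

lemma borel_measurable_sphere_volume:
  fixes f :: "'a::euclidean_space \<Rightarrow> 'b::topological_space"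
  assumes "f \<in> borel_measurable borel"
  shows "f \<in> borel_measurable sphere_volume"
  using measurable_restrict_space1[OF assms]
  by (simp cong: measurable_cong_sets)

definition sphere_area :: "'a::euclidean_space itself \<Rightarrow> real" where
  "sphere_area _ = real DIM('a) * unit_ball_vol (real DIM('a))"

lemma sphere_area_pos: "sphere_area TYPE('a::euclidean_space) > 0"
  by (simp add: sphere_area_def)

lemma emeasure_space_sphere_volume:
  "emeasure (sphere_volume :: 'a::euclidean_space measure) (sphere 0 1) = ennreal (sphere_area TYPE('a))"
proof -
  have "{x \<in> cball (0::'a) 1 - {0}. x /\<^sub>R norm x \<in> sphere 0 1} = cball 0 1 - {0}"
    by auto
  moreover have "emeasure lborel (cball (0::'a) 1 - {0}) = ennreal (unit_ball_vol (real DIM('a)))"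
    by (subst emeasure_Diff) (auto simp: emeasure_cball)
  ultimately show ?thesis
    by (subst emeasure_sphere_volume)
       (auto simp: sphere_area_def ennreal_mult' ennreal_of_nat_eq_real_of_nat)
qed

lemma finite_measure_sphere_volume: "finite_measure (sphere_volume :: 'a::euclidean_space measure)"
  by (rule finite_measureI) (simp add: emeasure_space_sphere_volume)

lemma measure_space_sphere_volume:
  "measure (sphere_volume :: 'a::euclidean_space measure) (sphere 0 1) = sphere_area TYPE('a)"
  by (simp add: measure_def emeasure_space_sphere_volume less_imp_le[OF sphere_area_pos])

lemma continuous_on_sphere_bounded:
  fixes f :: "'a::euclidean_space \<Rightarrow> 'b::real_normed_vector"
  assumes "continuous_on (sphere 0 1) f"
  shows "\<exists>K. \<forall>z\<in>sphere 0 1. norm (f z) \<le> K"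
  using compact_imp_bounded[OF compact_continuous_image[OF assms]] by (auto simp: bounded_iff)

lemma integrable_sphere_volume_bounded:
  fixes f :: "'a::euclidean_space \<Rightarrow> 'b::{banach, second_countable_topology}"
  assumes "f \<in> borel_measurable sphere_volume" "\<And>\<zeta>. \<zeta> \<in> sphere 0 1 \<Longrightarrow> norm (f \<zeta>) \<le> B"
  shows "integrable sphere_volume f"
  by (rule finite_measure.integrable_const_bound[OF finite_measure_sphere_volume _ assms(1), of B])
     (use assms(2) in auto)

lemma integrable_sphere_volume_continuous:
  fixes f :: "'a::euclidean_space \<Rightarrow> 'b::{banach, second_countable_topology}"
  assumes "continuous_on (sphere 0 1) f"
  shows "integrable sphere_volume f"
proof -
  obtain B where "\<And>\<zeta>. \<zeta> \<in> sphere 0 1 \<Longrightarrow> norm (f \<zeta>) \<le> B"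
    using continuous_on_sphere_bounded[OF assms] by blast
  then show ?thesis
    by (intro integrable_sphere_volume_bounded borel_measurable_sphere_volume_continuous assms)
qed

section \<open>Volume of spherical caps and integrability of Riesz kernels\<close>

lemma emeasure_lborel_scaleR_image:
  fixes A :: "'a::euclidean_space set"
  assumes "c > 0" "A \<in> sets borel"
  shows "emeasure lborel ((\<lambda>x. c *\<^sub>R x) ` A) = ennreal (c ^ DIM('a)) * emeasure lborel A"
proof -
  have im: "(\<lambda>x. c *\<^sub>R x) ` A = (\<lambda>x. (1/c) *\<^sub>R x) -` A"
    using assms(1) by (auto simp: image_iff intro!: bexI[of _ "(1/c) *\<^sub>R _"])
  have m: "(\<lambda>x. c *\<^sub>R x) ` A \<in> sets borel"
    unfolding im using assms(2) measurable_sets_borel[of "\<lambda>x. (1/c) *\<^sub>R x" borel A] by auto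
  have "emeasure lborel ((\<lambda>x. c *\<^sub>R x) ` A) =
     emeasure (density (distr lborel borel (\<lambda>x::'a. 0 + c *\<^sub>R x)) (\<lambda>_. \<bar>c\<bar>^DIM('a))) ((\<lambda>x. c *\<^sub>R x) ` A)"
    using lborel_affine[of c "0::'a"] assms(1) by simp
  also have "\<dots> = ennreal (c ^ DIM('a)) * emeasure (distr lborel borel (\<lambda>x::'a. 0 + c *\<^sub>R x)) ((\<lambda>x. c *\<^sub>R x) ` A)"
    using m assms(1) by (subst emeasure_density_const) auto
  also have "emeasure (distr lborel borel (\<lambda>x::'a. 0 + c *\<^sub>R x)) ((\<lambda>x. c *\<^sub>R x) ` A) =
      emeasure lborel ((\<lambda>x::'a. c *\<^sub>R x) -` ((\<lambda>x. c *\<^sub>R x) ` A))"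
    using m by (subst emeasure_distr) auto
  also have "(\<lambda>x::'a. c *\<^sub>R x) -` ((\<lambda>x. c *\<^sub>R x) ` A) = A"
    using assms(1) by auto
  finally show ?thesis .
qed

text \<open>Shrinking the cone over a cap of radius \<open>r\<close> by the factor \<open>1 - r\<close> removes at least the fraction
  \<open>r\<close> of its volume, and the removed part lies in a ball of radius \<open>2 * r\<close>.\<close>

lemma sphere_cap_small:
  fixes z :: "'a::euclidean_space"
  assumes z: "norm z = 1" and r: "0 < r" "r < 1"
  shows "measure sphere_volume {\<zeta> \<in> sphere 0 1. norm (z - \<zeta>) \<le> r} \<le>
    sphere_area TYPE('a) * 2 ^ DIM('a) * r ^ (DIM('a) - 1)"
proof -
  define A where "A = {\<zeta> \<in> sphere 0 1. norm (z - \<zeta>) \<le> r}"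
  define K where "K = {x \<in> cball 0 1 - {0}. x /\<^sub>R norm x \<in> A}"
  let ?n = "DIM('a)"
  have A: "A \<in> sets borel" "A \<subseteq> sphere 0 1"
    by (auto simp: A_def)
  have K: "K \<in> sets borel"
    unfolding K_def using A(1) by measurable
  have fin: "emeasure lborel S < \<infinity>" if "S \<subseteq> cball 0 1" for S :: "'a set"
    using emeasure_mono[OF that, of lborel] emeasure_lborel_cball_finite[of "0::'a" 1]
    by (auto simp: le_less_trans)
  let ?L = "(\<lambda>x. (1 - r) *\<^sub>R x) ` K"
  have L: "?L \<in> sets borel"
  proof -
    have "?L = (\<lambda>x. (1/(1-r)) *\<^sub>R x) -` K"
      using r by (auto simp: image_iff intro!: bexI[of _ "(1/(1-r)) *\<^sub>R _"])
    then show ?thesis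
      using K measurable_sets_borel[of "\<lambda>x. (1/(1-r)) *\<^sub>R x" borel K] by auto
  qed
  \<comment> \<open>A point of the cone outside the shrunken copy has norm above 1 - r, so it lies
    within r of its projection to the sphere, and the projection lies within r of
    \<open>z\<close>.\<close>
  have "K - ?L \<subseteq> cball z (2 * r)"
  proof
    fix x assume x: "x \<in> K - ?L"
    have "norm x > 1 - r"
    proof (rule ccontr)
      assume "\<not> norm x > 1 - r"
      then have "(1/(1-r)) *\<^sub>R x \<in> K"
        using x r by (auto simp: K_def divide_simps)
      then have "x \<in> ?L"
        using r by (auto simp: image_iff intro!: bexI[of _ "(1/(1-r)) *\<^sub>R x"])
      with x show False by auto
    qed
    moreover have "norm (x - x /\<^sub>R norm x) = 1 - norm x"
    proof -
      have nx: "norm x > 0" "norm x \<le> 1" using x by (auto simp: K_def)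
      have "x - x /\<^sub>R norm x = (1 - inverse (norm x)) *\<^sub>R x"
        by (simp add: algebra_simps)
      then have "norm (x - x /\<^sub>R norm x) = \<bar>1 - inverse (norm x)\<bar> * norm x"
        by simp
      also have "\<dots> = 1 - norm x"
        using nx one_le_inverse[of "norm x"] by (simp add: abs_if field_simps)
      finally show ?thesis .
    qed
    moreover have "norm (z - x /\<^sub>R norm x) \<le> r"
      using x by (auto simp: K_def A_def)
    moreover have "norm (z - x) \<le> norm (z - x /\<^sub>R norm x) + norm (x - x /\<^sub>R norm x)"
      using norm_triangle_ineq4[of "z - x /\<^sub>R norm x" "x - x /\<^sub>R norm x"] by simp
    ultimately show "x \<in> cball z (2 * r)"
      by (simp add: dist_norm)
  qed
  then have "measure lborel (K - ?L) \<le> measure lborel (cball z (2 * r))"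
    using K L emeasure_lborel_cball_finite[of z "2 * r"]
    by (intro measure_mono_fmeasurable) (auto simp: fmeasurable_def)
  also have "\<dots> = unit_ball_vol ?n * (2 * r) ^ ?n"
    using r content_cball[of "2 * r" z] by simp
  finally have 1: "measure lborel (K - ?L) \<le> unit_ball_vol ?n * (2 * r) ^ ?n" .
  have fmK: "K \<in> fmeasurable lborel"
    using K fin[of K] by (force simp: fmeasurable_def K_def)
  have LK: "?L \<subseteq> K"
  proof
    fix y assume "y \<in> ?L"
    then obtain x where x: "x \<in> K" "y = (1 - r) *\<^sub>R x" by auto
    have "(1 - r) * norm x \<le> 1"
      using x r mult_mono[of "1-r" 1 "norm x" 1] by (auto simp: K_def)
    moreover have "y /\<^sub>R norm y = x /\<^sub>R norm x"
      using r by (simp add: x(2))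
    moreover have "y \<noteq> 0" "norm y = (1 - r) * norm x" "x /\<^sub>R norm x \<in> A"
      using x r by (auto simp: K_def)
    ultimately show "y \<in> K"
      unfolding K_def by (simp del: scaleR_scaleR)
  qed
  have "measure lborel ?L = (1 - r) ^ ?n * measure lborel K"
    using emeasure_lborel_scaleR_image[of "1 - r" K] r K
    by (simp add: measure_def enn2real_mult)
  then have "measure lborel (K - ?L) = measure lborel K - (1 - r) ^ ?n * measure lborel K"
    using measurable_measure_Diff[OF fmK _ LK] L by simp
  also have "\<dots> = (1 - (1 - r) ^ ?n) * measure lborel K"
    by (simp add: algebra_simps)
  finally have 2: "(1 - (1 - r) ^ ?n) * measure lborel K \<le> unit_ball_vol ?n * (2 * r) ^ ?n"
    using 1 by simp
  \<comment> \<open>The dimension is at least 1, so the removed fraction is at least r. Dividing by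
    this r lowers the exponent of the bound from n to n - 1, the dimension of the sphere.\<close>
  have "(1 - r) ^ ?n \<le> (1 - r) ^ 1"
    using r by (intro power_decreasing) (auto simp: Suc_le_eq)
  then have "r * measure lborel K \<le> (1 - (1 - r) ^ ?n) * measure lborel K"
    by (intro mult_right_mono) auto
  with 2 have "r * measure lborel K \<le> unit_ball_vol ?n * (2 * r) ^ ?n" by simp
  also have "\<dots> = r * (unit_ball_vol ?n * 2 ^ ?n * r ^ (?n - 1))"
    using power_Suc[of r "?n - 1"] by (simp add: power_mult_distrib)
  finally have "measure lborel K \<le> unit_ball_vol ?n * 2 ^ ?n * r ^ (?n - 1)"
    using r by simp
  then have "real ?n * measure lborel K \<le> real ?n * (unit_ball_vol ?n * 2 ^ ?n * r ^ (?n - 1))"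
    by (intro mult_left_mono) auto
  moreover have "measure sphere_volume A = real ?n * measure lborel K"
    using emeasure_sphere_volume[OF A] by (simp add: measure_def K_def enn2real_mult)
  ultimately show ?thesis
    by (simp add: A_def sphere_area_def mult.assoc)
qed

lemma sphere_cap:
  fixes z :: "'a::euclidean_space"
  assumes z: "norm z = 1" and r: "0 < r"
  shows "measure sphere_volume {\<zeta> \<in> sphere 0 1. norm (z - \<zeta>) \<le> r} \<le>
    sphere_area TYPE('a) * 2 ^ DIM('a) * r ^ (DIM('a) - 1)"
proof (cases "r < 1")
  case False
  have "measure sphere_volume {\<zeta> \<in> sphere 0 1. norm (z - \<zeta>) \<le> r} \<le> measure (sphere_volume :: 'a measure) (space sphere_volume)"
    by (rule finite_measure.bounded_measure[OF finite_measure_sphere_volume])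
  also have "\<dots> = sphere_area TYPE('a) * (1 * 1)"
    by (simp add: measure_space_sphere_volume)
  also have "\<dots> \<le> sphere_area TYPE('a) * (2 ^ DIM('a) * r ^ (DIM('a) - 1))"
    using False sphere_area_pos[where ?'a = 'a]
    by (intro mult_left_mono mult_mono) auto
  finally show ?thesis by (simp add: mult.assoc)
qed (use sphere_cap_small[OF z r] in auto)

text \<open>Decompose the sphere into dyadic annuli \<open>2 powr - j < norm (z - \<zeta>) \<le> 2 powr (1 - j)\<close>.\<close>

lemma nn_integral_riesz_kernel:
  fixes z :: "'a::euclidean_space"
  assumes z: "norm z = 1" and g: "0 < \<gamma>" "\<gamma> \<le> real (DIM('a) - 1)"
  shows "(\<integral>\<^sup>+\<zeta>. ennreal (norm (z - \<zeta>) powr (\<gamma> - real (DIM('a) - 1))) \<partial>sphere_volume) \<le>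
    ennreal (sphere_area TYPE('a) * 2 ^ DIM('a) * 2 ^ (DIM('a) - 1) / (1 - 2 powr (- \<gamma>)))"
proof -
  define C where "C = sphere_area TYPE('a) * 2 ^ DIM('a)"
  define k where "k = DIM('a) - 1"
  have C: "C > 0" by (simp add: C_def sphere_area_pos)
  let ?A = "\<lambda>j::nat. {\<zeta> \<in> sphere 0 1. norm (z - \<zeta>) \<le> 2 * (1/2) ^ j}"
  let ?f = "\<lambda>(j::nat) \<zeta>. ennreal (((1/2) ^ j) powr (\<gamma> - k)) * indicator (?A j) \<zeta>"
  have A: "?A j \<in> sets sphere_volume" for j
    by (auto simp: sets_restrict_space_iff)
  have pt: "ennreal (norm (z - \<zeta>) powr (\<gamma> - k)) \<le> (\<Sum>j. ?f j \<zeta>)" if \<zeta>: "\<zeta> \<in> sphere 0 1" for \<zeta>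
  proof (cases "\<zeta> = z")
    case False
    define d where "d = norm (z - \<zeta>)"
    have d: "0 < d" "d \<le> 2"
      using False \<zeta> z norm_triangle_ineq4[of z \<zeta>] by (auto simp: d_def)
    obtain m where m: "(1/2) ^ m < d"
      using real_arch_pow_inv[OF d(1), of "1/2"] by auto
    \<comment> \<open>Minimality of \<open>j\<close> gives the upper bound on \<open>d\<close>
      through the failure at \<open>j - 1\<close>; for \<open>j = 0\<close> that bound is the
      diameter 2 of the sphere.\<close>
    define j where "j = (LEAST j. (1/2::real) ^ j < d)"
    have j: "(1/2) ^ j < d" unfolding j_def using m by (rule LeastI)
    have j2: "d \<le> 2 * (1/2) ^ j"
    proof (cases j)
      case (Suc i)
      then have "\<not> (1/2) ^ i < d"
        using not_less_Least[of i "\<lambda>j. (1/2::real) ^ j < d"] by (simp add: j_def)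
      with Suc show ?thesis by simp
    qed (use d in auto)
    \<comment> \<open>The exponent is nonpositive because \<gamma> \<le> k, so the kernel is largest
      at the inner radius of the annulus.\<close>
    have "d powr (\<gamma> - k) \<le> ((1/2) ^ j) powr (\<gamma> - k)"
      using j g by (intro powr_mono2') (auto simp: k_def)
    then have "ennreal (d powr (\<gamma> - k)) \<le> ?f j \<zeta>"
      using j2 \<zeta> by (auto simp: d_def)
    also have "\<dots> \<le> (\<Sum>j. ?f j \<zeta>)"
    proof -
      have "h j \<le> suminf h" for h :: "nat \<Rightarrow> ennreal"
        using sum_le_suminf[of h "{j}"] by simp
      then show ?thesis .
    qed
    finally show ?thesis by (simp add: d_def)
  qed auto
  have "(\<integral>\<^sup>+\<zeta>. ennreal (norm (z - \<zeta>) powr (\<gamma> - k)) \<partial>sphere_volume) \<le>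
      (\<integral>\<^sup>+\<zeta>. (\<Sum>j. ?f j \<zeta>) \<partial>sphere_volume)"
    by (rule nn_integral_mono) (use pt in auto)
  also have "\<dots> = (\<Sum>j. \<integral>\<^sup>+\<zeta>. ?f j \<zeta> \<partial>sphere_volume)"
    using A by (intro nn_integral_suminf) auto
  also have "\<dots> = (\<Sum>j. ennreal (((1/2) ^ j) powr (\<gamma> - k)) * emeasure sphere_volume (?A j))"
    using A by (subst nn_integral_cmult_indicator) auto
  also have "\<dots> \<le> (\<Sum>j. ennreal (C * 2 ^ k * (2 powr (- \<gamma>)) ^ j))"
  proof (intro suminf_le summableI)
    fix j :: nat
    have "emeasure sphere_volume (?A j) \<le> ennreal (C * (2 * (1/2) ^ j) ^ k)"
      using sphere_cap[OF z, of "2 * (1/2) ^ j"]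
      by (subst finite_measure.emeasure_eq_measure[OF finite_measure_sphere_volume])
         (unfold C_def k_def, intro ennreal_leI, simp)
    then have "ennreal (((1/2) ^ j) powr (\<gamma> - k)) * emeasure sphere_volume (?A j) \<le>
       ennreal (((1/2) ^ j) powr (\<gamma> - k)) * ennreal (C * (2 * (1/2) ^ j) ^ k)"
      by (intro mult_left_mono) auto
    also have "\<dots> = ennreal (((1/2) ^ j) powr (\<gamma> - k) * (C * (2 * (1/2) ^ j) ^ k))"
      using C by (simp add: ennreal_mult')
    also have "((1/2) ^ j) powr (\<gamma> - k) * (C * (2 * (1/2) ^ j) ^ k) =
        C * 2 ^ k * (((1/2::real) ^ j) powr (\<gamma> - k) * ((1/2) ^ j) ^ k)"
      by (simp add: power_mult_distrib)
    \<comment> \<open>The measure of the cap has order k in its radius and compensates the power -k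
      of the kernel; what remains is a geometric series of ratio 2^(-\<gamma>).\<close>
    also have "((1/2::real) ^ j) powr (\<gamma> - k) * ((1/2) ^ j) ^ k = ((1/2) ^ j) powr \<gamma>"
      by (simp add: powr_diff powr_realpow)
    also have "((1/2::real) ^ j) powr \<gamma> = (2 powr (- \<gamma>)) ^ j"
      by (simp add: powr_minus powr_powr powr_divide power_divide divide_simps
               flip: powr_realpow) (simp add: mult.commute)
    finally show "ennreal (((1/2) ^ j) powr (\<gamma> - k)) * emeasure sphere_volume (?A j) \<le>
       ennreal (C * 2 ^ k * (2 powr (- \<gamma>)) ^ j)" .
  qed
  also have "\<dots> = ennreal (\<Sum>j. C * 2 ^ k * (2 powr (- \<gamma>)) ^ j)"
  proof (rule suminf_ennreal2)
    have "2 powr (- \<gamma>) < 1" using g powr_less_mono[of "- \<gamma>" 0 2] by simp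
    then show "summable (\<lambda>j. C * 2 ^ k * (2 powr (- \<gamma>)) ^ j)"
      by (intro summable_mult summable_geometric) auto
  qed (use C in auto)
  also have "(\<Sum>j. C * 2 ^ k * (2 powr (- \<gamma>)) ^ j) = C * 2 ^ k / (1 - 2 powr (- \<gamma>))"
    using g powr_less_mono[of "- \<gamma>" 0 2]
    by (subst suminf_mult) (auto simp: suminf_geometric intro!: summable_geometric)
  finally show ?thesis by (simp add: C_def k_def)
qed

text \<open>One \<open>B\<close> serves every centre \<open>z\<close>. This uniformity later yields
  bounds in the supremum norm and the convergence of double integrals over the sphere.\<close>

lemma riesz_kernel_bound:
  assumes "0 < \<gamma>" "\<gamma> \<le> real (DIM('a) - 1)"
  obtains B where "B \<ge> 0"
    "\<And>z::'a::euclidean_space. norm z = 1 \<Longrightarrow>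
       integrable sphere_volume (\<lambda>\<zeta>. norm (z - \<zeta>) powr (\<gamma> - real (DIM('a) - 1)))"
    "\<And>z::'a. norm z = 1 \<Longrightarrow>
       (LINT \<zeta>|sphere_volume. norm (z - \<zeta>) powr (\<gamma> - real (DIM('a) - 1))) \<le> B"
proof
  let ?B = "sphere_area TYPE('a) * 2 ^ DIM('a) * 2 ^ (DIM('a) - 1) / (1 - 2 powr (- \<gamma>))"
  show B: "0 \<le> ?B"
    using assms sphere_area_pos[where ?'a = 'a] powr_mono[of "- \<gamma>" 0 2]
    by (intro divide_nonneg_nonneg) auto
  fix z :: 'a assume z: "norm z = 1"
  have m: "(\<lambda>\<zeta>. norm (z - \<zeta>) powr (\<gamma> - real (DIM('a) - 1))) \<in> borel_measurable sphere_volume"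
    by (rule borel_measurable_sphere_volume) measurable
  show i: "integrable sphere_volume (\<lambda>\<zeta>. norm (z - \<zeta>) powr (\<gamma> - real (DIM('a) - 1)))"
    using nn_integral_riesz_kernel[OF z assms]
    by (intro integrableI_bounded m) (auto simp: top.not_eq_extremum intro: le_less_trans)
  show "(LINT \<zeta>|sphere_volume. norm (z - \<zeta>) powr (\<gamma> - real (DIM('a) - 1))) \<le> ?B"
    using nn_integral_riesz_kernel[OF z assms] B
    by (subst (asm) nn_integral_eq_integral[OF i]) (auto simp: ennreal_le_iff)
qed

section \<open>The divergence theorem and the symmetry of the Laplace-Beltrami operator\<close>

lemma radial_ext_sphere: "z \<in> sphere 0 1 \<Longrightarrow> radial_ext f z = f z"
  by (simp add: radial_ext_def)

lemma radial_ext_scaleR: "c > 0 \<Longrightarrow> radial_ext f (c *\<^sub>R x) = radial_ext f x"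
proof -
  assume "c > 0"
  then have "(c *\<^sub>R x) /\<^sub>R norm (c *\<^sub>R x) = x /\<^sub>R norm x" by simp
  then show ?thesis by (simp only: radial_ext_def)
qed

section \<open>Integrals of derivatives of compactly supported functions\<close>

lemma integral_lborel_translation:
  fixes f :: "'a::euclidean_space \<Rightarrow> real"
  assumes "f \<in> borel_measurable borel"
  shows "(LINT x|lborel. f (c + x)) = (LINT x|lborel. f x)"
proof -
  have "(LINT x|lborel. f x) = (LINT x|distr lborel borel ((+) c). f x)"
    by (simp add: lborel_distr_plus)
  also have "\<dots> = (LINT x|lborel. f (c + x))"
    using assms by (subst integral_distr) auto
  finally show ?thesis ..
qed

lemma integrable_compact_support:
  fixes f :: "'a::euclidean_space \<Rightarrow> real"
  assumes "f \<in> borel_measurable borel" "\<And>x. \<bar>f x\<bar> \<le> B" "\<And>x. x \<notin> cball 0 R \<Longrightarrow> f x = 0"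
  shows "integrable lborel f"
proof -
  have "set_integrable lborel (cball (0::'a) R) (\<lambda>_. B)"
    unfolding set_integrable_def using emeasure_lborel_cball_finite[of "0::'a" R]
    by (intro integrable_scaleR_left integrable_real_indicator) auto
  then have "integrable lborel (\<lambda>x::'a. indicator (cball 0 R) x * B)"
    by (simp add: set_integrable_def)
  then show ?thesis
    by (rule Bochner_Integration.integrable_bound)
       (use assms in \<open>auto simp: indicator_def split: if_splits intro: order_trans[OF _ abs_ge_self]\<close>)
qed

text \<open>Each difference quotient has integral zero by translation invariance and is dominated
  through the Lipschitz bound, so the limit has integral zero. The derivative is only assumed
  bounded, not continuous; its measurability comes from being a pointwise limit of the
  quotients.\<close>

lemma integral_directional_derivative_0:
  fixes G :: "'a::euclidean_space \<Rightarrow> real"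
  assumes D: "\<And>x. (G has_derivative G' x) (at x)"
    and B: "\<And>x h. \<bar>G' x h\<bar> \<le> B * norm h"
    and supp: "\<And>x. x \<notin> cball 0 R \<Longrightarrow> G x = 0"
  shows "integrable lborel (\<lambda>x. G' x b)" "(LINT x|lborel. G' x b) = 0"
proof -
  have cont: "continuous_on UNIV G"
    using D by (meson continuous_at_imp_continuous_on has_derivative_continuous)
  then have meas [measurable]: "G \<in> borel_measurable borel"
    by (rule borel_measurable_continuous_onI)
  have Lip: "\<bar>G (x + h) - G x\<bar> \<le> B * norm h" for x h
  proof -
    have "norm (G (x + h) - G x) \<le> B * norm ((x + h) - x)"
    proof (rule differentiable_bound[of UNIV])
      show "onorm (G' x) \<le> B" for x
      proof (rule onorm_bound)
        obtain b :: 'a where "b \<in> Basis" using nonempty_Basis by blast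
        then show "0 \<le> B" using order_trans[OF abs_ge_zero B[of x b]] by simp
      qed (use B[of x] in auto)
    qed (use D has_derivative_at_withinI in auto)
    then show ?thesis by simp
  qed
  have "bounded (G ` cball 0 R)"
    by (intro compact_imp_bounded compact_continuous_image continuous_on_subset[OF cont]) auto
  then obtain K where "\<And>x. x \<in> cball 0 R \<Longrightarrow> norm (G x) \<le> K"
    unfolding bounded_iff by blast
  then have K: "\<bar>G x\<bar> \<le> max K 0" for x
    using supp[of x] by (cases "x \<in> cball 0 R") force+
  have int: "integrable lborel G"
    by (rule integrable_compact_support[OF meas K supp])
  define s where "s k = 1 / real (Suc k)" for k
  have s: "s k > 0" "s k \<le> 1" for k by (auto simp: s_def field_simps)
  have s0: "s \<longlonglongrightarrow> 0" unfolding s_def by (rule LIMSEQ_Suc[OF lim_1_over_n])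
  define Q where "Q k x = (G (s k *\<^sub>R b + x) - G x) / s k" for k x
  have Qlim: "(\<lambda>k. Q k x) \<longlonglongrightarrow> G' x b" for x
  proof -
    have "((\<lambda>t. G (x + t *\<^sub>R b)) has_derivative (\<lambda>t. G' x (t *\<^sub>R b))) (at 0)"
      by (rule has_derivative_compose[of "\<lambda>t. x + t *\<^sub>R b", where g = G])
         (auto intro!: derivative_eq_intros simp: D)
    moreover have "(\<lambda>t. G' x (t *\<^sub>R b)) = (\<lambda>t. t * G' x b)"
      using linear_scale[OF has_derivative_linear[OF D]] by auto
    ultimately have "((\<lambda>t. G (x + t *\<^sub>R b)) has_field_derivative G' x b) (at 0)"
      by (simp add: has_field_derivative_def mult_commute_abs)
    then have "((\<lambda>t. (G (x + t *\<^sub>R b) - G x) / t) \<longlongrightarrow> G' x b) (at 0)"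
      by (simp add: has_field_derivative_iff)
    then have "(\<lambda>k. (G (x + s k *\<^sub>R b) - G x) / s k) \<longlonglongrightarrow> G' x b"
      by (rule filterlim_compose) (use s0 s in \<open>auto simp: filterlim_at intro!: always_eventually
            simp: less_imp_neq[THEN not_sym]\<close>)
    then show ?thesis by (simp add: Q_def add.commute)
  qed
  \<comment> \<open>All step sizes are at most 1, so the translates vanish outside the ball enlarged
    by \<open>norm b\<close>.\<close>
  define w where "w x = indicator (cball 0 (R + norm b)) x * (B * norm b)" for x :: 'a
  have B0: "0 \<le> B * norm b" using B[of 0 b] abs_ge_zero order_trans by blast
  have w: "integrable lborel w"
    by (rule integrable_compact_support[where B = "B * norm b" and R = "R + norm b"])
       (use B0 in \<open>auto simp: w_def[abs_def] indicator_def mult_nonneg_nonneg\<close>)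
  have bound: "\<bar>Q k x\<bar> \<le> w x" for k x
  proof (cases "x \<in> cball 0 (R + norm b)")
    case True
    then show ?thesis
      using Lip[of x "s k *\<^sub>R b"] s[of k]
      by (simp add: Q_def w_def add.commute divide_le_eq) (simp add: mult_ac)
  next
    case False
    have "norm x \<le> norm (s k *\<^sub>R b + x) + norm (s k *\<^sub>R b)"
      using norm_triangle_ineq4[of "s k *\<^sub>R b + x" "s k *\<^sub>R b"] by simp
    also have "norm (s k *\<^sub>R b) \<le> norm b"
      using s[of k] by (simp add: mult_left_le_one_le)
    finally have "norm (s k *\<^sub>R b + x) > R" using False by simp
    moreover have "norm x > R" using False norm_ge_zero[of b] unfolding mem_cball_0 by linarith
    ultimately show ?thesis using False by (simp add: Q_def w_def supp)
  qed
  have Qm: "Q k \<in> borel_measurable lborel" for k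
    unfolding Q_def by measurable
  have lm: "(\<lambda>x. G' x b) \<in> borel_measurable lborel"
    by (rule borel_measurable_LIMSEQ_real[OF Qlim Qm])
  have Q0: "(LINT x|lborel. Q k x) = 0" for k
  proof -
    have i: "integrable lborel (\<lambda>x. G (s k *\<^sub>R b + x))"
    proof -
      have "integrable (distr lborel borel ((+) (s k *\<^sub>R b))) G"
        using int by (simp add: lborel_distr_plus)
      then show ?thesis by (subst (asm) integrable_distr_eq) auto
    qed
    have "(LINT x|lborel. Q k x) = ((LINT x|lborel. G (s k *\<^sub>R b + x)) - (LINT x|lborel. G x)) / s k"
      unfolding Q_def using i int by simp
    then show ?thesis by (simp add: integral_lborel_translation)
  qed
  show "integrable lborel (\<lambda>x. G' x b)"
    by (rule integrable_dominated_convergence[of _ _ Q w]) (use lm Qm w Qlim bound in auto)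
  have "(\<lambda>k. LINT x|lborel. Q k x) \<longlonglongrightarrow> (LINT x|lborel. G' x b)"
    by (rule integral_dominated_convergence[of _ _ Q w]) (use lm Qm w Qlim bound in auto)
  then show "(LINT x|lborel. G' x b) = 0"
    unfolding Q0 by (rule LIMSEQ_unique[OF _ tendsto_const, symmetric, THEN sym])
qed

section \<open>Calculus of continuously differentiable maps on the sphere\<close>

abbreviation sphere_deriv ::
    "('a::euclidean_space \<Rightarrow> 'b::real_normed_vector) \<Rightarrow> 'a \<Rightarrow> 'a \<Rightarrow> 'b" where
  "sphere_deriv f z \<equiv> frechet_derivative (radial_ext f) (at z)"

lemma sphere_C1_has_derivative:
  assumes "f \<in> sphere_C1" "norm z = 1"
  shows "(radial_ext f has_derivative sphere_deriv f z) (at z)"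
  using assms by (auto simp: sphere_C1_def frechet_derivative_works)

text \<open>The extension is homogeneous of degree 0, hence its derivative is homogeneous of degree
  -1: dividing the argument by the fixed number \<open>norm x\<close> moves the base point to the
  sphere.\<close>

lemma sphere_C1_has_derivative_off_sphere:
  fixes f :: "'a::euclidean_space \<Rightarrow> 'b::real_normed_vector"
  assumes "f \<in> sphere_C1" "x \<noteq> 0"
  shows "(radial_ext f has_derivative
    (\<lambda>h. sphere_deriv f (x /\<^sub>R norm x) (h /\<^sub>R norm x))) (at x)"
proof -
  have "((\<lambda>y. radial_ext f (y /\<^sub>R norm x)) has_derivative
    (\<lambda>h. sphere_deriv f (x /\<^sub>R norm x) (h /\<^sub>R norm x))) (at x)"
    by (rule has_derivative_compose[of "\<lambda>y. y /\<^sub>R norm x", where g = "radial_ext f"])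
       (use assms in \<open>auto intro!: derivative_eq_intros sphere_C1_has_derivative\<close>)
  moreover have "(\<lambda>y. radial_ext f (y /\<^sub>R norm x)) = radial_ext f"
    using assms(2) by (auto intro!: ext radial_ext_scaleR)
  ultimately show ?thesis by simp
qed

lemma sphere_C1_continuous_on:
  fixes f :: "'a::euclidean_space \<Rightarrow> 'b::real_normed_vector"
  assumes "f \<in> sphere_C1"
  shows "continuous_on (sphere 0 1) f"
proof -
  have "continuous_on (sphere 0 1) (radial_ext f)"
    using sphere_C1_has_derivative[OF assms]
    by (intro continuous_at_imp_continuous_on ballI) (metis has_derivative_continuous mem_sphere_0)
  then show ?thesis
    by (rule continuous_on_eq) (auto simp: radial_ext_sphere)
qed

lemma sphere_C1_radial_derivative:
  fixes f :: "'a::euclidean_space \<Rightarrow> 'b::real_normed_vector"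
  assumes "f \<in> sphere_C1" "norm z = 1"
  shows "sphere_deriv f z z = 0"
proof -
  let ?D = "sphere_deriv f z"

  have "((\<lambda>t. radial_ext f (z + t *\<^sub>R z)) has_derivative (\<lambda>t. ?D (t *\<^sub>R z))) (at (0::real))"
    by (rule has_derivative_compose[of "\<lambda>t. z + t *\<^sub>R z", where g = "radial_ext f"])
       (auto intro!: derivative_eq_intros simp: sphere_C1_has_derivative[OF assms])
  moreover have "((\<lambda>t. radial_ext f (z + t *\<^sub>R z)) has_derivative (\<lambda>t. 0)) (at (0::real))"
  proof (rule has_derivative_transform_within_open[of "\<lambda>t. radial_ext f z"])
    fix t :: real assume "t \<in> {-1<..}"
    then have "radial_ext f ((1 + t) *\<^sub>R z) = radial_ext f z" by (intro radial_ext_scaleR) auto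
    then show "radial_ext f z = radial_ext f (z + t *\<^sub>R z)" by (simp add: algebra_simps)
  qed auto
  ultimately have "(\<lambda>t::real. ?D (t *\<^sub>R z)) = (\<lambda>t. 0)"
    by (rule has_derivative_unique)
  from fun_cong[OF this, of 1] show ?thesis by simp
qed

text \<open>\<open>sphere_C1\<close> gives continuity in the base point for each fixed direction.
  Compactness bounds each basis direction, and finitely many of them control the operator norm
  uniformly.\<close>

lemma sphere_C1_derivative_bound:
  fixes f :: "'a::euclidean_space \<Rightarrow> 'b::real_normed_vector"
  assumes "f \<in> sphere_C1"
  obtains B where "B \<ge> 0" "\<And>z h. norm z = 1 \<Longrightarrow> norm (sphere_deriv f z h) \<le> B * norm h"
proof -
  let ?D = "\<lambda>z. sphere_deriv f z"
  have "\<exists>B. \<forall>z\<in>sphere 0 1. norm (?D z b) \<le> B" for b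
    using assms by (intro continuous_on_sphere_bounded) (auto simp: sphere_C1_def)
  then obtain K where K: "\<And>b z. z \<in> sphere 0 1 \<Longrightarrow> norm (?D z b) \<le> K b" by metis
  show thesis
  proof
    show "0 \<le> (\<Sum>b\<in>Basis. \<bar>K b\<bar>)" by (simp add: sum_nonneg)
    fix z h :: 'a assume z: "norm z = 1"
    have lin: "linear (?D z)"
      by (rule has_derivative_linear[OF sphere_C1_has_derivative[OF assms z]])
    have "?D z h = ?D z (\<Sum>b\<in>Basis. (h \<bullet> b) *\<^sub>R b)" by (simp add: euclidean_representation)
    also have "\<dots> = (\<Sum>b\<in>Basis. (h \<bullet> b) *\<^sub>R ?D z b)"
      by (simp add: linear_sum[OF lin] linear_scale[OF lin])
    finally have "norm (?D z h) \<le> (\<Sum>b\<in>Basis. norm ((h \<bullet> b) *\<^sub>R ?D z b))"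
      by (simp only: norm_sum)
    also have "\<dots> \<le> (\<Sum>b\<in>Basis. norm h * \<bar>K b\<bar>)"
    proof (rule sum_mono)
      fix b :: 'a assume "b \<in> Basis"
      have "norm ((h \<bullet> b) *\<^sub>R ?D z b) = \<bar>h \<bullet> b\<bar> * norm (?D z b)" by simp
      also have "\<dots> \<le> norm h * \<bar>K b\<bar>"
        using K[of z b] z Basis_le_norm[OF \<open>b \<in> Basis\<close>, of h]
        by (intro mult_mono) auto
      finally show "norm ((h \<bullet> b) *\<^sub>R ?D z b) \<le> norm h * \<bar>K b\<bar>" .
    qed
    finally show "norm (?D z h) \<le> (\<Sum>b\<in>Basis. \<bar>K b\<bar>) * norm h"
      by (simp add: sum_distrib_right mult.commute flip: sum_distrib_left)
  qed
qed

lemma sphere_div_continuous_on: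
  assumes "X \<in> sphere_C1"
  shows "continuous_on (sphere 0 1) (sphere_div X)"
proof -
  have "continuous_on (sphere 0 1) (\<lambda>z. sphere_deriv X z b)" for b
    using assms by (auto simp: sphere_C1_def)
  then show ?thesis
    unfolding sphere_div_def by (intro continuous_intros)
qed

text \<open>A continuously differentiable cutoff that increases with \<open>m\<close> to the indicator of \<open>{0<..<1}\<close>.\<close>

definition cutoff :: "nat \<Rightarrow> real \<Rightarrow> real" where
  "cutoff m \<rho> = 1 - (1 - (max 0 (\<rho> * (1 - \<rho>)))\<^sup>2) ^ m"

definition cutoff' :: "nat \<Rightarrow> real \<Rightarrow> real" where
  "cutoff' m \<rho> = real m * (1 - (max 0 (\<rho> * (1 - \<rho>)))\<^sup>2) ^ (m - 1) *
     (2 * max 0 (\<rho> * (1 - \<rho>)) * (1 - 2 * \<rho>))"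

text \<open>Squaring the positive part removes its kink at 0, which is what makes the cutoff
  differentiable across the unit sphere.\<close>

lemma max_0_power2_has_derivative:
  "((\<lambda>t::real. (max 0 t)\<^sup>2) has_field_derivative 2 * max 0 t) (at t)"
proof (cases "t = 0")
  case True
  have "((\<lambda>t::real. (max 0 t)\<^sup>2 / t) \<longlongrightarrow> 0) (at 0)"
  proof (rule Lim_null_comparison)
    show "\<forall>\<^sub>F t in at 0. norm ((max 0 t)\<^sup>2 / t) \<le> \<bar>t\<bar>"
      by (intro always_eventually allI) (auto simp: max_def power2_eq_square)
    show "((\<lambda>t::real. \<bar>t\<bar>) \<longlongrightarrow> 0) (at 0)" by (auto intro!: tendsto_eq_intros)
  qed
  then show ?thesis using True by (simp add: has_field_derivative_iff)
next
  case False
  show ?thesis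
  proof (cases "t > 0")
    case True
    have "((\<lambda>t::real. t\<^sup>2) has_field_derivative 2 * t) (at t)"
      by (auto intro!: derivative_eq_intros)
    then have "((\<lambda>t::real. (max 0 t)\<^sup>2) has_field_derivative 2 * t) (at t)"
      by (rule has_field_derivative_transform_within_open[of _ _ _ "{0<..}"]) (use True in auto)
    then show ?thesis using True by simp
  next
    case False
    with \<open>t \<noteq> 0\<close> have t: "t < 0" by simp
    have "((\<lambda>t::real. 0) has_field_derivative 0) (at t)" by simp
    then have "((\<lambda>t::real. (max 0 t)\<^sup>2) has_field_derivative 0) (at t)"
      by (rule has_field_derivative_transform_within_open[of _ _ _ "{..<0}"]) (use t in auto)
    then show ?thesis using t by simp
  qed
qed

lemma cutoff_has_derivative: "(cutoff m has_field_derivative cutoff' m \<rho>) (at \<rho>)"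
proof -
  have "((\<lambda>\<rho>. (max 0 (\<rho> * (1 - \<rho>)))\<^sup>2) has_field_derivative
     2 * max 0 (\<rho> * (1 - \<rho>)) * (1 - 2 * \<rho>)) (at \<rho>)"
    by (rule DERIV_chain2[OF max_0_power2_has_derivative]) (auto intro!: derivative_eq_intros)
  moreover have "((\<lambda>\<rho>. 1 - (1 - Q \<rho>) ^ m) has_field_derivative real m * (1 - Q \<rho>) ^ (m - 1) * q) (at \<rho>)"
    if "(Q has_field_derivative q) (at \<rho>)" for Q and q :: real
    using that by (auto intro!: derivative_eq_intros)
  ultimately show ?thesis
    unfolding cutoff_def[abs_def] cutoff'_def by blast
qed

lemma cutoff_inner_bounds:
  fixes \<rho> :: real
  assumes "0 \<le> \<rho>"
  shows "0 \<le> (max 0 (\<rho> * (1 - \<rho>)))\<^sup>2" "(max 0 (\<rho> * (1 - \<rho>)))\<^sup>2 \<le> 1"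
proof -
  have "\<rho> * (1 - \<rho>) \<le> 1"
  proof (cases "\<rho> \<le> 1")
    case True then show ?thesis using assms mult_mono[of \<rho> 1 "1 - \<rho>" 1] by auto
  next
    case False then have "\<rho> * (1 - \<rho>) \<le> 0" using assms by (simp add: mult_le_0_iff)
    then show ?thesis by simp
  qed
  then show "(max 0 (\<rho> * (1 - \<rho>)))\<^sup>2 \<le> 1" by (intro power_le_one) auto
qed auto

text \<open>The bound on the derivative may grow with \<open>m\<close>: it only shows, for each
  fixed \<open>m\<close>, that the cut-off field has a bounded derivative. The passage to the limit
  in \<open>m\<close> relies on the values lying between 0 and 1.\<close>

lemma cutoff_bounds:
  assumes "0 \<le> \<rho>"
  shows "0 \<le> cutoff m \<rho>" "cutoff m \<rho> \<le> 1" "\<bar>\<rho> * cutoff' m \<rho>\<bar> \<le> 2 * real m"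
proof -
  note b = cutoff_inner_bounds[OF assms]
  show "0 \<le> cutoff m \<rho>" "cutoff m \<rho> \<le> 1"
    unfolding cutoff_def using b by (auto intro!: power_le_one zero_le_power)
  show "\<bar>\<rho> * cutoff' m \<rho>\<bar> \<le> 2 * real m"
  proof (cases "\<rho> \<le> 1")
    case True
    define P where "P = (1 - (max 0 (\<rho> * (1 - \<rho>)))\<^sup>2) ^ (m - 1)"
    define M where "M = max 0 (\<rho> * (1 - \<rho>))"
    have P: "0 \<le> P" "P \<le> 1" unfolding P_def using b by (auto intro!: power_le_one)
    have M: "0 \<le> M" "M \<le> 1" unfolding M_def
      using True assms mult_mono[of \<rho> 1 "1 - \<rho>" 1] by auto
    have "\<bar>\<rho> * cutoff' m \<rho>\<bar> = 2 * real m * (\<rho> * (P * (M * \<bar>1 - 2 * \<rho>\<bar>)))"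
      using P M assms unfolding cutoff'_def P_def[symmetric] unfolding M_def[symmetric]
      by (simp add: abs_mult)
    also have "\<dots> \<le> 2 * real m * (1 * (1 * (1 * 1)))"
      using P M True assms by (intro mult_left_mono mult_mono) auto
    finally show ?thesis by simp
  next
    case False
    then have "\<rho> * (1 - \<rho>) \<le> 0" using assms by (simp add: mult_le_0_iff)
    then have "max 0 (\<rho> * (1 - \<rho>)) = 0" by simp
    then show ?thesis by (simp add: cutoff'_def)
  qed
qed

lemma cutoff_eq_0:
  assumes "1 \<le> \<rho>" shows "cutoff m \<rho> = 0"
proof -
  have "\<rho> * (1 - \<rho>) \<le> 0" using assms by (simp add: mult_le_0_iff)
  then have "max 0 (\<rho> * (1 - \<rho>)) = 0" by simp
  then show ?thesis by (simp add: cutoff_def)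
qed

lemma cutoff_0 [simp]: "cutoff m 0 = 0"
  by (simp add: cutoff_def)

lemma cutoff_tendsto:
  assumes "0 < \<rho>" "\<rho> < 1"
  shows "(\<lambda>m. cutoff m \<rho>) \<longlonglongrightarrow> 1"
proof -
  have "0 < max 0 (\<rho> * (1 - \<rho>))" using assms by (simp add: less_max_iff_disj)
  then have "\<bar>1 - (max 0 (\<rho> * (1 - \<rho>)))\<^sup>2\<bar> < 1"
    using cutoff_inner_bounds[of \<rho>] assms by (auto simp: abs_if)
  then have "(\<lambda>m. 1 - (1 - (max 0 (\<rho> * (1 - \<rho>)))\<^sup>2) ^ m) \<longlonglongrightarrow> 1 - 0"
    by (intro tendsto_diff tendsto_const LIMSEQ_power_zero) auto
  then show ?thesis by (simp add: cutoff_def)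
qed

lemma cutoff_field_has_derivative:
  fixes X :: "'a::euclidean_space \<Rightarrow> 'a"
  assumes X: "X \<in> sphere_C1" and x: "x \<noteq> 0"
  shows "((\<lambda>y. (norm y * cutoff m (norm y)) *\<^sub>R radial_ext X y) has_derivative
     (\<lambda>h. ((sgn x \<bullet> h) * (cutoff m (norm x) + norm x * cutoff' m (norm x))) *\<^sub>R radial_ext X x +
        cutoff m (norm x) *\<^sub>R sphere_deriv X (x /\<^sub>R norm x) h)) (at x)"
proof -
  let ?D = "sphere_deriv X (x /\<^sub>R norm x)"
  have nz: "norm (x /\<^sub>R norm x) = 1" using x by simp
  have lin: "linear ?D"
    by (rule has_derivative_linear[OF sphere_C1_has_derivative[OF X nz]])
  have d1: "((\<lambda>y. norm y * cutoff m (norm y)) has_derivative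
      (\<lambda>h. (sgn x \<bullet> h) * (cutoff m (norm x) + norm x * cutoff' m (norm x)))) (at x)"
  proof -
    have "((\<lambda>\<rho>. \<rho> * cutoff m \<rho>) has_derivative
       (*) (cutoff m (norm x) + norm x * cutoff' m (norm x))) (at (norm x))"
      unfolding has_field_derivative_def[symmetric]
      by (auto intro!: derivative_eq_intros cutoff_has_derivative)
    from has_derivative_compose[OF has_derivative_norm[OF x] this]
    show ?thesis by (simp add: mult.commute inner_commute)
  qed
  have "((\<lambda>y. (norm y * cutoff m (norm y)) *\<^sub>R radial_ext X y) has_derivative
     (\<lambda>h. (norm x * cutoff m (norm x)) *\<^sub>R ?D (h /\<^sub>R norm x) +
       ((sgn x \<bullet> h) * (cutoff m (norm x) + norm x * cutoff' m (norm x))) *\<^sub>R radial_ext X x)) (at x)"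
    by (rule has_derivative_scaleR[OF d1 sphere_C1_has_derivative_off_sphere[OF X x]])
  \<comment> \<open>The factor \<open>norm y\<close> in the field compensates the degree -1 of the
    derivative off the sphere, so the derivative at the projected point appears without a power of
    the radius.\<close>
  moreover have "norm x * c * inverse (norm x) = c" for c
    using x by simp
  ultimately show ?thesis
    by (simp add: linear_scale[OF lin] add.commute)
qed

text \<open>The radial extension need not have a limit at the origin, but it is bounded. The factor
  \<open>norm y\<close> and the vanishing of the cutoff at 0 make the field o(norm y), so it is
  differentiable on the whole space.\<close>

lemma cutoff_field_has_derivative_0:
  fixes X :: "'a::euclidean_space \<Rightarrow> 'a"
  assumes X: "X \<in> sphere_C1"
  shows "((\<lambda>y. (norm y * cutoff m (norm y)) *\<^sub>R radial_ext X y) has_derivative (\<lambda>h. 0)) (at 0)"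
proof -
  obtain K where K: "\<And>z. z \<in> sphere 0 1 \<Longrightarrow> norm (X z) \<le> K"
    using continuous_on_sphere_bounded[OF sphere_C1_continuous_on[OF X]] by blast
  have K': "norm (radial_ext X y) \<le> K" if "y \<noteq> 0" for y
    unfolding radial_ext_def by (rule K) (use that in auto)
  have c: "isCont (cutoff m) (norm (0::'a))"
    using cutoff_has_derivative DERIV_isCont by blast
  have "((\<lambda>h::'a. cutoff m (norm h) * K) \<longlongrightarrow> cutoff m (norm (0::'a)) * K) (at 0)"
    by (intro tendsto_mult tendsto_const isCont_tendsto_compose[OF c] tendsto_norm tendsto_ident_at)
  then have lim: "((\<lambda>h::'a. cutoff m (norm h) * K) \<longlongrightarrow> 0) (at 0)"
    by (simp add: cutoff_def)
  show ?thesis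
    unfolding has_derivative_at
  proof (intro conjI)
    show "(\<lambda>h::'a. norm ((norm (0 + h) * cutoff m (norm (0 + h))) *\<^sub>R radial_ext X (0 + h) -
              (norm (0::'a) * cutoff m (norm (0::'a))) *\<^sub>R radial_ext X 0 - 0) / norm h) \<midarrow>0\<rightarrow> 0"
    proof (rule Lim_null_comparison[OF _ lim])
      show "\<forall>\<^sub>F h in at 0. norm (norm ((norm (0 + h) * cutoff m (norm (0 + h))) *\<^sub>R radial_ext X (0 + h) -
              (norm (0::'a) * cutoff m (norm (0::'a))) *\<^sub>R radial_ext X 0 - 0) / norm h) \<le> cutoff m (norm h) * K"
        using K' cutoff_bounds(1) by (auto simp: eventually_at_filter intro!: always_eventually mult_left_mono)
    qed
  qed auto
qed

text \<open>The divergence of the compactly supported field \<open>\<rho> * cutoff m \<rho> * X\<close> on the ambient space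
  is \<open>cutoff m \<rho>\<close> times the divergence on the sphere, because \<open>X\<close> is tangential.\<close>

theorem integral_sphere_div:
  fixes X :: "'a::euclidean_space \<Rightarrow> 'a"
  assumes X: "X \<in> sphere_C1" and tan: "\<And>z. norm z = 1 \<Longrightarrow> X z \<bullet> z = 0"
  shows "(LINT z|sphere_volume. sphere_div X z) = 0"
proof -
  let ?D = "\<lambda>x. sphere_deriv X (x /\<^sub>R norm x)"
  define g where "g = sphere_div X"
  have gc: "continuous_on (sphere 0 1) g"
    unfolding g_def by (rule sphere_div_continuous_on[OF X])
  define F' where "F' m x h = (if x = 0 then 0 else
      ((sgn x \<bullet> h) * (cutoff m (norm x) + norm x * cutoff' m (norm x))) *\<^sub>R radial_ext X x +
        cutoff m (norm x) *\<^sub>R ?D x h)" for m x h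
  have F': "((\<lambda>y. (norm y * cutoff m (norm y)) *\<^sub>R radial_ext X y) has_derivative F' m x) (at x)" for m x
  proof (cases "x = 0")
    case True
    then have "F' m x = (\<lambda>h. 0)" by (simp add: F'_def fun_eq_iff)
    then show ?thesis using cutoff_field_has_derivative_0[OF X, of m] True by (simp only:)
  next
    case False
    then have "F' m x = (\<lambda>h. ((sgn x \<bullet> h) * (cutoff m (norm x) + norm x * cutoff' m (norm x))) *\<^sub>R radial_ext X x +
        cutoff m (norm x) *\<^sub>R ?D x h)" by (simp add: F'_def fun_eq_iff)
    then show ?thesis using cutoff_field_has_derivative[OF X False, of m] by (simp only:)
  qed
  obtain B where B: "B \<ge> 0" "\<And>z h. norm z = 1 \<Longrightarrow> norm (sphere_deriv X z h) \<le> B * norm h"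
    using sphere_C1_derivative_bound[OF X] by blast
  obtain K where K: "\<And>z. z \<in> sphere 0 1 \<Longrightarrow> norm (X z) \<le> K"
    using continuous_on_sphere_bounded[OF sphere_C1_continuous_on[OF X]] by blast
  have K': "norm (radial_ext X y) \<le> K" if "y \<noteq> 0" for y
    unfolding radial_ext_def by (rule K) (use that in auto)
  have bnd: "norm (F' m x h) \<le> ((1 + 2 * real m) * \<bar>K\<bar> + B) * norm h" for m x h
  proof (cases "x = 0")
    case False
    have nz: "norm (x /\<^sub>R norm x) = 1" using False by simp
    have s: "\<bar>sgn x \<bullet> h\<bar> \<le> norm h"
      using Cauchy_Schwarz_ineq2[of "sgn x" h] False by (simp add: norm_sgn)
    have c: "\<bar>cutoff m (norm x) + norm x * cutoff' m (norm x)\<bar> \<le> 1 + 2 * real m"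
      using cutoff_bounds[of "norm x" m] by auto
    have "norm (F' m x h) \<le> \<bar>sgn x \<bullet> h\<bar> * \<bar>cutoff m (norm x) + norm x * cutoff' m (norm x)\<bar> * norm (radial_ext X x)
        + \<bar>cutoff m (norm x)\<bar> * norm (?D x h)"
      using False by (simp add: F'_def norm_triangle_le abs_mult)
    also have "\<dots> \<le> norm h * (1 + 2 * real m) * \<bar>K\<bar> + 1 * (B * norm h)"
      using s c K'[OF False] B(2)[OF nz, of h] cutoff_bounds[of "norm x" m]
      by (intro add_mono mult_mono) auto
    finally show ?thesis by (simp add: algebra_simps)
  qed (use B(1) in \<open>auto simp: F'_def\<close>)
  have zero: "integrable lborel (\<lambda>x. F' m x b \<bullet> b)" "(LINT x|lborel. F' m x b \<bullet> b) = 0" if b: "b \<in> Basis" for m b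
  proof -
    have d: "((\<lambda>y. ((norm y * cutoff m (norm y)) *\<^sub>R radial_ext X y) \<bullet> b) has_derivative (\<lambda>h. F' m x h \<bullet> b)) (at x)" for x
      by (intro has_derivative_inner_left F')
    have e: "\<bar>F' m x h \<bullet> b\<bar> \<le> ((1 + 2 * real m) * \<bar>K\<bar> + B) * norm h" for x h
      using Basis_le_norm[OF b, of "F' m x h"] bnd[of m x h] by linarith
    have s: "((norm y * cutoff m (norm y)) *\<^sub>R radial_ext X y) \<bullet> b = 0" if "y \<notin> cball 0 1" for y
      using that by (simp add: cutoff_eq_0)
    show "integrable lborel (\<lambda>x. F' m x b \<bullet> b)" "(LINT x|lborel. F' m x b \<bullet> b) = 0"
      using integral_directional_derivative_0[OF d e s] by auto
  qed
  have div: "(\<Sum>b\<in>Basis. F' m x b \<bullet> b) = cutoff m (norm x) * g (x /\<^sub>R norm x)" for m x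
  proof (cases "x = 0")
    case False
    define c where "c = cutoff m (norm x) + norm x * cutoff' m (norm x)"
    have "(\<Sum>b\<in>Basis. F' m x b \<bullet> b) = (\<Sum>b\<in>Basis. c * ((sgn x \<bullet> b) * (radial_ext X x \<bullet> b)) + cutoff m (norm x) * (?D x b \<bullet> b))"
      using False unfolding F'_def c_def[symmetric]
      by (intro sum.cong refl) (simp add: inner_add_left mult_ac)
    also have "\<dots> = c * (sgn x \<bullet> radial_ext X x) + cutoff m (norm x) * g (x /\<^sub>R norm x)"
      unfolding sum.distrib g_def sphere_div_def euclidean_inner[of "sgn x" "radial_ext X x"] sum_distrib_left ..
    \<comment> \<open>All derivatives of the radial factor are collected in \<open>c\<close>, and
      \<open>c\<close> multiplies only the normal component of the field.\<close>
    also have "sgn x \<bullet> radial_ext X x = 0"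
      using tan[of "x /\<^sub>R norm x"] False by (simp add: radial_ext_def sgn_div_norm inner_commute)
    finally show ?thesis by simp
  qed (simp add: F'_def cutoff_def)
  have z1: "integrable lborel (\<lambda>x. cutoff m (norm x) * g (x /\<^sub>R norm x))"
           "(LINT x|lborel. cutoff m (norm x) * g (x /\<^sub>R norm x)) = 0" for m
    unfolding div[symmetric] using zero[of _ m] by (auto simp: Bochner_Integration.integral_sum)
  obtain L where L: "\<And>z. z \<in> sphere 0 1 \<Longrightarrow> norm (g z) \<le> L"
    using continuous_on_sphere_bounded[OF gc] by blast
  have L': "\<bar>g (x /\<^sub>R norm x)\<bar> \<le> L" if "x \<noteq> 0" for x
    using L[of "x /\<^sub>R norm x"] that by auto
  let ?G = "\<lambda>x. indicator (ball 0 1 - {0}) x * g (x /\<^sub>R norm x)"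
  have lim: "(\<lambda>m. cutoff m (norm x) * g (x /\<^sub>R norm x)) \<longlonglongrightarrow> ?G x" for x
  proof (cases "x \<in> ball 0 1 - {0}")
    case True
    then have "(\<lambda>m. cutoff m (norm x) * g (x /\<^sub>R norm x)) \<longlonglongrightarrow> 1 * g (x /\<^sub>R norm x)"
      by (intro tendsto_mult tendsto_const cutoff_tendsto) auto
    then show ?thesis using True by simp
  next
    case False
    then have "cutoff m (norm x) = 0" for m
      by (cases "x = 0") (auto simp: cutoff_eq_0)
    then show ?thesis using False by simp
  qed
  define w where "w x = indicator (cball 0 1) x * \<bar>L\<bar>" for x :: 'a
  have w: "integrable lborel w"
    by (rule integrable_compact_support[where B = "\<bar>L\<bar>" and R = 1]) (auto simp: w_def[abs_def] indicator_def)
  have dom: "\<bar>cutoff m (norm x) * g (x /\<^sub>R norm x)\<bar> \<le> w x" for m x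
  proof (cases "x \<in> cball 0 1 - {0}")
    case True
    then have "\<bar>cutoff m (norm x)\<bar> * \<bar>g (x /\<^sub>R norm x)\<bar> \<le> 1 * \<bar>L\<bar>"
      using L'[of x] cutoff_bounds[of "norm x" m] by (intro mult_mono) auto
    then show ?thesis using True by (simp add: w_def abs_mult)
  next
    case False
    then have "cutoff m (norm x) = 0"
      by (cases "x = 0") (auto simp: cutoff_eq_0)
    then show ?thesis by (simp add: w_def)
  qed
  have meas: "(\<lambda>x. cutoff m (norm x) * g (x /\<^sub>R norm x)) \<in> borel_measurable lborel" for m
    using z1(1) by blast
  have Gm: "?G \<in> borel_measurable lborel"
    by (rule borel_measurable_LIMSEQ_real[OF lim meas])
  have "(\<lambda>m. LINT x|lborel. cutoff m (norm x) * g (x /\<^sub>R norm x)) \<longlonglongrightarrow> (LINT x|lborel. ?G x)"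
    by (rule integral_dominated_convergence[of _ _ _ w]) (use Gm meas w lim dom in auto)
  then have G0: "(LINT x|lborel. ?G x) = 0"
    unfolding z1(2) using LIMSEQ_unique tendsto_const by blast
  \<comment> \<open>The cutoffs converge to the indicator of the open punctured ball, whereas
    \<open>sphere_volume\<close> is built on the closed one; the difference is a null set.\<close>
  have null: "sphere (0::'a) 1 \<in> null_sets lborel"
    using negligible_sphere[of "0::'a" 1]
    by (simp add: negligible_iff_null_sets null_sets_completion_iff)
  have "(LINT x:cball 0 1 - {0}|lborel. g (x /\<^sub>R norm x)) = (LINT x|lborel. ?G x)"
    unfolding set_lebesgue_integral_def
  proof (rule integral_cong_AE)
    have c: "continuous_on (- {0}) (\<lambda>x. g (x /\<^sub>R norm x))"
      by (rule continuous_on_compose2[OF gc]) (auto intro!: continuous_intros simp: field_simps split: if_splits)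
    have m: "(\<lambda>x. indicator (- {0}) x *\<^sub>R g (x /\<^sub>R norm x)) \<in> borel_measurable borel"
      by (rule borel_measurable_continuous_on_indicator[OF _ c]) auto
    have "(\<lambda>x. indicator (cball 0 1) x * (indicator (- {0}) x *\<^sub>R g (x /\<^sub>R norm x))) \<in> borel_measurable borel"
      by (intro borel_measurable_times borel_measurable_indicator m) auto
    also have "(\<lambda>x. indicator (cball 0 1) x * (indicator (- {0}) x *\<^sub>R g (x /\<^sub>R norm x))) =
        (\<lambda>x. indicator (cball 0 1 - {0}) x *\<^sub>R g (x /\<^sub>R norm x))"
      by (auto simp: indicator_def)
    finally show "(\<lambda>x. indicator (cball 0 1 - {0}) x *\<^sub>R g (x /\<^sub>R norm x)) \<in> borel_measurable lborel"
      by simp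
    show "?G \<in> borel_measurable lborel" by (rule Gm)
    have "AE x in lborel. x \<notin> sphere (0::'a) 1" by (rule AE_not_in[OF null])
    then show "AE x in lborel. indicator (cball 0 1 - {0}) x *\<^sub>R g (x /\<^sub>R norm x) = ?G x"
      by eventually_elim (auto simp: indicator_def)
  qed
  with G0 show ?thesis
    using integral_sphere_volume[OF borel_measurable_sphere_volume_continuous[OF gc]]
    by (simp add: g_def)
qed

text \<open>Pairing the gradient with \<open>z\<close> gives the derivative of the radial extension
  in the direction \<open>z\<close>, along which the extension is constant.\<close>

lemma sphere_grad_tangential:
  fixes u :: "'a::euclidean_space \<Rightarrow> real"
  assumes "u \<in> sphere_C1" "norm z = 1"
  shows "sphere_grad u z \<bullet> z = 0"
proof -
  let ?D = "sphere_deriv u z"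
  have lin: "linear ?D"
    by (rule has_derivative_linear[OF sphere_C1_has_derivative[OF assms]])
  have "?D z = ?D (\<Sum>b\<in>Basis. (z \<bullet> b) *\<^sub>R b)" by (simp add: euclidean_representation)
  also have "\<dots> = (\<Sum>b\<in>Basis. (z \<bullet> b) * ?D b)"
    by (simp add: linear_sum[OF lin] linear_scale[OF lin])
  finally have "(\<Sum>b\<in>Basis. (z \<bullet> b) * ?D b) = 0"
    using sphere_C1_radial_derivative[OF assms] by simp
  moreover have "(\<Sum>b\<in>Basis. (z \<bullet> b) * ?D b) = (\<Sum>b\<in>Basis. ?D b * (b \<bullet> z))"
    by (intro sum.cong refl) (simp only: mult.commute inner_commute)
  ultimately show ?thesis
    by (simp add: sphere_grad_def inner_sum_left)
qed

lemma sphere_C1_scaleR: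
  fixes u :: "'a::euclidean_space \<Rightarrow> real" and X :: "'a \<Rightarrow> 'b::real_normed_vector"
  assumes u: "u \<in> sphere_C1" and X: "X \<in> sphere_C1"
  shows "(\<lambda>z. u z *\<^sub>R X z) \<in> sphere_C1"
    and "\<And>z h. norm z = 1 \<Longrightarrow> sphere_deriv (\<lambda>z. u z *\<^sub>R X z) z h =
      u z *\<^sub>R sphere_deriv X z h + sphere_deriv u z h *\<^sub>R X z"
proof -
  have *: "(radial_ext (\<lambda>z. u z *\<^sub>R X z) has_derivative (\<lambda>h.
      u z *\<^sub>R sphere_deriv X z h + sphere_deriv u z h *\<^sub>R X z)) (at z)"
    if "norm z = 1" for z
  proof -
    have "radial_ext (\<lambda>z. u z *\<^sub>R X z) = (\<lambda>x. radial_ext u x *\<^sub>R radial_ext X x)"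
      by (auto simp: radial_ext_def)
    then show ?thesis
      using has_derivative_scaleR[OF sphere_C1_has_derivative[OF u that] sphere_C1_has_derivative[OF X that]] that
      by (simp add: radial_ext_sphere)
  qed
  show fd: "sphere_deriv (\<lambda>z. u z *\<^sub>R X z) z h =
      u z *\<^sub>R sphere_deriv X z h + sphere_deriv u z h *\<^sub>R X z"
    if "norm z = 1" for z h
    using frechet_derivative_at[OF *[OF that]] by metis
  have cont: "continuous_on (sphere 0 1) (\<lambda>z. sphere_deriv X z v)"
       "continuous_on (sphere 0 1) (\<lambda>z. sphere_deriv u z v)" for v
    using u X by (auto simp: sphere_C1_def)
  have "continuous_on (sphere 0 1) (\<lambda>z. u z *\<^sub>R sphere_deriv X z v + sphere_deriv u z v *\<^sub>R X z)" for v
    by (intro continuous_intros cont sphere_C1_continuous_on u X)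
  then have "continuous_on (sphere 0 1) (\<lambda>z. sphere_deriv (\<lambda>z. u z *\<^sub>R X z) z v)" for v
    by (rule continuous_on_eq) (simp add: fd)
  then show "(\<lambda>z. u z *\<^sub>R X z) \<in> sphere_C1"
    unfolding sphere_C1_def by (intro CollectI conjI ballI allI) (auto intro: differentiableI[OF *])
qed

lemma sphere_C1_diff:
  fixes X Y :: "'a::euclidean_space \<Rightarrow> 'b::real_normed_vector"
  assumes X: "X \<in> sphere_C1" and Y: "Y \<in> sphere_C1"
  shows "(\<lambda>z. X z - Y z) \<in> sphere_C1"
    and "\<And>z h. norm z = 1 \<Longrightarrow> sphere_deriv (\<lambda>z. X z - Y z) z h =
      sphere_deriv X z h - sphere_deriv Y z h"
proof -
  have *: "(radial_ext (\<lambda>z. X z - Y z) has_derivative (\<lambda>h.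
      sphere_deriv X z h - sphere_deriv Y z h)) (at z)"
    if "norm z = 1" for z
  proof -
    have "radial_ext (\<lambda>z. X z - Y z) = (\<lambda>x. radial_ext X x - radial_ext Y x)"
      by (auto simp: radial_ext_def)
    then show ?thesis
      using has_derivative_diff[OF sphere_C1_has_derivative[OF X that] sphere_C1_has_derivative[OF Y that]]
      by simp
  qed
  show fd: "sphere_deriv (\<lambda>z. X z - Y z) z h =
      sphere_deriv X z h - sphere_deriv Y z h"
    if "norm z = 1" for z h
    using frechet_derivative_at[OF *[OF that]] by metis
  have "continuous_on (sphere 0 1) (\<lambda>z. sphere_deriv X z v - sphere_deriv Y z v)" for v
    using X Y by (intro continuous_intros) (auto simp: sphere_C1_def)
  then have "continuous_on (sphere 0 1) (\<lambda>z. sphere_deriv (\<lambda>z. X z - Y z) z v)" for v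
    by (rule continuous_on_eq) (simp add: fd)
  then show "(\<lambda>z. X z - Y z) \<in> sphere_C1"
    unfolding sphere_C1_def by (intro CollectI conjI ballI allI) (auto intro: differentiableI[OF *])
qed

lemma laplace_beltrami_continuous_on:
  "u \<in> sphere_C2 \<Longrightarrow> continuous_on (sphere 0 1) (laplace_beltrami u)"
  by (simp add: laplace_beltrami_def sphere_C2_def sphere_div_continuous_on)

text \<open>Green's second identity: the divergence theorem is applied to the tangential field u
  grad v - v grad u, in whose divergence the products of the two gradients cancel.\<close>

theorem laplace_beltrami_symmetric:
  fixes u v :: "'a::euclidean_space \<Rightarrow> real"
  assumes u: "u \<in> sphere_C2" and v: "v \<in> sphere_C2"
  shows "(LINT z|sphere_volume. u z * laplace_beltrami v z) = (LINT z|sphere_volume. v z * laplace_beltrami u z)"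
proof -
  have u1: "u \<in> sphere_C1" "sphere_grad u \<in> sphere_C1" and v1: "v \<in> sphere_C1" "sphere_grad v \<in> sphere_C1"
    using u v by (auto simp: sphere_C2_def)
  define X where "X z = u z *\<^sub>R sphere_grad v z - v z *\<^sub>R sphere_grad u z" for z
  note uv = sphere_C1_scaleR[OF u1(1) v1(2)] and vu = sphere_C1_scaleR[OF v1(1) u1(2)]
  have X: "X \<in> sphere_C1"
    unfolding X_def by (rule sphere_C1_diff(1)[OF uv(1) vu(1)])
  have Xd: "sphere_div X z = u z * laplace_beltrami v z - v z * laplace_beltrami u z" if z: "norm z = 1" for z
  proof -
    let ?Du = "sphere_deriv u z" and ?Dv = "sphere_deriv v z"
    let ?DDu = "sphere_deriv (sphere_grad u) z"
      and ?DDv = "sphere_deriv (sphere_grad v) z"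
    have g: "sphere_grad u z \<bullet> b = ?Du b" "sphere_grad v z \<bullet> b = ?Dv b" if "b \<in> Basis" for b
      using that by (simp_all add: sphere_grad_def)
    have "sphere_div X z = (\<Sum>b\<in>Basis. u z * (?DDv b \<bullet> b) - v z * (?DDu b \<bullet> b) +
        (?Du b * (sphere_grad v z \<bullet> b) - ?Dv b * (sphere_grad u z \<bullet> b)))"
      unfolding sphere_div_def X_def
      by (simp add: sphere_C1_diff(2)[OF uv(1) vu(1) z] uv(2)[OF z] vu(2)[OF z] inner_diff_left inner_add_left algebra_simps)
    also have "\<dots> = (\<Sum>b\<in>Basis. u z * (?DDv b \<bullet> b) - v z * (?DDu b \<bullet> b))"
      by (intro sum.cong) (simp_all add: g)
    finally show ?thesis
      by (simp add: sum_subtractf laplace_beltrami_def sphere_div_def flip: sum_distrib_left)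
  qed
  have "0 = (LINT z|sphere_volume. sphere_div X z)"
    by (rule integral_sphere_div[OF X, symmetric])
       (simp add: X_def inner_diff_left sphere_grad_tangential[OF u1(1)] sphere_grad_tangential[OF v1(1)])
  also have "\<dots> = (LINT z|sphere_volume. u z * laplace_beltrami v z - v z * laplace_beltrami u z)"
    by (intro Bochner_Integration.integral_cong) (use Xd in auto)
  also have "\<dots> = (LINT z|sphere_volume. u z * laplace_beltrami v z) - (LINT z|sphere_volume. v z * laplace_beltrami u z)"
    by (intro Bochner_Integration.integral_diff integrable_sphere_volume_continuous continuous_intros
          laplace_beltrami_continuous_on sphere_C1_continuous_on u v u1 v1)
  finally show ?thesis by simp
qed

section \<open>Zonal potentials\<close>

text \<open>Functions are given on the whole ambient space, but only their values on the sphere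
  count. The radial extensions may still differ at the origin, where they see the value at 0, so the
  transfer takes place on the open complement of the origin.\<close>

lemma radial_ext_has_derivative_cong:
  fixes f g :: "'a::euclidean_space \<Rightarrow> 'b::real_normed_vector"
  assumes "\<And>z. norm z = 1 \<Longrightarrow> f z = g z" "norm z = 1"
  shows "(radial_ext f has_derivative D) (at z) \<longleftrightarrow> (radial_ext g has_derivative D) (at z)"
proof -
  have eq: "radial_ext f x = radial_ext g x" if "x \<in> - {0}" for x
    using assms(1)[of "x /\<^sub>R norm x"] that by (simp add: radial_ext_def)
  have z: "z \<in> - {0}" using assms(2) by auto
  show ?thesis
    using has_derivative_transform_within_open[of "radial_ext f" D z UNIV "- {0}" "radial_ext g"]
      has_derivative_transform_within_open[of "radial_ext g" D z UNIV "- {0}" "radial_ext f"] eq z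
    by auto
qed

text \<open>\<open>frechet_derivative\<close> is a Hilbert choice from the set of all derivatives,
  and both sides choose from the same set; the equality thus covers non-differentiable functions as
  well.\<close>

lemma frechet_derivative_radial_ext_cong:
  fixes f g :: "'a::euclidean_space \<Rightarrow> 'b::real_normed_vector"
  assumes "\<And>z. norm z = 1 \<Longrightarrow> f z = g z" "norm z = 1"
  shows "sphere_deriv f z = sphere_deriv g z"
  unfolding frechet_derivative_def using radial_ext_has_derivative_cong[OF assms] by simp

lemma sphere_C1_cong:
  fixes f g :: "'a::euclidean_space \<Rightarrow> 'b::real_normed_vector"
  assumes "f \<in> sphere_C1" and eq: "\<And>z. norm z = 1 \<Longrightarrow> f z = g z"
  shows "g \<in> sphere_C1"
proof -
  have "radial_ext g differentiable (at z)" if "norm z = 1" for z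
  proof -
    have "\<exists>D. (radial_ext f has_derivative D) (at z)"
      using assms(1) that by (auto simp: sphere_C1_def differentiable_def)
    then show ?thesis
      by (simp only: differentiable_def radial_ext_has_derivative_cong[of f g z, OF eq that])
  qed
  moreover have "continuous_on (sphere 0 1) (\<lambda>z. sphere_deriv g z v)" for v
  proof -
    have "continuous_on (sphere 0 1) (\<lambda>z. sphere_deriv f z v)"
      using assms(1) by (auto simp: sphere_C1_def)
    then show ?thesis
      by (rule continuous_on_eq) (simp add: frechet_derivative_radial_ext_cong[OF eq])
  qed
  ultimately show ?thesis by (simp add: sphere_C1_def)
qed

lemma sphere_grad_cong:
  fixes f g :: "'a::euclidean_space \<Rightarrow> real"
  assumes "\<And>z. norm z = 1 \<Longrightarrow> f z = g z" "norm z = 1"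
  shows "sphere_grad f z = sphere_grad g z"
  using frechet_derivative_radial_ext_cong[OF assms] by (simp add: sphere_grad_def)

lemma sphere_div_cong:
  fixes f g :: "'a::euclidean_space \<Rightarrow> 'a"
  assumes "\<And>z. norm z = 1 \<Longrightarrow> f z = g z" "norm z = 1"
  shows "sphere_div f z = sphere_div g z"
  using frechet_derivative_radial_ext_cong[OF assms] by (simp add: sphere_div_def)

lemma sphere_C2_cong:
  fixes f g :: "'a::euclidean_space \<Rightarrow> real"
  assumes "f \<in> sphere_C2" and eq: "\<And>z. norm z = 1 \<Longrightarrow> f z = g z"
  shows "g \<in> sphere_C2"
  using assms sphere_C1_cong[OF _ eq] sphere_C1_cong[OF _ sphere_grad_cong[OF eq]]
  by (auto simp: sphere_C2_def)

lemma laplace_beltrami_cong: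
  fixes f g :: "'a::euclidean_space \<Rightarrow> real"
  assumes eq: "\<And>z. norm z = 1 \<Longrightarrow> f z = g z" and "norm z = 1"
  shows "laplace_beltrami f z = laplace_beltrami g z"
  unfolding laplace_beltrami_def by (intro sphere_div_cong sphere_grad_cong eq assms)

section \<open>Restriction of ambient functions and differentiation under the integral\<close>

lemma radial_projection_has_derivative:
  fixes z :: "'a::euclidean_space"
  assumes "norm z = 1"
  shows "((\<lambda>x. x /\<^sub>R norm x) has_derivative (\<lambda>h. h - (z \<bullet> h) *\<^sub>R z)) (at z)"
proof -
  have z: "z \<noteq> 0" using assms by auto
  have s: "sgn z = z" using assms by (simp add: sgn_div_norm)
  have n: "(norm has_derivative (\<lambda>h. h \<bullet> sgn z)) (at z)"
    using has_derivative_norm[OF z] by (simp add: inner_commute)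
  have "((\<lambda>x. inverse (norm x)) has_derivative (\<lambda>h. - (inverse (norm z) * (h \<bullet> sgn z) * inverse (norm z)))) (at z)"
    by (rule Deriv.has_derivative_inverse[OF _ n]) (use z in simp)
  then have "((\<lambda>x. inverse (norm x)) has_derivative (\<lambda>h. - (z \<bullet> h))) (at z)"
    using assms s by (simp add: inner_commute)
  from has_derivative_scaleR[OF this has_derivative_ident] show ?thesis
    using assms by (simp add: algebra_simps)
qed

lemma ambient_sphere_C1:
  fixes F :: "'a::euclidean_space \<Rightarrow> 'b::real_normed_vector"
  assumes F: "\<And>x. (F has_derivative F' x) (at x)"
    and cont: "\<And>h. continuous_on UNIV (\<lambda>x. F' x h)"
  shows "F \<in> sphere_C1"
    and "\<And>z h. norm z = 1 \<Longrightarrow> sphere_deriv F z h = F' z (h - (z \<bullet> h) *\<^sub>R z)"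
proof -
  have *: "(radial_ext F has_derivative (\<lambda>h. F' z (h - (z \<bullet> h) *\<^sub>R z))) (at z)" if z: "norm z = 1" for z
    unfolding radial_ext_def[abs_def]
    by (rule has_derivative_compose[OF radial_projection_has_derivative[OF z]]) (use F z in simp)
  show fd: "sphere_deriv F z h = F' z (h - (z \<bullet> h) *\<^sub>R z)" if "norm z = 1" for z h
    using frechet_derivative_at[OF *[OF that]] by metis
  \<comment> \<open>Continuity of the derivative is known for fixed directions only, while the
    normal direction \<open>z\<close> moves with the base point. Expanding it in the basis leaves
    fixed directions with continuous coefficients.\<close>
  have "F' z (v - (z \<bullet> v) *\<^sub>R z) = F' z v - (z \<bullet> v) *\<^sub>R (\<Sum>b\<in>Basis. (z \<bullet> b) *\<^sub>R F' z b)" for z v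
  proof -
    have lin: "linear (F' z)" by (rule has_derivative_linear[OF F])
    have "F' z z = F' z (\<Sum>b\<in>Basis. (z \<bullet> b) *\<^sub>R b)" by (simp add: euclidean_representation)
    then show ?thesis
      by (simp add: linear_diff[OF lin] linear_scale[OF lin] linear_sum[OF lin])
  qed
  moreover have "continuous_on (sphere 0 1) (\<lambda>z. F' z v - (z \<bullet> v) *\<^sub>R (\<Sum>b\<in>Basis. (z \<bullet> b) *\<^sub>R F' z b))" for v
    by (intro continuous_intros continuous_on_subset[OF cont]) auto
  ultimately have "continuous_on (sphere 0 1) (\<lambda>z. sphere_deriv F z v)" for v
    by (rule_tac continuous_on_eq[rotated]) (auto simp: fd)
  then show "F \<in> sphere_C1"
    unfolding sphere_C1_def by (intro CollectI conjI ballI allI) (auto intro: differentiableI[OF *])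
qed

text \<open>By the mean value inequality all increments obey the same bound \<open>B\<close>, so the
  remainder divided by \<open>norm h\<close> stays below \<open>2 * B\<close> and dominated
  convergence applies on the finite measure space.\<close>

lemma has_derivative_integral:
  fixes k :: "'a::euclidean_space \<Rightarrow> 'm \<Rightarrow> 'b::{banach, second_countable_topology}"
  assumes M: "finite_measure M" and d: "d > 0"
    and D: "\<And>x m. x \<in> ball x0 d \<Longrightarrow> m \<in> space M \<Longrightarrow> ((\<lambda>x. k x m) has_derivative k' x m) (at x)"
    and B: "\<And>x m h. x \<in> ball x0 d \<Longrightarrow> m \<in> space M \<Longrightarrow> norm (k' x m h) \<le> B * norm h"
    and k: "\<And>x. x \<in> ball x0 d \<Longrightarrow> integrable M (k x)"
    and k'm: "\<And>h. (\<lambda>m. k' x0 m h) \<in> borel_measurable M"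
  shows "((\<lambda>x. LINT m|M. k x m) has_derivative (\<lambda>h. LINT m|M. k' x0 m h)) (at x0)"
proof -
  interpret finite_measure M by (rule M)
  have x0: "x0 \<in> ball x0 d" using d by simp
  have lin: "linear (k' x0 m)" if "m \<in> space M" for m
    by (rule has_derivative_linear[OF D[OF x0 that]])
  have k'i: "integrable M (\<lambda>m. k' x0 m h)" for h
    by (rule integrable_const_bound[OF _ k'm, where B = "B * norm h"]) (use B[OF x0] in auto)
  have Bl: "norm (k (x0 + h) m - k x0 m - k' x0 m h) \<le> 2 * B * norm h"
    if h: "norm h < d" and m: "m \<in> space M" for h m
  proof -
    have B0: "0 \<le> B"
    proof -
      obtain b :: 'a where "b \<in> Basis" using nonempty_Basis by blast
      then show "0 \<le> B" using order_trans[OF norm_ge_zero B[OF x0 m, of b]] by simp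
    qed
    have "norm (k (x0 + h) m - k x0 m) \<le> B * norm ((x0 + h) - x0)"
    proof (rule differentiable_bound[of "ball x0 d" "\<lambda>x. k x m" "\<lambda>x. k' x m"])
      show "onorm (k' x m) \<le> B" if "x \<in> ball x0 d" for x
        using B[OF that m] B0 by (intro onorm_bound) auto
      show "((\<lambda>x. k x m) has_derivative k' x m) (at x within ball x0 d)" if "x \<in> ball x0 d" for x
        by (rule has_derivative_at_withinI[OF D[OF that m]])
    qed (use h d in \<open>simp_all add: dist_norm\<close>)
    then show ?thesis
      using B[OF x0 m, of h] norm_triangle_ineq4[of "k (x0 + h) m - k x0 m" "k' x0 m h"] by simp
  qed
  show ?thesis
    unfolding has_derivative_at
  proof (intro conjI)
    show "bounded_linear (\<lambda>h. LINT m|M. k' x0 m h)"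
    proof (rule bounded_linear_intro[of _ "B * measure M (space M)"])
      show "(LINT m|M. k' x0 m (x + y)) = (LINT m|M. k' x0 m x) + (LINT m|M. k' x0 m y)" for x y
      proof -
        have "(LINT m|M. k' x0 m (x + y)) = (LINT m|M. k' x0 m x + k' x0 m y)"
          by (rule Bochner_Integration.integral_cong[OF refl]) (rule linear_add[OF lin])
        then show ?thesis by (simp only: Bochner_Integration.integral_add[OF k'i k'i])
      qed
      show "(LINT m|M. k' x0 m (r *\<^sub>R x)) = r *\<^sub>R (LINT m|M. k' x0 m x)" for r x
      proof -
        have "(LINT m|M. k' x0 m (r *\<^sub>R x)) = (LINT m|M. r *\<^sub>R k' x0 m x)"
          by (rule Bochner_Integration.integral_cong[OF refl]) (rule linear_scale[OF lin])
        then show ?thesis by (simp only: integral_scaleR_right)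
      qed
      show "norm (LINT m|M. k' x0 m x) \<le> norm x * (B * measure M (space M))" for x
      proof -
        have "norm (LINT m|M. k' x0 m x) \<le> (LINT m|M. norm (k' x0 m x))"
          by (rule integral_norm_bound)
        also have "\<dots> \<le> (LINT m|M. B * norm x)"
          by (intro integral_mono integrable_norm k'i) (use B[OF x0] in auto)
        finally show ?thesis by (simp add: mult_ac)
      qed
    qed
    let ?q = "\<lambda>h m. (k (x0 + h) m - k x0 m - k' x0 m h) /\<^sub>R norm h"
    show "(\<lambda>h. norm ((LINT m|M. k (x0 + h) m) - (LINT m|M. k x0 m) - (LINT m|M. k' x0 m h)) / norm h) \<midarrow>0\<rightarrow> 0"
      unfolding tendsto_at_iff_sequentially
    proof (intro allI impI)
      fix X :: "nat \<Rightarrow> 'a"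
      assume X0: "\<forall>i. X i \<in> UNIV - {0}" and X: "X \<longlonglongrightarrow> 0"
      have ev: "\<forall>\<^sub>F i in sequentially. norm (X i) < d"
        using X d by (auto simp: tendsto_iff dist_norm)
      then obtain i0 where i0: "\<And>i. i \<ge> i0 \<Longrightarrow> norm (X i) < d"
        by (auto simp: eventually_sequentially)
      \<comment> \<open>Dominated convergence works along sequences; dropping finitely many terms
        keeps the sequence inside the ball of radius \<open>d\<close>, where the derivative bound
        holds.\<close>
      define Y where "Y i = X (i + i0)" for i
      have Y: "norm (Y i) < d" "Y i \<noteq> 0" for i using i0[of "i + i0"] X0 by (auto simp: Y_def)
      have Yl: "Y \<longlonglongrightarrow> 0" unfolding Y_def by (rule LIMSEQ_ignore_initial_segment[OF X])
      have ki: "integrable M (k (x0 + Y i))" for i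
        by (rule k) (use Y in \<open>simp add: dist_norm\<close>)
      have qi: "integrable M (?q (Y i))" for i
        by (intro integrable_scaleR_right Bochner_Integration.integrable_diff ki k'i k x0)
      have "(\<lambda>i. LINT m|M. ?q (Y i) m) \<longlonglongrightarrow> (LINT m|M. 0)"
      proof (rule integral_dominated_convergence[of _ _ _ "\<lambda>_. 2 * \<bar>B\<bar>"])
        show "?q (Y i) \<in> borel_measurable M" for i
          by (rule borel_measurable_integrable[OF qi])
        show "AE m in M. (\<lambda>i. ?q (Y i) m) \<longlonglongrightarrow> 0"
        proof (rule AE_I2)
          fix m assume m: "m \<in> space M"
          have "(\<lambda>h. norm (k (x0 + h) m - k x0 m - k' x0 m h) / norm h) \<midarrow>0\<rightarrow> 0"
            using D[OF x0 m] unfolding has_derivative_at by blast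
          then have "(\<lambda>i. norm (k (x0 + Y i) m - k x0 m - k' x0 m (Y i)) / norm (Y i)) \<longlonglongrightarrow> 0"
            by (rule filterlim_compose) (use Yl Y(2) in \<open>simp add: filterlim_at\<close>)
          then have "(\<lambda>i. norm (?q (Y i) m)) \<longlonglongrightarrow> 0" by (simp add: divide_inverse mult.commute)
          then show "(\<lambda>i. ?q (Y i) m) \<longlonglongrightarrow> 0" by (rule tendsto_norm_zero_cancel)
        qed
        show "AE m in M. norm (?q (Y i) m) \<le> 2 * \<bar>B\<bar>" for i
        proof (rule AE_I2)
          fix m assume m: "m \<in> space M"
          have "norm (?q (Y i) m) = norm (k (x0 + Y i) m - k x0 m - k' x0 m (Y i)) / norm (Y i)"
            by (simp add: divide_inverse mult.commute)
          also have "\<dots> \<le> 2 * B"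
            using Bl[OF Y(1) m] Y(2) by (simp add: divide_le_eq)
          finally show "norm (?q (Y i) m) \<le> 2 * \<bar>B\<bar>" by linarith
        qed
      qed auto
      then have "(\<lambda>i. LINT m|M. ?q (Y i) m) \<longlonglongrightarrow> 0"
        by (simp only: Bochner_Integration.integral_zero)
      then have "(\<lambda>i. norm (LINT m|M. ?q (Y i) m)) \<longlonglongrightarrow> 0"
        by (rule tendsto_norm_zero)
      moreover have "norm (LINT m|M. ?q (Y i) m) =
         norm ((LINT m|M. k (x0 + Y i) m) - (LINT m|M. k x0 m) - (LINT m|M. k' x0 m (Y i))) / norm (Y i)" for i
      proof -
        have E: "(LINT m|M. ?q (Y i) m) = ((LINT m|M. k (x0 + Y i) m) - (LINT m|M. k x0 m) - (LINT m|M. k' x0 m (Y i))) /\<^sub>R norm (Y i)"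
          using ki[of i] k[OF x0] k'i[of "Y i"] by simp
        show ?thesis unfolding E by (simp add: divide_inverse mult.commute)
      qed
      ultimately have "(\<lambda>i. norm ((LINT m|M. k (x0 + X (i + i0)) m) - (LINT m|M. k x0 m) - (LINT m|M. k' x0 m (X (i + i0)))) / norm (X (i + i0))) \<longlonglongrightarrow> 0"
        by (simp add: Y_def)
      then have "(\<lambda>i. norm ((LINT m|M. k (x0 + X i) m) - (LINT m|M. k x0 m) - (LINT m|M. k' x0 m (X i))) / norm (X i)) \<longlonglongrightarrow> 0"
        by (rule LIMSEQ_offset)
      then show "((\<lambda>h. norm ((LINT m|M. k (x0 + h) m) - (LINT m|M. k x0 m) - (LINT m|M. k' x0 m h)) / norm h) \<circ> X) \<longlonglongrightarrow> 0"
        by (simp add: comp_def)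
    qed
  qed
qed

lemma poly_bounded_on_interval:
  fixes p :: "real poly"
  obtains C where "C \<ge> 0" "\<And>t. \<bar>t\<bar> \<le> R \<Longrightarrow> \<bar>poly p t\<bar> \<le> C"
proof -
  have "bounded (poly p ` {-R..R})"
    by (intro compact_imp_bounded compact_continuous_image) (auto intro!: continuous_intros)
  then obtain C where C: "\<And>t. t \<in> {-R..R} \<Longrightarrow> norm (poly p t) \<le> C"
    unfolding bounded_iff by blast
  show thesis
  proof (rule that[of "\<bar>C\<bar>"])
    fix t :: real assume "\<bar>t\<bar> \<le> R"
    then have "t \<in> {-R..R}" by auto
    from C[OF this] show "\<bar>poly p t\<bar> \<le> \<bar>C\<bar>" by simp
  qed simp
qed

text \<open>Both a single zonal function (\<open>M\<close> a point mass) and a convolution with a zonal kernel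
  (\<open>M\<close> the sphere) are of this form.\<close>

definition zonal_potential ::
  "'m measure \<Rightarrow> ('m \<Rightarrow> 'a::euclidean_space) \<Rightarrow> real poly \<Rightarrow> ('m \<Rightarrow> 'b::{banach, second_countable_topology}) \<Rightarrow> 'a \<Rightarrow> 'b" where
  "zonal_potential M Y p v x = (LINT m|M. poly p (x \<bullet> Y m) *\<^sub>R v m)"

locale zonal_measure = finite_measure M for M :: "'m measure" +
  fixes Y :: "'m \<Rightarrow> 'a::euclidean_space"
  assumes Y_measurable [measurable]: "Y \<in> borel_measurable M"
    and norm_Y: "m \<in> space M \<Longrightarrow> norm (Y m) = 1"
begin

lemma abs_inner_Y_le: "m \<in> space M \<Longrightarrow> \<bar>x \<bullet> Y m\<bar> \<le> norm x"
  using Cauchy_Schwarz_ineq2[of x "Y m"] norm_Y by simp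

lemma poly_inner_Y_measurable [measurable]: "(\<lambda>m. poly p (x \<bullet> Y m)) \<in> borel_measurable M"
proof -
  have "poly p \<in> borel_measurable borel"
    by (intro borel_measurable_continuous_onI continuous_intros)
  then show ?thesis by measurable
qed

lemma zonal_potential_integrable:
  fixes v :: "'m \<Rightarrow> 'b::{banach, second_countable_topology}"
  assumes [measurable]: "v \<in> borel_measurable M" and V: "\<And>m. m \<in> space M \<Longrightarrow> norm (v m) \<le> V"
  shows "integrable M (\<lambda>m. poly p (x \<bullet> Y m) *\<^sub>R v m)"
proof -
  obtain C where C: "C \<ge> 0" "\<And>t. \<bar>t\<bar> \<le> norm x \<Longrightarrow> \<bar>poly p t\<bar> \<le> C"
    using poly_bounded_on_interval by blast
  show ?thesis
  proof (rule integrable_const_bound)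
    show "AE m in M. norm (poly p (x \<bullet> Y m) *\<^sub>R v m) \<le> C * V"
    proof (rule AE_I2)
      fix m assume m: "m \<in> space M"
      have "norm (poly p (x \<bullet> Y m) *\<^sub>R v m) = \<bar>poly p (x \<bullet> Y m)\<bar> * norm (v m)" by simp
      also have "\<dots> \<le> C * V"
        using C V[OF m] abs_inner_Y_le[OF m] by (intro mult_mono) auto
      finally show "norm (poly p (x \<bullet> Y m) *\<^sub>R v m) \<le> C * V" .
    qed
  qed measurable
qed

text \<open>The derivative is again a zonal potential, with \<open>pderiv p\<close> and with a
  density multiplied by \<open>h \<bullet> Y m\<close>. The vector-valued density allows the same
  lemma to be applied to the gradient.\<close>

lemma zonal_potential_has_derivative:
  fixes v :: "'m \<Rightarrow> 'b::{banach, second_countable_topology}"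
  assumes v: "v \<in> borel_measurable M" and V: "\<And>m. m \<in> space M \<Longrightarrow> norm (v m) \<le> V"
  shows "(zonal_potential M Y p v has_derivative
     (\<lambda>h. zonal_potential M Y (pderiv p) (\<lambda>m. (h \<bullet> Y m) *\<^sub>R v m) x)) (at x)"
proof -
  obtain C where C: "C \<ge> 0" "\<And>t. \<bar>t\<bar> \<le> norm x + 1 \<Longrightarrow> \<bar>poly (pderiv p) t\<bar> \<le> C"
    using poly_bounded_on_interval by blast
  let ?k' = "\<lambda>x m h. poly (pderiv p) (x \<bullet> Y m) *\<^sub>R (h \<bullet> Y m) *\<^sub>R v m"
  have "((\<lambda>x. LINT m|M. poly p (x \<bullet> Y m) *\<^sub>R v m) has_derivative (\<lambda>h. LINT m|M. ?k' x m h)) (at x)"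
  proof (rule has_derivative_integral[of M 1 x _ _ "C * V"])
    show "((\<lambda>x. poly p (x \<bullet> Y m) *\<^sub>R v m) has_derivative ?k' y m) (at y)" for y m
    proof -
      have "((\<lambda>x. poly p (x \<bullet> Y m)) has_derivative (\<lambda>h. (h \<bullet> Y m) * poly (pderiv p) (y \<bullet> Y m))) (at y)"
      proof -
        have "((\<lambda>x. x \<bullet> Y m) has_derivative (\<lambda>h. h \<bullet> Y m)) (at y)"
          by (auto intro!: derivative_eq_intros)
        from has_derivative_compose[OF this has_field_derivative_imp_has_derivative[OF poly_DERIV[of p]]]
        show ?thesis by (simp add: mult.commute)
      qed
      from has_derivative_scaleR_left[OF this] show ?thesis
        by (simp add: mult.commute)
    qed
    show "norm (?k' y m h) \<le> C * V * norm h" if y: "y \<in> ball x 1" and m: "m \<in> space M" for y m h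
    proof -
      have "norm y \<le> norm x + 1"
        using y norm_triangle_ineq4[of x "x - y"] by (simp add: dist_norm)
      then have "\<bar>poly (pderiv p) (y \<bullet> Y m)\<bar> \<le> C"
        using abs_inner_Y_le[OF m, of y] by (intro C) auto
      moreover have "norm (?k' y m h) = \<bar>poly (pderiv p) (y \<bullet> Y m)\<bar> * (\<bar>h \<bullet> Y m\<bar> * norm (v m))"
        by (simp add: abs_mult)
      moreover have "\<bar>h \<bullet> Y m\<bar> * norm (v m) \<le> norm h * V"
        using V[OF m] abs_inner_Y_le[OF m, of h] by (intro mult_mono) auto
      ultimately have "norm (?k' y m h) \<le> C * (norm h * V)"
        using C(1) by (metis mult_mono abs_ge_zero mult_nonneg_nonneg norm_ge_zero)
      then show ?thesis by (simp add: mult_ac)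
    qed
    show "integrable M (\<lambda>m. poly p (y \<bullet> Y m) *\<^sub>R v m)" for y
      by (rule zonal_potential_integrable[OF v V])
    show "(\<lambda>m. ?k' x m h) \<in> borel_measurable M" for h
      using v by measurable
  qed (auto intro: finite_measure_axioms)
  then show ?thesis
    by (simp add: zonal_potential_def[abs_def])
qed

lemma zonal_potential_continuous:
  fixes v :: "'m \<Rightarrow> 'b::{banach, second_countable_topology}"
  assumes v: "v \<in> borel_measurable M" and V: "\<And>m. m \<in> space M \<Longrightarrow> norm (v m) \<le> V"
  shows "continuous_on UNIV (zonal_potential M Y p v)"
  using zonal_potential_has_derivative[OF v V]
  by (intro continuous_at_imp_continuous_on ballI has_derivative_continuous) auto

text \<open>With \<open>G\<close> the ambient gradient and \<open>H\<close> its derivative, the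
  tangential trace of G - (x . G) x at a unit vector z is tr H - z . H z z - (DIM - 1) (z . G). The
  trace of \<open>H\<close> is the potential of p'' because the vectors \<open>Y m\<close> have
  length 1.\<close>

lemma zonal_potential_smooth:
  fixes w :: "'m \<Rightarrow> real"
  assumes w: "w \<in> borel_measurable M" and W: "\<And>m. m \<in> space M \<Longrightarrow> \<bar>w m\<bar> \<le> W"
  shows "zonal_potential M Y p w \<in> sphere_C2"
    and "\<And>z. norm z = 1 \<Longrightarrow> laplace_beltrami (zonal_potential M Y p w) z =
      (LINT m|M. ((1 - (z \<bullet> Y m)\<^sup>2) * poly (pderiv (pderiv p)) (z \<bullet> Y m)
         - (real DIM('a) - 1) * (z \<bullet> Y m) * poly (pderiv p) (z \<bullet> Y m)) * w m)"
proof -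
  note [measurable] = w
  let ?p' = "pderiv p" and ?p'' = "pderiv (pderiv p)"
  define G where "G = zonal_potential M Y ?p' (\<lambda>m. w m *\<^sub>R Y m)"
  define H where "H x h = zonal_potential M Y ?p'' (\<lambda>m. (h \<bullet> Y m) *\<^sub>R w m *\<^sub>R Y m) x" for x h
  have m1: "(\<lambda>m. w m *\<^sub>R Y m) \<in> borel_measurable M" "(\<lambda>m. (h \<bullet> Y m) *\<^sub>R w m *\<^sub>R Y m) \<in> borel_measurable M"
     "(\<lambda>m. (h \<bullet> Y m) *\<^sub>R w m) \<in> borel_measurable M" for h
    by measurable
  have b1: "norm (w m *\<^sub>R Y m) \<le> W" "norm ((h \<bullet> Y m) *\<^sub>R w m *\<^sub>R Y m) \<le> norm h * W"
     "norm ((h \<bullet> Y m) *\<^sub>R w m) \<le> norm h * W" if m: "m \<in> space M" for m h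
    using W[OF m] norm_Y[OF m] abs_inner_Y_le[OF m, of h] by (auto simp: abs_mult intro!: mult_mono)
  have Gi: "x \<bullet> G y = zonal_potential M Y ?p' (\<lambda>m. (x \<bullet> Y m) *\<^sub>R w m) y" for x y
  proof -
    have "x \<bullet> G y = (LINT m|M. x \<bullet> (poly ?p' (y \<bullet> Y m) *\<^sub>R w m *\<^sub>R Y m))"
      unfolding G_def zonal_potential_def
      by (subst integral_inner_right[OF zonal_potential_integrable[OF m1(1) b1(1)]]) auto
    then show ?thesis by (simp add: zonal_potential_def mult_ac)
  qed
  have Hi: "x \<bullet> H y h = (LINT m|M. poly ?p'' (y \<bullet> Y m) * ((x \<bullet> Y m) * (h \<bullet> Y m)) * w m)" for x y h
  proof -
    have "x \<bullet> H y h = (LINT m|M. x \<bullet> (poly ?p'' (y \<bullet> Y m) *\<^sub>R (h \<bullet> Y m) *\<^sub>R w m *\<^sub>R Y m))"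
      unfolding H_def zonal_potential_def
      by (subst integral_inner_right[OF zonal_potential_integrable[OF m1(2) b1(2)]]) auto
    then show ?thesis by (simp add: mult_ac)
  qed
  have f': "(zonal_potential M Y p w has_derivative (\<lambda>h. h \<bullet> G x)) (at x)" for x
    using zonal_potential_has_derivative[of w W p x] w W by (simp add: Gi)
  have G': "(G has_derivative H x) (at x)" for x
    unfolding G_def H_def by (rule zonal_potential_has_derivative[OF m1(1) b1(1)])
  have Gc: "continuous_on UNIV G"
    unfolding G_def by (rule zonal_potential_continuous[OF m1(1) b1(1)])
  have Hc: "continuous_on UNIV (\<lambda>x. H x h)" for h
    unfolding H_def by (rule zonal_potential_continuous[OF m1(2) b1(2)])
  \<comment> \<open>On the sphere this is the tangential part of \<open>G\<close>, hence the
    spherical gradient. Off the sphere it is a differentiable ambient formula and not the radially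
    constant extension, so that \<open>ambient_sphere_C1\<close> applies.\<close>
  define V where "V x = G x - (x \<bullet> G x) *\<^sub>R x" for x
  define V' where "V' x h = H x h - ((x \<bullet> G x) *\<^sub>R h + (x \<bullet> H x h + h \<bullet> G x) *\<^sub>R x)" for x h
  have V': "(V has_derivative V' x) (at x)" for x
    unfolding V_def[abs_def] V'_def[abs_def] by (auto intro!: derivative_eq_intros G')
  have V'c: "continuous_on UNIV (\<lambda>x. V' x h)" for h
    unfolding V'_def by (intro continuous_intros Gc Hc)
  have fC1: "zonal_potential M Y p w \<in> sphere_C1"
    by (rule ambient_sphere_C1(1)[OF f']) (intro continuous_intros Gc)
  have fd: "sphere_deriv (zonal_potential M Y p w) z h = (h - (z \<bullet> h) *\<^sub>R z) \<bullet> G z"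
    if "norm z = 1" for z h
    by (rule ambient_sphere_C1(2)[OF f' _ that]) (intro continuous_intros Gc)
  have grad: "V z = sphere_grad (zonal_potential M Y p w) z" if "norm z = 1" for z
  proof (rule euclidean_eqI)
    fix b :: 'a assume b: "b \<in> Basis"
    then have "sphere_grad (zonal_potential M Y p w) z \<bullet> b = (b - (z \<bullet> b) *\<^sub>R z) \<bullet> G z"
      by (simp add: sphere_grad_def fd[OF that])
    also have "\<dots> = G z \<bullet> b - (z \<bullet> G z) * (z \<bullet> b)"
      by (simp add: inner_diff_left inner_commute[of b "G z"])
    finally show "V z \<bullet> b = sphere_grad (zonal_potential M Y p w) z \<bullet> b"
      by (simp add: V_def inner_diff_left)
  qed
  have VC1: "V \<in> sphere_C1" by (rule ambient_sphere_C1(1)[OF V' V'c])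
  show "zonal_potential M Y p w \<in> sphere_C2"
    using fC1 sphere_C1_cong[OF VC1 grad] by (simp add: sphere_C2_def)
  fix z :: 'a assume z: "norm z = 1"
  have zz: "z \<bullet> z = 1" using z by (simp add: norm_eq_1)
  have linV: "linear (V' z)" by (rule has_derivative_linear[OF V'])
  have tr: "(\<Sum>b\<in>Basis. H z b \<bullet> b) = (LINT m|M. poly ?p'' (z \<bullet> Y m) * w m)"
  proof -
    have "(\<Sum>b\<in>Basis. H z b \<bullet> b) = (\<Sum>b\<in>Basis. (LINT m|M. poly ?p'' (z \<bullet> Y m) * ((b \<bullet> Y m) * (b \<bullet> Y m)) * w m))"
      by (simp add: Hi inner_commute[of "H z _"])
    also have "\<dots> = (LINT m|M. (\<Sum>b\<in>Basis. poly ?p'' (z \<bullet> Y m) * ((b \<bullet> Y m) * (b \<bullet> Y m)) * w m))"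
    proof (rule Bochner_Integration.integral_sum[symmetric])
      fix b :: 'a
      show "integrable M (\<lambda>m. poly ?p'' (z \<bullet> Y m) * ((b \<bullet> Y m) * (b \<bullet> Y m)) * w m)"
        using integrable_inner_right[OF zonal_potential_integrable[OF m1(2) b1(2)], of b ?p'' z b]
        by (simp add: mult_ac)
    qed
    also have "\<dots> = (LINT m|M. poly ?p'' (z \<bullet> Y m) * w m)"
    proof (intro Bochner_Integration.integral_cong refl)
      fix m assume m: "m \<in> space M"
      have "(\<Sum>b\<in>Basis. (b \<bullet> Y m) * (b \<bullet> Y m)) = 1"
      proof -
        have "(\<Sum>b\<in>Basis. (Y m \<bullet> b) * (Y m \<bullet> b)) = 1"
          using norm_Y[OF m] by (simp only: norm_eq_1 euclidean_inner[of "Y m" "Y m"])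
        then show ?thesis by (simp only: inner_commute[of "Y m"])
      qed
      then show "(\<Sum>b\<in>Basis. poly ?p'' (z \<bullet> Y m) * ((b \<bullet> Y m) * (b \<bullet> Y m)) * w m) = poly ?p'' (z \<bullet> Y m) * w m"
        by (simp flip: sum_distrib_left sum_distrib_right)
    qed
    finally show ?thesis .
  qed
  have "laplace_beltrami (zonal_potential M Y p w) z = sphere_div V z"
    unfolding laplace_beltrami_def by (rule sphere_div_cong[OF _ z]) (simp add: grad)
  also have "\<dots> = (\<Sum>b\<in>Basis. V' z (b - (z \<bullet> b) *\<^sub>R z) \<bullet> b)"
    by (simp add: sphere_div_def ambient_sphere_C1(2)[OF V' V'c z])
  also have "\<dots> = (\<Sum>b\<in>Basis. V' z b \<bullet> b - (z \<bullet> b) * (V' z z \<bullet> b))"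
    by (simp add: linear_diff[OF linV] linear_scale[OF linV] inner_diff_left)
  \<comment> \<open>The trace over the tangent space is the ambient trace without the contribution
    of the normal direction.\<close>
  also have "\<dots> = (\<Sum>b\<in>Basis. V' z b \<bullet> b) - V' z z \<bullet> z"
    by (simp add: sum_subtractf euclidean_inner[of "V' z z" z] mult.commute)
  also have "V' z z \<bullet> z = - 2 * (z \<bullet> G z)"
    by (simp add: V'_def inner_diff_left inner_add_left zz inner_commute[of "H z z" z])
  also have "(\<Sum>b\<in>Basis. V' z b \<bullet> b) =
      (\<Sum>b\<in>Basis. H z b \<bullet> b - ((z \<bullet> G z) + ((z \<bullet> H z b) * (z \<bullet> b) + (G z \<bullet> b) * (z \<bullet> b))))"
    by (intro sum.cong refl)
       (simp add: V'_def inner_diff_left inner_add_left distrib_right inner_commute[of _ "G z"])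
  also have "\<dots> = (\<Sum>b\<in>Basis. H z b \<bullet> b) - (real DIM('a) * (z \<bullet> G z) + (z \<bullet> H z z + z \<bullet> G z))"
  proof -
    have "(\<Sum>b\<in>Basis. (z \<bullet> H z b) * (z \<bullet> b)) = z \<bullet> H z z"
    proof -
      have linH: "linear (H z)" by (rule has_derivative_linear[OF G'])
      have "H z z = H z (\<Sum>b\<in>Basis. (z \<bullet> b) *\<^sub>R b)" by (simp add: euclidean_representation)
      also have "\<dots> = (\<Sum>b\<in>Basis. (z \<bullet> b) *\<^sub>R H z b)"
        by (simp add: linear_scale[OF linH] linear_sum[OF linH])
      finally show ?thesis by (simp add: inner_sum_right mult.commute)
    qed
    moreover have "(\<Sum>b\<in>Basis. (G z \<bullet> b) * (z \<bullet> b)) = z \<bullet> G z"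
      by (simp add: euclidean_inner[of z "G z"] mult.commute)
    ultimately show ?thesis by (simp add: sum_subtractf sum.distrib)
  qed
  finally have L: "laplace_beltrami (zonal_potential M Y p w) z =
      (LINT m|M. poly ?p'' (z \<bullet> Y m) * w m) - z \<bullet> H z z - (real DIM('a) - 1) * (z \<bullet> G z)"
    by (simp add: tr algebra_simps)
  have i1: "integrable M (\<lambda>m. poly ?p'' (z \<bullet> Y m) * w m)"
    using zonal_potential_integrable[of w W ?p'' z] w W by simp
  have i2: "integrable M (\<lambda>m. poly ?p'' (z \<bullet> Y m) * ((z \<bullet> Y m) * (z \<bullet> Y m)) * w m)"
    using integrable_inner_right[OF zonal_potential_integrable[OF m1(2) b1(2)], of z ?p'' z z]
    by (simp add: mult_ac)
  have i3: "integrable M (\<lambda>m. poly ?p' (z \<bullet> Y m) * ((z \<bullet> Y m) * w m))"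
    using zonal_potential_integrable[OF m1(3) b1(3), of ?p' z z] by simp
  show "laplace_beltrami (zonal_potential M Y p w) z =
      (LINT m|M. ((1 - (z \<bullet> Y m)\<^sup>2) * poly ?p'' (z \<bullet> Y m)
         - (real DIM('a) - 1) * (z \<bullet> Y m) * poly ?p' (z \<bullet> Y m)) * w m)"
  proof -
    have "(LINT m|M. ((1 - (z \<bullet> Y m)\<^sup>2) * poly ?p'' (z \<bullet> Y m)
         - (real DIM('a) - 1) * (z \<bullet> Y m) * poly ?p' (z \<bullet> Y m)) * w m) =
       (LINT m|M. poly ?p'' (z \<bullet> Y m) * w m - poly ?p'' (z \<bullet> Y m) * ((z \<bullet> Y m) * (z \<bullet> Y m)) * w m
          - (real DIM('a) - 1) * (poly ?p' (z \<bullet> Y m) * ((z \<bullet> Y m) * w m)))"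
      by (intro Bochner_Integration.integral_cong refl) (simp add: algebra_simps power2_eq_square)
    also have "\<dots> = (LINT m|M. poly ?p'' (z \<bullet> Y m) * w m)
       - (LINT m|M. poly ?p'' (z \<bullet> Y m) * ((z \<bullet> Y m) * (z \<bullet> Y m)) * w m)
       - (real DIM('a) - 1) * (LINT m|M. poly ?p' (z \<bullet> Y m) * ((z \<bullet> Y m) * w m))"
      using i1 i2 i3 by simp
    finally show ?thesis unfolding L Hi Gi by (simp add: zonal_potential_def)
  qed
qed

end

section \<open>Zonal polynomials\<close>

text \<open>They turn sums of cos (n \<theta>) into polynomials in t = cos \<theta>, so that zonal
  functions are differentiable also at t = 1 and t = -1 and extend to the ambient space.\<close>

fun chebyshev :: "nat \<Rightarrow> real poly" where
  "chebyshev 0 = 1"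
| "chebyshev (Suc 0) = [:0, 1:]"
| "chebyshev (Suc (Suc n)) = [:0, 2:] * chebyshev (Suc n) - chebyshev n"

lemma poly_chebyshev_cos: "poly (chebyshev n) (cos \<theta>) = cos (real n * \<theta>)"
proof (induction n rule: chebyshev.induct)
  case (3 n)
  have "cos (real (Suc (Suc n)) * \<theta>) + cos (real n * \<theta>) = 2 * cos \<theta> * cos (real (Suc n) * \<theta>)"
    using cos_plus_cos[of "real (Suc (Suc n)) * \<theta>" "real n * \<theta>"]
    by (simp add: algebra_simps add_divide_distrib)
  with 3 show ?case by simp
qed auto

text \<open>The Taylor coefficients of (1 - w)^(-(\<nu> + 1)).\<close>

definition geg_coeff :: "real \<Rightarrow> nat \<Rightarrow> real" where
  "geg_coeff \<nu> m = pochhammer (\<nu> + 1) m / fact m"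

lemma geg_coeff_0 [simp]: "geg_coeff \<nu> 0 = 1"
  by (simp add: geg_coeff_def)

lemma geg_coeff_Suc: "real (Suc m) * geg_coeff \<nu> (Suc m) = (\<nu> + real (Suc m)) * geg_coeff \<nu> m"
  by (simp add: geg_coeff_def pochhammer_Suc field_simps del: of_nat_Suc) (simp add: algebra_simps)

lemma geg_coeff_nonneg: "\<nu> \<ge> 0 \<Longrightarrow> geg_coeff \<nu> m \<ge> 0"
  by (auto simp: geg_coeff_def pochhammer_prod intro!: divide_nonneg_nonneg prod_nonneg)

text \<open>With w = r e^(i \<theta>), the Poisson kernel is (1 - w w') (1 - w)^(-(\<nu> + 1)) (1 -
  w')^(-(\<nu> + 1)), where w' is the conjugate of w; this is the coefficient of w^m w'^l in
  it.\<close>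

definition zonal_coeff :: "real \<Rightarrow> nat \<Rightarrow> nat \<Rightarrow> real" where
  "zonal_coeff \<nu> m l = geg_coeff \<nu> m * geg_coeff \<nu> l -
     (if m = 0 \<or> l = 0 then 0 else geg_coeff \<nu> (m - 1) * geg_coeff \<nu> (l - 1))"

text \<open>The coefficient of \<open>r ^ j\<close> in the Poisson kernel
  \<open>(1 - r\<^sup>2) / (1 - 2 * r * t + r\<^sup>2) powr (\<nu> + 1)\<close>, for \<open>\<nu> = (N - 1) / 2\<close>; up to a factor it is the
  Gegenbauer polynomial of index \<open>\<nu>\<close>.\<close>

definition zonal_poly :: "real \<Rightarrow> nat \<Rightarrow> real poly" where
  "zonal_poly \<nu> j =
     (\<Sum>m\<le>j. smult (zonal_coeff \<nu> m (j - m)) (chebyshev (nat \<bar>int j - 2 * int m\<bar>)))"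

lemma poly_zonal_poly_cos:
  "poly (zonal_poly \<nu> j) (cos \<theta>) =
     (\<Sum>m\<le>j. zonal_coeff \<nu> m (j - m) * cos ((real j - 2 * real m) * \<theta>))"
proof -
  have "cos (real (nat \<bar>int j - 2 * int m\<bar>) * \<theta>) = cos ((real j - 2 * real m) * \<theta>)" for m
  proof -
    have "real (nat \<bar>int j - 2 * int m\<bar>) = \<bar>real j - 2 * real m\<bar>" by simp
    moreover have "cos (\<bar>x\<bar> * \<theta>) = cos (x * \<theta>)" for x
      by (cases "x \<ge> 0") (simp_all add: abs_if)
    ultimately show ?thesis by simp
  qed
  then show ?thesis
    by (simp add: zonal_poly_def poly_sum poly_chebyshev_cos)
qed

lemma zonal_poly_0 [simp]: "zonal_poly \<nu> 0 = 1"
  by (simp add: zonal_poly_def zonal_coeff_def)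

text \<open>The left-hand side equals a_m a_l \<nu> (\<nu> + l + m + 1) with a =
  \<open>geg_coeff \<nu>\<close>, which is symmetric in m and l. The relation is stated without
  division, so that it includes \<nu> = 0 together with l = 0 or m = 0.\<close>

lemma zonal_coeff_shift:
  "real (Suc m) * (real l + \<nu>) * zonal_coeff \<nu> (Suc m) l =
     real (Suc l) * (real m + \<nu>) * zonal_coeff \<nu> m (Suc l)"
proof -
  have A: "real (Suc m) * (real l + \<nu>) * zonal_coeff \<nu> (Suc m) l =
      geg_coeff \<nu> m * geg_coeff \<nu> l * \<nu> * (\<nu> + real l + real (Suc m))" for m l
  proof (cases l)
    case 0
    have "real (Suc m) * (real l + \<nu>) * zonal_coeff \<nu> (Suc m) l =
       \<nu> * (real (Suc m) * geg_coeff \<nu> (Suc m))"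
      using 0 by (simp add: zonal_coeff_def)
    also have "\<dots> = \<nu> * ((\<nu> + real (Suc m)) * geg_coeff \<nu> m)"
      by (simp only: geg_coeff_Suc)
    finally show ?thesis using 0 by (simp add: mult_ac)
  next
    case (Suc k)
    have "real (Suc m) * (real l + \<nu>) * zonal_coeff \<nu> (Suc m) l =
       (real (Suc m) * geg_coeff \<nu> (Suc m)) * (real l + \<nu>) * geg_coeff \<nu> l
       - real (Suc m) * geg_coeff \<nu> m * ((\<nu> + real (Suc k)) * geg_coeff \<nu> k)"
      using Suc by (simp add: zonal_coeff_def algebra_simps)
    also have "\<dots> = ((\<nu> + real (Suc m)) * geg_coeff \<nu> m) * (real l + \<nu>) * geg_coeff \<nu> l
       - real (Suc m) * geg_coeff \<nu> m * (real l * geg_coeff \<nu> l)"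
      unfolding geg_coeff_Suc[symmetric] Suc ..
    finally show ?thesis by (simp add: algebra_simps)
  qed
  have sym: "zonal_coeff \<nu> m l = zonal_coeff \<nu> l m" for m l
    by (simp add: zonal_coeff_def)
  show ?thesis
    using A[of m l] A[of l m] sym[of "Suc l" m] by (simp add: algebra_simps)
qed

text \<open>This is f'' + 2 \<nu> cot \<theta> f' + j (j + 2 \<nu>) f = 0 for f \<theta> = Z (cos
  \<theta>), multiplied by sin \<theta>. The products of sines and cosines are combinations of sin
  ((p + 1) \<theta>) and sin ((p - 1) \<theta>) with p = j - 2m, and neighbouring terms cancel by
  \<open>zonal_coeff_shift\<close>.\<close>

lemma zonal_poly_ode_cos:
  defines "P \<equiv> \<lambda>j (\<nu>::real) m. zonal_coeff \<nu> m (j - m)"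
  shows "(\<Sum>m\<le>j. P j \<nu> m * ((real j * (real j + 2 * \<nu>) - (real j - 2 * real m)\<^sup>2) *
             sin \<theta> * cos ((real j - 2 * real m) * \<theta>)
           - 2 * \<nu> * (real j - 2 * real m) * cos \<theta> * sin ((real j - 2 * real m) * \<theta>))) = 0"
proof -
  \<comment> \<open>\<open>H m\<close> is the sin ((p + 1) \<theta>) part of the m-th term. Since p
    drops by 2 when m grows by 1, \<open>H (Suc m)\<close> has the frequency p - 1 of the same term.
    The value 0 beyond \<open>j\<close> guards against truncated subtraction in
    \<open>j - m\<close>.\<close>
  define H where "H m = (if m > j then 0 else
     2 * (real m * (real (j - m) + \<nu>) * zonal_coeff \<nu> m (j - m)) * sin ((real j - 2 * real m + 1) * \<theta>))" for m
  have "P j \<nu> m * ((real j * (real j + 2 * \<nu>) - (real j - 2 * real m)\<^sup>2) *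
             sin \<theta> * cos ((real j - 2 * real m) * \<theta>)
           - 2 * \<nu> * (real j - 2 * real m) * cos \<theta> * sin ((real j - 2 * real m) * \<theta>)) = H m - H (Suc m)"
    if m: "m \<le> j" for m
  proof -
    obtain l where l: "j = m + l" using m le_Suc_ex by blast
    define p where "p = real j - 2 * real m"
    have s: "sin ((p + 1) * \<theta>) = sin (p * \<theta>) * cos \<theta> + cos (p * \<theta>) * sin \<theta>"
            "sin ((p - 1) * \<theta>) = sin (p * \<theta>) * cos \<theta> - cos (p * \<theta>) * sin \<theta>"
      by (simp_all add: distrib_right left_diff_distrib sin_add sin_diff)
    have H1: "H m = 2 * (real m * (real l + \<nu>) * P j \<nu> m) * sin ((p + 1) * \<theta>)"
      using l by (simp add: H_def P_def p_def)
    have H2: "H (Suc m) = 2 * (real l * (real m + \<nu>) * P j \<nu> m) * sin ((p - 1) * \<theta>)"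
    proof (cases l)
      case 0 then show ?thesis using l by (simp add: H_def)
    next
      case (Suc k)
      have "H (Suc m) = 2 * (real (Suc m) * (real k + \<nu>) * zonal_coeff \<nu> (Suc m) k) * sin ((p - 1) * \<theta>)"
        using l Suc by (simp add: H_def p_def algebra_simps)
      also have "\<dots> = 2 * (real l * (real m + \<nu>) * P j \<nu> m) * sin ((p - 1) * \<theta>)"
        unfolding zonal_coeff_shift using l Suc by (simp add: P_def)
      finally show ?thesis .
    qed
    have p: "p = real l - real m" "real j = real l + real m" using l by (auto simp: p_def)
    show ?thesis
      unfolding H1 H2 s unfolding p_def[symmetric] unfolding p
      by (simp add: algebra_simps power2_eq_square)
  qed
  then have "(\<Sum>m\<le>j. P j \<nu> m * ((real j * (real j + 2 * \<nu>) - (real j - 2 * real m)\<^sup>2) *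
             sin \<theta> * cos ((real j - 2 * real m) * \<theta>)
           - 2 * \<nu> * (real j - 2 * real m) * cos \<theta> * sin ((real j - 2 * real m) * \<theta>)))
      = (\<Sum>m\<le>j. H m - H (Suc m))"
    by (intro sum.cong) auto
  also have "\<dots> = H 0 - H (Suc j)"
    by (rule sum_telescope)
  also have "\<dots> = 0" by (simp add: H_def)
  finally show ?thesis .
qed

text \<open>Substituting t = cos \<theta> reduces the equation to the trigonometric identity
  wherever sin \<theta> is nonzero, that is on the open interval (-1, 1); a polynomial with
  infinitely many zeros vanishes, which gives every real \<open>t\<close>.\<close>

lemma zonal_poly_ode:
  "(1 - t\<^sup>2) * poly (pderiv (pderiv (zonal_poly \<nu> j))) t
     - (2 * \<nu> + 1) * t * poly (pderiv (zonal_poly \<nu> j)) t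
     = - (real j * (real j + 2 * \<nu>)) * poly (zonal_poly \<nu> j) t"
proof -
  define Z where "Z = zonal_poly \<nu> j"
  define c where "c m = zonal_coeff \<nu> m (j - m)" for m
  define p where "p m = real j - 2 * real m" for m
  define \<mu> where "\<mu> = real j * (real j + 2 * \<nu>)"
  define Q where "Q = [:1, 0, -1:] * pderiv (pderiv Z) - smult (2 * \<nu> + 1) ([:0, 1:] * pderiv Z) + smult \<mu> Z"
  have Z: "poly Z (cos \<theta>) = (\<Sum>m\<le>j. c m * cos (p m * \<theta>))" for \<theta>
    by (simp add: Z_def poly_zonal_poly_cos c_def p_def)
  have Z1: "- sin \<theta> * poly (pderiv Z) (cos \<theta>) = (\<Sum>m\<le>j. - c m * p m * sin (p m * \<theta>))" for \<theta>
  proof (rule DERIV_unique)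
    show "((\<lambda>\<theta>. poly Z (cos \<theta>)) has_field_derivative - sin \<theta> * poly (pderiv Z) (cos \<theta>)) (at \<theta>)"
      by (auto intro!: derivative_eq_intros DERIV_chain2[OF poly_DERIV])
    show "((\<lambda>\<theta>. poly Z (cos \<theta>)) has_field_derivative (\<Sum>m\<le>j. - c m * p m * sin (p m * \<theta>))) (at \<theta>)"
      unfolding Z by (auto intro!: derivative_eq_intros sum.cong)
  qed
  have Z2: "(sin \<theta>)\<^sup>2 * poly (pderiv (pderiv Z)) (cos \<theta>) - cos \<theta> * poly (pderiv Z) (cos \<theta>) =
      (\<Sum>m\<le>j. - c m * (p m)\<^sup>2 * cos (p m * \<theta>))" for \<theta>
  proof (rule DERIV_unique)
    show "((\<lambda>\<theta>. - sin \<theta> * poly (pderiv Z) (cos \<theta>)) has_field_derivative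
       (sin \<theta>)\<^sup>2 * poly (pderiv (pderiv Z)) (cos \<theta>) - cos \<theta> * poly (pderiv Z) (cos \<theta>)) (at \<theta>)"
      by (auto intro!: derivative_eq_intros DERIV_chain2[OF poly_DERIV] simp: power2_eq_square)
    show "((\<lambda>\<theta>. - sin \<theta> * poly (pderiv Z) (cos \<theta>)) has_field_derivative
       (\<Sum>m\<le>j. - c m * (p m)\<^sup>2 * cos (p m * \<theta>))) (at \<theta>)"
      unfolding Z1 by (auto intro!: derivative_eq_intros sum.cong simp: power2_eq_square)
  qed
  have Q0: "poly Q (cos \<theta>) = 0" if "sin \<theta> \<noteq> 0" for \<theta>
  proof -
    have "sin \<theta> * poly Q (cos \<theta>) =
       sin \<theta> * ((sin \<theta>)\<^sup>2 * poly (pderiv (pderiv Z)) (cos \<theta>) - cos \<theta> * poly (pderiv Z) (cos \<theta>))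
       + 2 * \<nu> * cos \<theta> * (- sin \<theta> * poly (pderiv Z) (cos \<theta>)) + \<mu> * sin \<theta> * poly Z (cos \<theta>)"
      by (simp add: Q_def sin_squared_eq) (simp add: algebra_simps power2_eq_square)
    also have "\<dots> = sin \<theta> * (\<Sum>m\<le>j. - c m * (p m)\<^sup>2 * cos (p m * \<theta>))
        + 2 * \<nu> * cos \<theta> * (\<Sum>m\<le>j. - c m * p m * sin (p m * \<theta>)) + \<mu> * sin \<theta> * (\<Sum>m\<le>j. c m * cos (p m * \<theta>))"
      by (simp only: Z1 Z2 Z)
    also have "\<dots> = (\<Sum>m\<le>j. c m * ((\<mu> - (p m)\<^sup>2) * sin \<theta> * cos (p m * \<theta>)
           - 2 * \<nu> * p m * cos \<theta> * sin (p m * \<theta>)))"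
      by (simp add: sum_distrib_left sum.distrib[symmetric] algebra_simps)
    also have "\<dots> = 0"
      using zonal_poly_ode_cos[of \<nu> j \<theta>] by (simp add: c_def p_def \<mu>_def)
    finally show ?thesis using that by simp
  qed
  have "Q = 0"
  proof (rule ccontr)
    assume "Q \<noteq> 0"
    then have "finite {x. poly Q x = 0}" by (rule poly_roots_finite)
    moreover have "{-1<..<1} \<subseteq> {x. poly Q x = 0}"
    proof
      fix x :: real assume x: "x \<in> {-1<..<1}"
      then have "sin (arccos x) \<noteq> 0" using sin_arccos_nonzero[of x] by auto
      then show "x \<in> {x. poly Q x = 0}"
        using Q0[of "arccos x"] x by simp
    qed
    ultimately have "finite {-1<..<1::real}" by (rule rev_finite_subset)
    then show False using infinite_Ioo[of "-1::real" 1] by simp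
  qed
  then have "poly Q t = 0" by simp
  then show ?thesis
    by (simp add: Q_def Z_def \<mu>_def algebra_simps power2_eq_square)
qed

section \<open>Generating function of the zonal polynomials\<close>

lemma geg_coeff_sums_complex:
  fixes w :: complex
  assumes "norm w < 1"
  shows "(\<lambda>m. of_real (geg_coeff \<nu> m) * w ^ m) sums (1 - w) powr of_real (- (\<nu> + 1))"
proof -
  have "(\<lambda>n. (of_real (- (\<nu> + 1)) gchoose n) * (- w) ^ n) sums (1 + (- w)) powr of_real (- (\<nu> + 1))"
    by (rule gen_binomial_complex) (use assms in auto)
  moreover have "(of_real (- (\<nu> + 1)) gchoose n) * (- w) ^ n = of_real (geg_coeff \<nu> n) * w ^ n" for n
  proof -
    have "(of_real (- (\<nu> + 1)) gchoose n :: complex) = (-1) ^ n * of_real (geg_coeff \<nu> n)"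
    proof -
      have "- of_real (- (\<nu> + 1)) = (of_real (\<nu> + 1) :: complex)" by simp
      then show ?thesis
        by (simp only: gbinomial_pochhammer geg_coeff_def pochhammer_of_real of_real_divide of_real_fact
              times_divide_eq_right)
    qed
    moreover have "(- w) ^ n = (-1) ^ n * w ^ n" by (rule power_minus)
    moreover have "(-1) ^ n * c * ((-1) ^ n * v) = c * v" for c v :: complex
    proof -
      have "(-1) ^ n * c * ((-1) ^ n * v) = ((-1) ^ n * (-1) ^ n) * (c * v)"
        by (simp only: mult_ac)
      then show ?thesis by (simp only: minus_one_mult_self mult_1)
    qed
    ultimately show ?thesis by (simp only:)
  qed
  ultimately show ?thesis by (simp only: add_uminus_conv_diff)
qed

lemma geg_coeff_summable:
  assumes "\<nu> \<ge> 0" "0 \<le> r" "r < 1"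
  shows "summable (\<lambda>m. geg_coeff \<nu> m * r ^ m)"
proof -
  have "summable (\<lambda>m. (of_real (geg_coeff \<nu> m * r ^ m) :: complex))"
    using sums_summable[OF geg_coeff_sums_complex[of "of_real r" \<nu>]] assms
    by (simp only: of_real_mult of_real_power norm_of_real abs_of_nonneg)
  then show ?thesis by (simp only: summable_complex_of_real)
qed

text \<open>The Gegenbauer polynomial of index \<nu> + 1 and degree j, evaluated at cos
  \<theta>.\<close>

definition geg_sum :: "real \<Rightarrow> nat \<Rightarrow> real \<Rightarrow> real" where
  "geg_sum \<nu> j \<theta> = (\<Sum>m\<le>j. geg_coeff \<nu> m * geg_coeff \<nu> (j - m) * cos ((real j - 2 * real m) * \<theta>))"

text \<open>For w = r e^(i \<theta>) the base 1 - 2 r cos \<theta> + r^2 is |1 - w|^2, so the series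
  is the Cauchy product of the binomial series of (1 - w)^(-(\<nu> + 1)) with its complex
  conjugate.\<close>

lemma geg_sum_sums:
  assumes "\<nu> \<ge> 0" "0 \<le> r" "r < 1"
  shows "(\<lambda>j. r ^ j * geg_sum \<nu> j \<theta>) sums ((1 - 2 * r * cos \<theta> + r\<^sup>2) powr (- (\<nu> + 1)))"
proof -
  define w where "w = of_real r * cis \<theta>"
  define S where "S = (1 - w) powr of_real (- (\<nu> + 1))"
  let ?a = "\<lambda>m. of_real (geg_coeff \<nu> m) * w ^ m"
  have w: "norm w = r" using assms by (simp add: w_def norm_mult)
  have a: "?a sums S"
    unfolding S_def by (rule geg_coeff_sums_complex) (use assms w in auto)
  then have b: "(\<lambda>m. cnj (?a m)) sums cnj S"
    by (simp only: sums_cnj)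
  have n: "summable (\<lambda>m. norm (?a m))"
    using geg_coeff_summable[OF assms] assms w geg_coeff_nonneg[OF assms(1)]
    by (simp add: norm_mult norm_power)
  have "(\<lambda>k. \<Sum>i\<le>k. ?a i * cnj (?a (k - i))) sums ((\<Sum>k. ?a k) * (\<Sum>k. cnj (?a k)))"
    by (rule Cauchy_product_sums) (use n in \<open>simp_all add: norm_mult norm_power\<close>)
  also have "(\<Sum>k. ?a k) * (\<Sum>k. cnj (?a k)) = S * cnj S"
    using a b by (simp add: sums_iff)
  also have "S * cnj S = of_real ((cmod S)\<^sup>2)"
    by (simp only: complex_norm_square)
  finally have "(\<lambda>k. Re (\<Sum>i\<le>k. ?a i * cnj (?a (k - i)))) sums Re (of_real ((cmod S)\<^sup>2))"
    by (rule sums_Re)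
  moreover have "Re (\<Sum>i\<le>k. ?a i * cnj (?a (k - i))) = r ^ k * geg_sum \<nu> k \<theta>" for k
  proof -
    have "?a i * cnj (?a (k - i)) =
       of_real (geg_coeff \<nu> i * geg_coeff \<nu> (k - i) * r ^ k) * cis (- ((real k - 2 * real i) * \<theta>))"
      if i: "i \<le> k" for i
    proof -
      have "w ^ i * cnj w ^ (k - i) = of_real (r ^ i * r ^ (k - i)) * (cis \<theta> ^ i * cis (-\<theta>) ^ (k - i))"
        by (simp add: w_def power_mult_distrib cis_cnj)
      also have "cis \<theta> ^ i * cis (-\<theta>) ^ (k - i) = cis (- ((real k - 2 * real i) * \<theta>))"
      proof -
        have "cis \<theta> ^ i * cis (-\<theta>) ^ (k - i) = cis (real i * \<theta> + real (k - i) * (- \<theta>))"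
          by (simp only: Complex.DeMoivre cis_mult)
        also have "real i * \<theta> + real (k - i) * (- \<theta>) = - ((real k - 2 * real i) * \<theta>)"
          using i by (simp add: of_nat_diff algebra_simps)
        finally show ?thesis .
      qed
      also have "r ^ i * r ^ (k - i) = r ^ k"
        using i by (simp flip: power_add)
      finally show ?thesis by (simp add: algebra_simps)
    qed
    then have "(\<Sum>i\<le>k. ?a i * cnj (?a (k - i))) = (\<Sum>i\<le>k.
       of_real (geg_coeff \<nu> i * geg_coeff \<nu> (k - i) * r ^ k) * cis (- ((real k - 2 * real i) * \<theta>)))"
      by (intro sum.cong) auto
    then show ?thesis
      by (simp only:) (simp add: geg_sum_def sum_distrib_left mult_ac)
  qed
  moreover have "(cmod S)\<^sup>2 = (1 - 2 * r * cos \<theta> + r\<^sup>2) powr (- (\<nu> + 1))"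
  proof -
    have "cmod S = cmod (1 - w) powr (- (\<nu> + 1))"
      unfolding S_def by (subst norm_powr_real_powr') auto
    moreover have "cmod (1 - w) > 0" using w assms by auto
    ultimately have "(cmod S)\<^sup>2 = ((cmod (1 - w))\<^sup>2) powr (- (\<nu> + 1))"
      by (simp add: power2_eq_square powr_mult)
    also have "(cmod (1 - w))\<^sup>2 = (1 - r * cos \<theta>)\<^sup>2 + (r * sin \<theta>)\<^sup>2"
      by (simp add: w_def cmod_power2)
    also have "\<dots> = 1 - 2 * r * cos \<theta> + r\<^sup>2 * ((cos \<theta>)\<^sup>2 + (sin \<theta>)\<^sup>2)"
      unfolding power2_eq_square by (simp only: algebra_simps)
    finally show ?thesis by simp
  qed
  ultimately show ?thesis by simp
qed

text \<open>The factor 1 - r^2 of the Poisson kernel at the level of coefficients: it subtracts the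
  coefficient two places earlier. The index shift from m to m + 1 leaves the frequency j - 2m
  unchanged.\<close>

lemma poly_zonal_poly_geg:
  "poly (zonal_poly \<nu> j) (cos \<theta>) = geg_sum \<nu> j \<theta> - (if j < 2 then 0 else geg_sum \<nu> (j - 2) \<theta>)"
proof -
  let ?t = "\<lambda>m. (if m = 0 \<or> j - m = 0 then 0 else geg_coeff \<nu> (m - 1) * geg_coeff \<nu> (j - m - 1)) *
       cos ((real j - 2 * real m) * \<theta>)"
  have "poly (zonal_poly \<nu> j) (cos \<theta>) = geg_sum \<nu> j \<theta> - (\<Sum>m\<le>j. ?t m)"
    by (simp add: poly_zonal_poly_cos zonal_coeff_def geg_sum_def left_diff_distrib sum_subtractf)
  also have "(\<Sum>m\<le>j. ?t m) = (if j < 2 then 0 else geg_sum \<nu> (j - 2) \<theta>)"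
  proof (cases "j < 2")
    case True
    then have "?t m = 0" if "m \<le> j" for m using that by auto
    then have "(\<Sum>m\<le>j. ?t m) = (\<Sum>m\<le>j. 0)" by (intro sum.cong) auto
    then show ?thesis using True by simp
  next
    case False
    then obtain i where i: "j = Suc (Suc i)"
      by (metis add_2_eq_Suc le_Suc_ex not_less)
    have "(\<Sum>m\<le>Suc (Suc i). ?t m) = ?t 0 + (\<Sum>m\<le>Suc i. ?t (Suc m))"
      by (rule sum.atMost_Suc_shift)
    also have "\<dots> = (\<Sum>m\<le>i. ?t (Suc m))"
      using i by simp
    also have "\<dots> = (\<Sum>m\<le>i. geg_coeff \<nu> m * geg_coeff \<nu> (i - m) * cos ((real i - 2 * real m) * \<theta>))"
      by (intro sum.cong) (auto simp: i algebra_simps Suc_diff_le)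
    finally show ?thesis using i by (simp add: geg_sum_def)
  qed
  finally show ?thesis .
qed

lemma sums_shift2:
  fixes f :: "nat \<Rightarrow> real"
  assumes "(\<lambda>j. r ^ j * f j) sums S"
  shows "(\<lambda>j. r ^ j * (if j < 2 then 0 else f (j - 2))) sums (r\<^sup>2 * S)"
proof -
  have "(\<lambda>j. r ^ (j + 2) * (if j + 2 < 2 then 0 else f (j + 2 - 2))) sums (r\<^sup>2 * S)"
    using sums_mult[OF assms, of "r\<^sup>2"] by (simp add: power2_eq_square algebra_simps)
  then show ?thesis
    by (subst (asm) sums_iff_shift) (simp add: numeral_2_eq_2)
qed

lemma zonal_poly_sums:
  assumes "\<nu> \<ge> 0" "0 \<le> r" "r < 1" "-1 \<le> t" "t \<le> 1"
  shows "(\<lambda>j. r ^ j * poly (zonal_poly \<nu> j) t) sums ((1 - r\<^sup>2) * (1 - 2 * r * t + r\<^sup>2) powr (- (\<nu> + 1)))"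
proof -
  obtain \<theta> where \<theta>: "t = cos \<theta>" using assms(4,5) cos_arccos by metis
  note S = geg_sum_sums[OF assms(1-3), of \<theta>]
  have "(\<lambda>j. r ^ j * poly (zonal_poly \<nu> j) t) =
      (\<lambda>j. r ^ j * geg_sum \<nu> j \<theta> - r ^ j * (if j < 2 then 0 else geg_sum \<nu> (j - 2) \<theta>))"
    unfolding \<theta> poly_zonal_poly_geg by (simp only: right_diff_distrib)
  moreover have "(1 - r\<^sup>2) * X = X - r\<^sup>2 * X" for X
    by (simp only: left_diff_distrib mult_1)
  ultimately show ?thesis
    using sums_diff[OF S sums_shift2[OF S]] unfolding \<theta> by (simp only:)
qed

text \<open>The coefficient of r^j in (1 + r^2) (1 - r)^(-2 (\<nu> + 1)). All coefficients are
  nonnegative and every cosine is 1 at \<theta> = 0, which makes it a majorant of the zonal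
  polynomial on [-1, 1].\<close>

definition zonal_bound :: "real \<Rightarrow> nat \<Rightarrow> real" where
  "zonal_bound \<nu> j = geg_sum \<nu> j 0 + (if j < 2 then 0 else geg_sum \<nu> (j - 2) 0)"

lemma abs_poly_zonal_poly_le:
  assumes "\<nu> \<ge> 0" "-1 \<le> t" "t \<le> 1"
  shows "\<bar>poly (zonal_poly \<nu> j) t\<bar> \<le> zonal_bound \<nu> j"
proof -
  obtain \<theta> where \<theta>: "t = cos \<theta>" using assms cos_arccos by metis
  have "\<bar>geg_sum \<nu> j \<theta>\<bar> \<le> geg_sum \<nu> j 0" for j
  proof -
    have "\<bar>geg_coeff \<nu> m * geg_coeff \<nu> (j - m) * cos x\<bar> \<le> geg_coeff \<nu> m * geg_coeff \<nu> (j - m)" for m x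
      using geg_coeff_nonneg[OF assms(1)] mult_left_mono[OF abs_cos_le_one[of x], of "geg_coeff \<nu> m * geg_coeff \<nu> (j - m)"]
      by (simp add: abs_mult)
    then show ?thesis
      unfolding geg_sum_def by (intro order_trans[OF sum_abs] sum_mono) auto
  qed
  from this[of j] this[of "j - 2"] show ?thesis
    unfolding \<theta> by (auto simp: poly_zonal_poly_geg zonal_bound_def)
qed

lemma zonal_bound_summable:
  assumes "\<nu> \<ge> 0" "0 \<le> r" "r < 1"
  shows "summable (\<lambda>j. r ^ j * zonal_bound \<nu> j)"
  using sums_summable[OF sums_add[OF geg_sum_sums[OF assms, of 0] sums_shift2[OF geg_sum_sums[OF assms, of 0]]]]
  by (simp only: zonal_bound_def distrib_left)

section \<open>The Poisson kernel\<close>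

lemma zonal_kernel_smooth:
  fixes y :: "'a::euclidean_space"
  assumes "norm y = 1"
  shows "(\<lambda>\<zeta>. poly p (\<zeta> \<bullet> y)) \<in> sphere_C2"
    and "\<And>z. norm z = 1 \<Longrightarrow> laplace_beltrami (\<lambda>\<zeta>. poly p (\<zeta> \<bullet> y)) z =
      (1 - (z \<bullet> y)\<^sup>2) * poly (pderiv (pderiv p)) (z \<bullet> y) - (real DIM('a) - 1) * (z \<bullet> y) * poly (pderiv p) (z \<bullet> y)"
proof -
  let ?M = "return (count_space UNIV) ()"
  interpret prob_space ?M by (rule prob_space_return) auto
  interpret zonal_measure ?M "\<lambda>_. y" by standard (use assms in auto)
  have int: "(LINT m|?M. f m) = f ()" for f :: "unit \<Rightarrow> real"
    by (subst integral_return) auto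
  have eq: "zonal_potential ?M (\<lambda>_. y) p (\<lambda>_. 1::real) = (\<lambda>\<zeta>. poly p (\<zeta> \<bullet> y))"
    by (rule ext) (simp only: zonal_potential_def int real_scaleR_def mult_1_right)
  have m: "(\<lambda>_. 1::real) \<in> borel_measurable ?M" by simp
  show "(\<lambda>\<zeta>. poly p (\<zeta> \<bullet> y)) \<in> sphere_C2"
    using zonal_potential_smooth(1)[OF m, of 1 p] by (simp add: eq)
  show "laplace_beltrami (\<lambda>\<zeta>. poly p (\<zeta> \<bullet> y)) z =
      (1 - (z \<bullet> y)\<^sup>2) * poly (pderiv (pderiv p)) (z \<bullet> y) - (real DIM('a) - 1) * (z \<bullet> y) * poly (pderiv p) (z \<bullet> y)"
    if "norm z = 1" for z
    using zonal_potential_smooth(2)[OF m _ that, of 1 p] unfolding eq int by simp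
qed

section \<open>Zonal projections and their eigenvalues\<close>

locale sphere_setting =
  fixes N :: nat and space_type :: "'a::euclidean_space itself"
  assumes DIM: "DIM('a) = N + 1" and N: "1 \<le> N"
begin

abbreviation \<nu> :: real where "\<nu> \<equiv> (real N - 1) / 2"

abbreviation \<sigma> :: "'a measure" where "\<sigma> \<equiv> sphere_volume"

abbreviation Z :: "nat \<Rightarrow> real \<Rightarrow> real" where "Z j \<equiv> poly (zonal_poly \<nu> j)"

text \<open>As 2 \<nu> = N - 1, these are the classical eigenvalues j (j + N - 1).\<close>

abbreviation eigval :: "nat \<Rightarrow> real" where "eigval j \<equiv> real j * (real j + 2 * \<nu>)"

lemma nu_nonneg: "0 \<le> \<nu>"
  using N by simp

lemma inner_sphere_bounds:
  fixes z \<zeta> :: 'a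
  assumes "norm z = 1" "norm \<zeta> = 1"
  shows "-1 \<le> z \<bullet> \<zeta>" "z \<bullet> \<zeta> \<le> 1"
  using Cauchy_Schwarz_ineq2[of z \<zeta>] assms by auto

lemma eigval_strict_mono: "i < j \<Longrightarrow> eigval i < eigval j"
  using N by (intro mult_strict_mono') auto

lemma eigval_inj: "inj eigval"
  by (rule injI) (metis eigval_strict_mono linorder_neqE_nat less_irrefl)

text \<open>The kernel is not normalised: this is \<open>sphere_area\<close> times the orthogonal
  projection onto the spherical harmonics of degree j, whence the area factor in all later
  identities.\<close>

definition proj :: "nat \<Rightarrow> ('a \<Rightarrow> real) \<Rightarrow> 'a \<Rightarrow> real" where
  "proj j f z = (LINT \<zeta>|\<sigma>. Z j (z \<bullet> \<zeta>) * f \<zeta>)"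

lemma proj_integrable:
  assumes "continuous_on (sphere 0 1) f"
  shows "integrable \<sigma> (\<lambda>\<zeta>. Z j (z \<bullet> \<zeta>) * f \<zeta>)"
  by (intro integrable_sphere_volume_continuous continuous_intros assms)

lemma zonal_C2: "norm y = 1 \<Longrightarrow> (\<lambda>\<zeta>::'a. Z j (y \<bullet> \<zeta>)) \<in> sphere_C2"
  using zonal_kernel_smooth(1)[of y "zonal_poly \<nu> j"] by (simp add: inner_commute)

lemma zonal_ode:
  "(1 - t\<^sup>2) * poly (pderiv (pderiv (zonal_poly \<nu> j))) t - real N * t * poly (pderiv (zonal_poly \<nu> j)) t
     = - eigval j * Z j t"
proof -
  have "2 * \<nu> + 1 = real N" by (simp add: field_simps)
  then show ?thesis using zonal_poly_ode[of t \<nu> j] by (simp only: minus_mult_left)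
qed

lemma zonal_laplace:
  fixes y z :: 'a
  assumes "norm y = 1" "norm z = 1"
  shows "laplace_beltrami (\<lambda>\<zeta>. Z j (y \<bullet> \<zeta>)) z = - eigval j * Z j (y \<bullet> z)"
proof -
  have "laplace_beltrami (\<lambda>\<zeta>. Z j (\<zeta> \<bullet> y)) z = - eigval j * Z j (z \<bullet> y)"
    using zonal_kernel_smooth(2)[OF assms(1), of z "zonal_poly \<nu> j"] assms(2)
    by (simp only: DIM of_nat_add of_nat_1 add_diff_cancel_right' zonal_ode)
  then show ?thesis by (simp add: inner_commute)
qed

text \<open>The derivatives act on the polynomial kernel, so continuity of \<open>f\<close>
  suffices. In this way an eigenfunction that is only Hoelder continuous regains its
  regularity.\<close>

lemma proj_C2:
  assumes "continuous_on (sphere 0 1) f"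
  shows "proj j f \<in> sphere_C2"
    and "\<And>z. norm z = 1 \<Longrightarrow> laplace_beltrami (proj j f) z = - eigval j * proj j f z"
proof -
  interpret finite_measure \<sigma> by (rule finite_measure_sphere_volume)
  interpret zonal_measure \<sigma> "\<lambda>\<zeta>. \<zeta>"
    by standard (auto intro!: borel_measurable_sphere_volume)
  have m: "f \<in> borel_measurable \<sigma>" by (rule borel_measurable_sphere_volume_continuous[OF assms])
  obtain K where K: "\<And>z. z \<in> sphere 0 1 \<Longrightarrow> norm (f z) \<le> K"
    using continuous_on_sphere_bounded[OF assms] by blast
  have K': "\<bar>f m\<bar> \<le> K" if "m \<in> space \<sigma>" for m using K[of m] that by simp
  have eq: "zonal_potential \<sigma> (\<lambda>\<zeta>. \<zeta>) (zonal_poly \<nu> j) f = proj j f"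
    by (auto simp: zonal_potential_def proj_def)
  show "proj j f \<in> sphere_C2"
    using zonal_potential_smooth(1)[OF m K', of "zonal_poly \<nu> j"] by (simp only: eq)
  fix z :: 'a assume z: "norm z = 1"
  have "laplace_beltrami (proj j f) z = (LINT \<zeta>|\<sigma>. (- eigval j * Z j (z \<bullet> \<zeta>)) * f \<zeta>)"
    using zonal_potential_smooth(2)[OF m K' z, of "zonal_poly \<nu> j"]
    by (simp only: eq DIM of_nat_add of_nat_1 add_diff_cancel_right' zonal_ode)
  also have "\<dots> = - eigval j * proj j f z"
    unfolding proj_def mult.assoc integral_mult_right_zero ..
  finally show "laplace_beltrami (proj j f) z = - eigval j * proj j f z" .
qed

text \<open>Symmetry moves the Laplacian from \<open>f\<close> onto the kernel, where
  \<open>zonal_laplace\<close> evaluates it.\<close>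

lemma proj_laplace:
  assumes f: "f \<in> sphere_C2" and z: "norm z = 1"
  shows "proj j (laplace_beltrami f) z = - eigval j * proj j f z"
proof -
  have "proj j (laplace_beltrami f) z = (LINT \<zeta>|\<sigma>. f \<zeta> * laplace_beltrami (\<lambda>\<zeta>. Z j (z \<bullet> \<zeta>)) \<zeta>)"
    unfolding proj_def by (rule laplace_beltrami_symmetric[OF zonal_C2[OF z] f])
  also have "\<dots> = (LINT \<zeta>|\<sigma>. - eigval j * (Z j (z \<bullet> \<zeta>) * f \<zeta>))"
    by (intro Bochner_Integration.integral_cong refl) (simp add: zonal_laplace[OF z])
  finally show ?thesis by (simp only: proj_def integral_mult_right_zero)
qed

lemma proj_cong: "(\<And>\<zeta>. norm \<zeta> = 1 \<Longrightarrow> f \<zeta> = g \<zeta>) \<Longrightarrow> proj j f z = proj j g z"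
  unfolding proj_def by (intro Bochner_Integration.integral_cong refl) simp

lemma proj_cmult: "proj j (\<lambda>\<zeta>. c * f \<zeta>) z = c * proj j f z"
  unfolding proj_def mult.left_commute[of _ c] integral_mult_right_zero ..

lemma proj_orthogonal:
  assumes "i \<noteq> j" "norm y = 1" "norm z = 1"
  shows "proj i (\<lambda>\<zeta>. Z j (y \<bullet> \<zeta>)) z = 0"
proof -
  have "- eigval i * proj i (\<lambda>\<zeta>. Z j (y \<bullet> \<zeta>)) z = proj i (laplace_beltrami (\<lambda>\<zeta>. Z j (y \<bullet> \<zeta>))) z"
    by (rule proj_laplace[OF zonal_C2[OF assms(2)] assms(3), symmetric])
  also have "\<dots> = proj i (\<lambda>\<zeta>. - eigval j * Z j (y \<bullet> \<zeta>)) z"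
    by (rule proj_cong) (rule zonal_laplace[OF assms(2)])
  also have "\<dots> = - eigval j * proj i (\<lambda>\<zeta>. Z j (y \<bullet> \<zeta>)) z"
    by (rule proj_cmult)
  finally have "(eigval i - eigval j) * proj i (\<lambda>\<zeta>. Z j (y \<bullet> \<zeta>)) z = 0"
    by (simp add: left_diff_distrib)
  moreover have "eigval i \<noteq> eigval j" using eigval_inj assms(1) by (auto dest: injD)
  ultimately show ?thesis by simp
qed

section \<open>Poisson integrals and recovery of a function from its projections\<close>

definition poisson_kernel :: "real \<Rightarrow> real \<Rightarrow> real" where
  "poisson_kernel r t = (1 - r\<^sup>2) * (1 - 2 * r * t + r\<^sup>2) powr (- (\<nu> + 1))"

definition poisson :: "real \<Rightarrow> ('a \<Rightarrow> real) \<Rightarrow> 'a \<Rightarrow> real" where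
  "poisson r f z = (LINT \<zeta>|\<sigma>. poisson_kernel r (z \<bullet> \<zeta>) * f \<zeta>)"

text \<open>In this form the base stays away from zero when \<zeta> is far from z, uniformly for r
  near 1, and it depends on the points through their distance only, as the subordination integral
  requires.\<close>

lemma poisson_base:
  fixes z \<zeta> :: 'a
  assumes "norm z = 1" "norm \<zeta> = 1"
  shows "1 - 2 * r * (z \<bullet> \<zeta>) + r\<^sup>2 = (1 - r)\<^sup>2 + r * (norm (z - \<zeta>))\<^sup>2"
proof -
  have "(norm (z - \<zeta>))\<^sup>2 = 2 - 2 * (z \<bullet> \<zeta>)"
    using assms by (simp add: power2_norm_eq_inner inner_diff_left inner_diff_right norm_eq_1 inner_commute)
  then show ?thesis by (simp only:) (simp add: power2_eq_square algebra_simps)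
qed

lemma poisson_base_pos:
  fixes z \<zeta> :: 'a
  assumes "norm z = 1" "norm \<zeta> = 1" "0 \<le> r" "r < 1"
  shows "1 - 2 * r * (z \<bullet> \<zeta>) + r\<^sup>2 > 0"
  unfolding poisson_base[OF assms(1,2)] using assms by (intro add_pos_nonneg) auto

lemma poisson_kernel_nonneg: "0 \<le> r \<Longrightarrow> r < 1 \<Longrightarrow> 0 \<le> poisson_kernel r t"
  unfolding poisson_kernel_def by (intro mult_nonneg_nonneg) (auto simp: power_le_one)

lemma poisson_kernel_continuous:
  fixes z :: 'a
  assumes "norm z = 1" "0 \<le> r" "r < 1"
  shows "continuous_on (sphere 0 1) (\<lambda>\<zeta>. poisson_kernel r (z \<bullet> \<zeta>))"
  unfolding poisson_kernel_def
  by (intro continuous_intros) (use poisson_base_pos[OF assms(1) _ assms(2,3)] in force)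

text \<open>\<open>zonal_bound\<close> majorises the kernels uniformly on the sphere, which
  justifies integrating the expansion of the Poisson kernel term by term.\<close>

lemma poisson_sums:
  assumes f: "continuous_on (sphere 0 1) f" and z: "norm z = 1" and r: "0 \<le> r" "r < 1"
  shows "(\<lambda>j. r ^ j * proj j f z) sums poisson r f z"
proof -
  obtain K where K: "\<And>z. z \<in> sphere 0 1 \<Longrightarrow> norm (f z) \<le> K"
    using continuous_on_sphere_bounded[OF f] by blast
  let ?t = "\<lambda>j \<zeta>. r ^ j * (Z j (z \<bullet> \<zeta>) * f \<zeta>)"
  have bnd: "norm (?t j \<zeta>) \<le> r ^ j * zonal_bound \<nu> j * K" if \<zeta>: "norm \<zeta> = 1" for j \<zeta>
  proof -
    have "\<bar>Z j (z \<bullet> \<zeta>)\<bar> \<le> zonal_bound \<nu> j"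
      by (rule abs_poly_zonal_poly_le[OF nu_nonneg inner_sphere_bounds[OF z \<zeta>]])
    then have "\<bar>Z j (z \<bullet> \<zeta>)\<bar> * \<bar>f \<zeta>\<bar> \<le> zonal_bound \<nu> j * K"
      using K[of \<zeta>] \<zeta> by (intro mult_mono) auto
    then have "r ^ j * (\<bar>Z j (z \<bullet> \<zeta>)\<bar> * \<bar>f \<zeta>\<bar>) \<le> r ^ j * (zonal_bound \<nu> j * K)"
      using r by (intro mult_left_mono) auto
    then show ?thesis using r by (simp add: abs_mult mult.assoc)
  qed
  have sb: "summable (\<lambda>j. r ^ j * zonal_bound \<nu> j * K)"
    by (intro summable_mult2 zonal_bound_summable nu_nonneg r)
  have int: "integrable \<sigma> (?t j)" for j
    by (intro integrable_mult_right proj_integrable f)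
  have "(\<lambda>j. LINT \<zeta>|\<sigma>. ?t j \<zeta>) sums (LINT \<zeta>|\<sigma>. (\<Sum>j. ?t j \<zeta>))"
  proof (rule sums_integral[OF int])
    show "AE \<zeta> in \<sigma>. summable (\<lambda>j. norm (?t j \<zeta>))"
      by (rule AE_I2, rule summable_comparison_test'[OF sb, of 0]) (use bnd in simp)
    show "summable (\<lambda>j. LINT \<zeta>|\<sigma>. norm (?t j \<zeta>))"
    proof (rule summable_comparison_test'[OF summable_mult[OF sb, of "sphere_area TYPE('a)"], of 0])
      fix j :: nat
      have "(LINT \<zeta>|\<sigma>. norm (?t j \<zeta>)) \<le> (LINT \<zeta>|\<sigma>. r ^ j * zonal_bound \<nu> j * K)"
        by (intro integral_mono integrable_norm int integrable_sphere_volume_continuous) (use bnd in auto)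
      then show "norm (LINT \<zeta>|\<sigma>. norm (?t j \<zeta>)) \<le> sphere_area TYPE('a) * (r ^ j * zonal_bound \<nu> j * K)"
        by (simp add: measure_space_sphere_volume)
    qed
  qed
  moreover have "(LINT \<zeta>|\<sigma>. ?t j \<zeta>) = r ^ j * proj j f z" for j
    by (simp add: proj_def)
  moreover have "(LINT \<zeta>|\<sigma>. (\<Sum>j. ?t j \<zeta>)) = poisson r f z"
    unfolding poisson_def
  proof (rule Bochner_Integration.integral_cong[OF refl])
    fix \<zeta> assume "\<zeta> \<in> space \<sigma>"
    then have \<zeta>: "norm \<zeta> = 1" by simp
    have "(\<lambda>j. r ^ j * Z j (z \<bullet> \<zeta>)) sums poisson_kernel r (z \<bullet> \<zeta>)"
      unfolding poisson_kernel_def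
      by (rule zonal_poly_sums[OF nu_nonneg r inner_sphere_bounds[OF z \<zeta>]])
    from sums_mult2[OF this, of "f \<zeta>"]
    show "(\<Sum>j. ?t j \<zeta>) = poisson_kernel r (z \<bullet> \<zeta>) * f \<zeta>"
      by (simp add: sums_iff mult.assoc)
  qed
  ultimately show ?thesis by (simp only:)
qed

lemma poisson_single:
  assumes f: "continuous_on (sphere 0 1) f" and z: "norm z = 1" and r: "0 \<le> r" "r < 1"
    and 0: "\<And>j. j \<noteq> k \<Longrightarrow> proj j f z = 0"
  shows "poisson r f z = r ^ k * proj k f z"
proof -
  have "(\<lambda>j. r ^ j * proj j f z) sums (\<Sum>j\<in>{k}. r ^ j * proj j f z)"
    by (rule sums_finite) (use 0 in auto)
  then show ?thesis
    using sums_unique2[OF poisson_sums[OF f z r]] by fastforce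
qed

text \<open>The mass of the kernel is found without computing an integral over \<open>r\<close>: the
  constant 1 is \<open>Z 0\<close>, hence orthogonal to every other \<open>Z j\<close>, and only the
  term j = 0 of the expansion remains.\<close>

lemma poisson_1:
  assumes z: "norm z = 1" and r: "0 \<le> r" "r < 1"
  shows "poisson r (\<lambda>_. 1) z = sphere_area TYPE('a)"
proof -
  have "poisson r (\<lambda>_. 1) z = r ^ 0 * proj 0 (\<lambda>_. 1) z"
  proof (rule poisson_single[OF _ z r])
    show "proj j (\<lambda>_. 1) z = 0" if "j \<noteq> 0" for j
      using proj_orthogonal[OF that z z] by simp
  qed simp
  then show ?thesis by (simp add: proj_def measure_space_sphere_volume)
qed

text \<open>The kernel is a nonnegative approximate identity of mass \<open>sphere_area\<close>:
  near z continuity of f makes the contribution small, and away from z the kernel is at most (1 -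
  r^2) C.\<close>

lemma poisson_tendsto:
  assumes f: "continuous_on (sphere 0 1) f" and z: "norm z = 1"
  shows "((\<lambda>r. poisson r f z) \<longlongrightarrow> sphere_area TYPE('a) * f z) (at_left 1)"
proof (rule tendstoI)
  fix e :: real assume e: "e > 0"
  have area: "sphere_area TYPE('a) > 0" by (rule sphere_area_pos)
  define \<epsilon> where "\<epsilon> = e / (2 * sphere_area TYPE('a))"
  have \<epsilon>: "\<epsilon> > 0" using e area by (simp add: \<epsilon>_def)
  obtain K where K: "\<And>z. z \<in> sphere 0 1 \<Longrightarrow> norm (f z) \<le> K"
    using continuous_on_sphere_bounded[OF f] by blast
  obtain \<delta> where \<delta>: "\<delta> > 0" "\<And>\<zeta>. \<zeta> \<in> sphere 0 1 \<Longrightarrow> dist \<zeta> z < \<delta> \<Longrightarrow> dist (f \<zeta>) (f z) < \<epsilon>"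
    using f z \<epsilon> unfolding continuous_on_iff by (metis mem_sphere_0)
  \<comment> \<open>For r \<ge> 1/2 and points at distance at least \<delta>, the base of the kernel
    is at least r \<delta>^2 \<ge> \<delta>^2 / 2, and the exponent is negative.\<close>
  define C where "C = (\<delta>\<^sup>2 / 2) powr (- (\<nu> + 1))"
  have est: "\<bar>poisson r f z - sphere_area TYPE('a) * f z\<bar> \<le> \<epsilon> * sphere_area TYPE('a) + sphere_area TYPE('a) * (2 * \<bar>K\<bar> * (1 - r\<^sup>2) * C)" if r: "1/2 \<le> r" "r < 1" for r
  proof -
    have r0: "0 \<le> r" using r by simp
    let ?k = "\<lambda>\<zeta>. poisson_kernel r (z \<bullet> \<zeta>)"
    have kc: "continuous_on (sphere 0 1) ?k" by (rule poisson_kernel_continuous[OF z r0 r(2)])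
    have i1: "integrable \<sigma> (\<lambda>\<zeta>. ?k \<zeta> * f \<zeta>)" and i2: "integrable \<sigma> (\<lambda>\<zeta>. ?k \<zeta> * f z)"
      and i3: "integrable \<sigma> (\<lambda>\<zeta>. ?k \<zeta> * (f \<zeta> - f z))" and i4: "integrable \<sigma> (\<lambda>\<zeta>. \<epsilon> * ?k \<zeta>)"
      by (intro integrable_sphere_volume_continuous continuous_intros kc f)+
    have one: "(LINT \<zeta>|\<sigma>. ?k \<zeta>) = sphere_area TYPE('a)"
      using poisson_1[OF z r0 r(2)] by (simp add: poisson_def)
    have "poisson r f z - sphere_area TYPE('a) * f z = (LINT \<zeta>|\<sigma>. ?k \<zeta> * f \<zeta>) - (LINT \<zeta>|\<sigma>. ?k \<zeta> * f z)"
      by (simp add: poisson_def one)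
    also have "\<dots> = (LINT \<zeta>|\<sigma>. ?k \<zeta> * (f \<zeta> - f z))"
      by (subst Bochner_Integration.integral_diff[symmetric, OF i1 i2]) (simp add: right_diff_distrib)
    also have "\<bar>\<dots>\<bar> \<le> (LINT \<zeta>|\<sigma>. \<bar>?k \<zeta> * (f \<zeta> - f z)\<bar>)"
      by (rule integral_abs_bound)
    also have "\<dots> \<le> (LINT \<zeta>|\<sigma>. \<epsilon> * ?k \<zeta> + 2 * \<bar>K\<bar> * (1 - r\<^sup>2) * C)"
    proof (rule integral_mono)
      show "integrable \<sigma> (\<lambda>\<zeta>. \<bar>?k \<zeta> * (f \<zeta> - f z)\<bar>)" by (intro integrable_abs i3)
      show "integrable \<sigma> (\<lambda>\<zeta>. \<epsilon> * ?k \<zeta> + 2 * \<bar>K\<bar> * (1 - r\<^sup>2) * C)"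
        by (intro integrable_sphere_volume_continuous continuous_intros kc)
      fix \<zeta> assume "\<zeta> \<in> space \<sigma>"
      then have \<zeta>: "norm \<zeta> = 1" by simp
      have k0: "0 \<le> ?k \<zeta>" by (rule poisson_kernel_nonneg[OF r0 r(2)])
      have r2: "0 \<le> 1 - r\<^sup>2" using r by (simp add: power_le_one)
      have C0: "0 \<le> C" by (simp add: C_def)
      show "\<bar>?k \<zeta> * (f \<zeta> - f z)\<bar> \<le> \<epsilon> * ?k \<zeta> + 2 * \<bar>K\<bar> * (1 - r\<^sup>2) * C"
      proof (cases "dist \<zeta> z < \<delta>")
        case True
        then have "\<bar>f \<zeta> - f z\<bar> \<le> \<epsilon>" using \<delta>(2)[of \<zeta>] \<zeta> by (simp add: dist_real_def)
        then have "?k \<zeta> * \<bar>f \<zeta> - f z\<bar> \<le> ?k \<zeta> * \<epsilon>" using k0 by (intro mult_left_mono)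
        moreover have "0 \<le> 2 * \<bar>K\<bar> * (1 - r\<^sup>2) * C" using r2 C0 by (intro mult_nonneg_nonneg) auto
        ultimately show ?thesis using k0 by (simp add: abs_mult mult.commute)
      next
        case False
        have "\<delta>\<^sup>2 / 2 \<le> r * (norm (z - \<zeta>))\<^sup>2"
        proof -
          have "\<delta>\<^sup>2 \<le> (norm (z - \<zeta>))\<^sup>2"
            using False \<delta>(1) by (intro power_mono) (auto simp: dist_norm norm_minus_commute)
          then have "1/2 * \<delta>\<^sup>2 \<le> r * (norm (z - \<zeta>))\<^sup>2"
            using r by (intro mult_mono) auto
          then show ?thesis by simp
        qed
        then have "\<delta>\<^sup>2 / 2 \<le> 1 - 2 * r * (z \<bullet> \<zeta>) + r\<^sup>2"
          unfolding poisson_base[OF z \<zeta>] by (simp add: add_increasing)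
        then have "(1 - 2 * r * (z \<bullet> \<zeta>) + r\<^sup>2) powr (- (\<nu> + 1)) \<le> C"
          unfolding C_def using \<delta>(1) nu_nonneg by (intro powr_mono2') auto
        then have "?k \<zeta> \<le> (1 - r\<^sup>2) * C"
          unfolding poisson_kernel_def using r2 by (intro mult_left_mono)
        moreover have "\<bar>f \<zeta> - f z\<bar> \<le> 2 * \<bar>K\<bar>"
          using K[of \<zeta>] K[of z] \<zeta> z by auto
        ultimately have "?k \<zeta> * \<bar>f \<zeta> - f z\<bar> \<le> (1 - r\<^sup>2) * C * (2 * \<bar>K\<bar>)"
          using k0 r2 C0 by (intro mult_mono) auto
        moreover have "0 \<le> \<epsilon> * ?k \<zeta>" using \<epsilon> k0 by simp
        ultimately show ?thesis using k0 by (simp add: abs_mult mult_ac)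
      qed
    qed
    also have "\<dots> = (LINT \<zeta>|\<sigma>. \<epsilon> * ?k \<zeta>) + (LINT \<zeta>|\<sigma>. 2 * \<bar>K\<bar> * (1 - r\<^sup>2) * C)"
      by (intro Bochner_Integration.integral_add i4 integrable_sphere_volume_continuous continuous_intros)
    also have "\<dots> = \<epsilon> * sphere_area TYPE('a) + sphere_area TYPE('a) * (2 * \<bar>K\<bar> * (1 - r\<^sup>2) * C)"
      by (simp add: one measure_space_sphere_volume)
    finally show ?thesis .
  qed
  have "((\<lambda>r. \<epsilon> * sphere_area TYPE('a) + sphere_area TYPE('a) * (2 * \<bar>K\<bar> * (1 - r\<^sup>2) * C)) \<longlongrightarrow> \<epsilon> * sphere_area TYPE('a) + sphere_area TYPE('a) * (2 * \<bar>K\<bar> * (1 - 1\<^sup>2) * C)) (at_left 1)"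
    by (intro tendsto_intros)
  moreover have "\<epsilon> * sphere_area TYPE('a) + sphere_area TYPE('a) * (2 * \<bar>K\<bar> * (1 - 1\<^sup>2) * C) < e"
    using e area by (simp add: \<epsilon>_def)
  ultimately have "\<forall>\<^sub>F r in at_left 1. \<epsilon> * sphere_area TYPE('a) + sphere_area TYPE('a) * (2 * \<bar>K\<bar> * (1 - r\<^sup>2) * C) < e"
    by (rule order_tendstoD(2))
  moreover have "\<forall>\<^sub>F r in at_left 1. r \<in> {1/2<..<(1::real)}"
    by (rule eventually_at_leftI[of "1/2"]) auto
  ultimately show "\<forall>\<^sub>F r in at_left 1. dist (poisson r f z) (sphere_area TYPE('a) * f z) < e"
  proof eventually_elim
    case (elim r)
    with est[of r] show ?case by (simp add: dist_real_def)
  qed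
qed

text \<open>The Poisson integral is r^k times the k-th projection. Its limit at r = 1 is the
  projection on the one hand and the area times the value of \<open>f\<close> on the other.\<close>

lemma proj_single:
  assumes f: "continuous_on (sphere 0 1) f" and z: "norm z = 1"
    and 0: "\<And>j. j \<noteq> k \<Longrightarrow> proj j f z = 0"
  shows "proj k f z = sphere_area TYPE('a) * f z"
proof -
  have "\<forall>\<^sub>F r in at_left 1. r \<in> {0<..<(1::real)}"
    by (rule eventually_at_leftI[of 0]) auto
  then have "\<forall>\<^sub>F r in at_left 1. poisson r f z = r ^ k * proj k f z"
  proof eventually_elim
    case (elim r)
    then show ?case by (intro poisson_single[OF f z _ _ 0]) auto
  qed
  moreover have "((\<lambda>r. r ^ k * proj k f z) \<longlongrightarrow> 1 ^ k * proj k f z) (at_left 1)"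
    by (intro tendsto_intros)
  ultimately have "((\<lambda>r. poisson r f z) \<longlongrightarrow> proj k f z) (at_left 1)"
    by (simp add: tendsto_cong)
  then show ?thesis
    using poisson_tendsto[OF f z] by (intro tendsto_unique[of "at_left (1::real)"]) auto
qed

text \<open>Abstracts from the operator: \<open>e\<close> lists its eigenvalues on the zonal
  functions and \<open>E\<close> is the eigenvalue of \<open>f\<close>. A projection that does not
  vanish at \<open>z0\<close> fixes the index k, and injectivity of \<open>e\<close> kills all other
  projections at every point.\<close>

lemma spectral_uniqueness:
  assumes f: "continuous_on (sphere 0 1) f" and z0: "norm z0 = 1" "f z0 \<noteq> 0"
    and e: "inj e" and E: "\<And>j z. norm z = 1 \<Longrightarrow> E * proj j f z = e j * proj j f z"
  shows "\<exists>k. E = e k \<and> (\<forall>z. norm z = 1 \<longrightarrow> proj k f z = sphere_area TYPE('a) * f z \<and>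
    (\<forall>j. j \<noteq> k \<longrightarrow> proj j f z = 0))"
proof -
  have "\<exists>k. proj k f z0 \<noteq> 0"
  proof (rule ccontr)
    assume "\<nexists>k. proj k f z0 \<noteq> 0"
    \<comment> \<open>If all projections vanished at \<open>z0\<close>, the instance k = 0 of
      \<open>proj_single\<close> would force f z0 = 0.\<close>
    then have "proj 0 f z0 = sphere_area TYPE('a) * f z0" by (intro proj_single[OF f z0(1)]) auto
    with \<open>\<nexists>k. proj k f z0 \<noteq> 0\<close> show False
      using z0(2) sphere_area_pos[where ?'a = 'a] by auto
  qed
  then obtain k where k: "proj k f z0 \<noteq> 0" by blast
  have Ek: "E = e k" using E[OF z0(1), of k] k by simp
  have 0: "proj j f z = 0" if z: "norm z = 1" and "j \<noteq> k" for z j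
  proof -
    have "e j \<noteq> E" using e Ek that(2) by (auto dest: injD)
    then show "proj j f z = 0" using E[OF z, of j] by simp
  qed
  show ?thesis
    by (intro exI[of _ k] conjI allI impI Ek 0 proj_single[OF f])
qed


end

section \<open>The logarithmic kernel\<close>

lemma sphere_holder_continuous_on:
  fixes f :: "'a::euclidean_space \<Rightarrow> real"
  assumes "\<And>x y. norm x = 1 \<Longrightarrow> norm y = 1 \<Longrightarrow> \<bar>f x - f y\<bar> \<le> C * norm (x - y) powr \<gamma>" "0 < \<gamma>"
  shows "continuous_on (sphere 0 1) f"
  unfolding continuous_on_def
proof
  fix y :: 'a assume y: "y \<in> sphere 0 1"
  have "((\<lambda>x. f x - f y) \<longlongrightarrow> 0) (at y within sphere 0 1)"
  proof (rule Lim_null_comparison)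
    show "\<forall>\<^sub>F x in at y within sphere 0 1. norm (f x - f y) \<le> C * norm (x - y) powr \<gamma>"
      unfolding eventually_at_filter using assms(1) y by (auto intro!: always_eventually)
    have "((\<lambda>x. norm (x - y)) \<longlongrightarrow> 0) (at y within sphere 0 1)"
      by (intro tendsto_norm_zero LIM_zero tendsto_ident_at)
    then have "((\<lambda>x. norm (x - y) powr \<gamma>) \<longlongrightarrow> 0 powr \<gamma>) (at y within sphere 0 1)"
      by (intro tendsto_powr' tendsto_const) (use assms(2) in \<open>auto intro!: always_eventually\<close>)
    then have "((\<lambda>x. norm (x - y) powr \<gamma>) \<longlongrightarrow> 0) (at y within sphere 0 1)" by simp
    from tendsto_mult_left[OF this, of C]
    show "((\<lambda>x. C * norm (x - y) powr \<gamma>) \<longlongrightarrow> 0) (at y within sphere 0 1)" by simp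
  qed
  then show "(f \<longlongrightarrow> f y) (at y within sphere 0 1)" by (rule LIM_zero_cancel)
qed

lemma norm_diff_sphere_le:
  fixes x y :: "'a::real_normed_vector"
  assumes "norm x = 1" "norm y = 1" shows "norm (x - y) \<le> 2"
  using norm_triangle_ineq4[of x y] assms by simp

text \<open>The sphere has diameter 2, so a larger exponent can be lowered to 1 at the cost of the
  factor 2^(\<beta> - 1). Exponents up to 1 stay within the range \<gamma> \<le> N of the Riesz
  kernel bounds in every dimension.\<close>

lemma sphere_holder_exponent_le_1:
  fixes f :: "'a::euclidean_space \<Rightarrow> real"
  assumes "f \<in> sphere_holder \<beta>" "0 < \<beta>"
  obtains \<gamma> C where "0 < \<gamma>" "\<gamma> \<le> 1" "0 \<le> C"
    "\<And>x y. norm x = 1 \<Longrightarrow> norm y = 1 \<Longrightarrow> \<bar>f x - f y\<bar> \<le> C * norm (x - y) powr \<gamma>"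
proof -
  obtain C0 where "\<And>x y. norm x = 1 \<Longrightarrow> norm y = 1 \<Longrightarrow> \<bar>f x - f y\<bar> \<le> C0 * norm (x - y) powr \<beta>"
    using assms(1) unfolding sphere_holder_def by force
  then have C0: "\<bar>f x - f y\<bar> \<le> \<bar>C0\<bar> * norm (x - y) powr \<beta>" if "norm x = 1" "norm y = 1" for x y
    using that by (meson abs_ge_self mult_right_mono order_trans powr_ge_zero)
  show thesis
  proof (cases "\<beta> \<le> 1")
    case True
    then show thesis using that[of \<beta> "\<bar>C0\<bar>"] C0 assms(2) by auto
  next
    case False
    show thesis
    proof (rule that[of 1 "\<bar>C0\<bar> * 2 powr (\<beta> - 1)"])
      fix x y :: 'a assume xy: "norm x = 1" "norm y = 1"
      have "norm (x - y) powr \<beta> = norm (x - y) powr (\<beta> - 1) * norm (x - y) powr 1"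
        by (simp only: powr_add[symmetric]) simp
      also have "\<dots> \<le> 2 powr (\<beta> - 1) * norm (x - y) powr 1"
        using False norm_diff_sphere_le[OF xy] by (intro mult_right_mono powr_mono2) auto
      finally have "\<bar>C0\<bar> * norm (x - y) powr \<beta> \<le> \<bar>C0\<bar> * (2 powr (\<beta> - 1) * norm (x - y) powr 1)"
        by (intro mult_left_mono) auto
      with C0[OF xy] show "\<bar>f x - f y\<bar> \<le> \<bar>C0\<bar> * 2 powr (\<beta> - 1) * norm (x - y) powr 1"
        by (simp add: mult.assoc)
    qed auto
  qed
qed

section \<open>The kernel as a superposition of Poisson kernels\<close>

lemma integral_powr_unit_interval:
  assumes "a > 0"
  shows "integrable lborel (\<lambda>r::real. indicator {0<..<1} r * r powr (a - 1))"
    and "(LINT r|lborel. indicator {0<..<1} r * r powr (a - 1)) = 1 / a"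
proof -
  have "((\<lambda>r. r powr (a - 1)) has_integral (1 powr (a - 1 + 1) / (a - 1 + 1) - 0 powr (a - 1 + 1) / (a - 1 + 1))) {0..1}"
    using has_integral_powr_from_0[of "a - 1" 1] assms by simp
  then have 1: "((\<lambda>r. r powr (a - 1)) has_integral 1 / a) {0<..<1}"
    by (simp add: has_integral_Icc_iff_Ioo)
  then have 2: "(\<lambda>r. r powr (a - 1)) absolutely_integrable_on {0<..<1}"
    by (intro nonnegative_absolutely_integrable_1) (auto simp: has_integral_integrable)
  have m: "(\<lambda>r::real. indicator {0<..<1} r * r powr (a - 1)) \<in> borel_measurable lborel"
    by measurable
  show "integrable lborel (\<lambda>r::real. indicator {0<..<1} r * r powr (a - 1))"
    using 2 integrable_completion[OF m] by (simp add: set_integrable_def)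
  show "(LINT r|lborel. indicator {0<..<1} r * r powr (a - 1)) = 1 / a"
    using set_lebesgue_integral_eq_integral(2)[OF 2] integral_unique[OF 1] integral_completion[OF m]
    by (simp add: set_lebesgue_integral_def)
qed

lemma power2_powr:
  fixes x :: real
  assumes "x > 0" shows "(x\<^sup>2) powr a = x powr (2 * a)"
proof -
  have "(x\<^sup>2) powr a = (x powr 2) powr a" using assms by simp
  then show ?thesis by (simp only: powr_powr)
qed

text \<open>The substitution \<open>x = r * d\<^sup>2 / ((1 - r)\<^sup>2 + r * d\<^sup>2)\<close> turns the integral into a Beta integral.\<close>

lemma subordination_integral:
  fixes d :: real and N :: nat
  assumes d: "d > 0" and N: "1 \<le> N"
  defines "k \<equiv> \<lambda>r. r powr (real N / 2 - 1) * (1 + r) * ((1 - r)\<^sup>2 + r * d\<^sup>2) powr (- ((real N + 1) / 2))"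
  shows "integrable lborel (\<lambda>r. indicator {0<..<1} r * k r)"
    and "(LINT r|lborel. indicator {0<..<1} r * k r) = Beta (real N / 2) (1 / 2) / d ^ N"
proof -
  define Q where "Q r = (1 - r)\<^sup>2 + r * d\<^sup>2" for r
  define g where "g r = r * d\<^sup>2 / Q r" for r
  define g' where "g' r = d\<^sup>2 * (1 - r\<^sup>2) / (Q r)\<^sup>2" for r
  define f where "f x = x powr (real N / 2 - 1) * (1 - x) powr (1 / 2 - 1)" for x :: real
  have Q: "Q r > 0" if "0 \<le> r" for r
  proof (cases "r = 0")
    case False
    then show ?thesis using that d by (auto simp: Q_def intro!: add_nonneg_pos)
  qed (simp add: Q_def)
  have dg: "(g has_field_derivative g' r) (at r)" if "0 \<le> r" for r
  proof -
    have dQ: "(Q has_field_derivative (- 2 * (1 - r) + d\<^sup>2)) (at r)"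
      unfolding Q_def[abs_def] by (auto intro!: derivative_eq_intros)
    have "((\<lambda>r. r * d\<^sup>2) has_field_derivative d\<^sup>2) (at r)"
      by (auto intro!: derivative_eq_intros)
    from DERIV_divide[OF this dQ] Q[OF that]
    have "(g has_field_derivative (d\<^sup>2 * Q r - r * d\<^sup>2 * (- 2 * (1 - r) + d\<^sup>2)) / (Q r * Q r)) (at r)"
      by (simp only: g_def[abs_def] less_irrefl not_False_eq_True)
    moreover have "d\<^sup>2 * Q r - r * d\<^sup>2 * (- 2 * (1 - r) + d\<^sup>2) = d\<^sup>2 * (1 - r\<^sup>2)"
      by (simp add: Q_def power2_eq_square algebra_simps)
    ultimately show ?thesis by (simp only: g'_def power2_eq_square)
  qed
  have g'pos: "g' r > 0" if "0 < r" "r < 1" for r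
    using that d Q[of r] by (auto simp: g'_def power_less_one_iff intro!: divide_pos_pos mult_pos_pos)
  have mono: "g r < g s" if "0 < r" "r < s" "s < 1" for r s
  proof (rule DERIV_pos_imp_increasing[OF that(2)])
    fix x assume "r \<le> x" "x \<le> s"
    then show "\<exists>y. (g has_real_derivative y) (at x) \<and> 0 < y"
      using dg[of x] g'pos[of x] that by auto
  qed
  have inj: "inj_on g {0<..<1}"
    by (rule linorder_inj_onI) (use mono in force)+
  have g01: "0 < g r" "g r < 1" if "0 < r" "r < 1" for r
    using that d Q[of r] by (auto simp: g_def Q_def)
  have img: "g ` {0<..<1} = {0<..<1}"
  proof
    show "{0<..<1} \<subseteq> g ` {0<..<1}"
    proof
      fix x :: real assume x: "x \<in> {0<..<1}"
      have c: "continuous_on {0..1} g"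
        by (intro continuous_at_imp_continuous_on ballI) (use dg DERIV_isCont in auto)
      have "\<exists>r\<ge>0. r \<le> 1 \<and> g r = x"
        by (rule IVT'[OF _ _ _ c]) (use x d in \<open>auto simp: g_def Q_def\<close>)
      then obtain r where r: "0 \<le> r" "r \<le> 1" "g r = x" by blast
      have "r \<noteq> 0" "r \<noteq> 1" using r x d by (auto simp: g_def Q_def)
      with r show "x \<in> g ` {0<..<1}" by auto
    qed
  qed (use g01 in auto)
  have B: "(f has_integral Beta (real N / 2) (1 / 2)) {0<..<1}"
    using has_integral_Beta_real[of "real N / 2" "1 / 2"] N
    by (simp add: f_def[abs_def] has_integral_Icc_iff_Ioo)
  have fabs: "f absolutely_integrable_on {0<..<1}"
    using B by (intro nonnegative_absolutely_integrable_1) (auto simp: f_def has_integral_integrable)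
  have "(\<lambda>r. \<bar>g' r\<bar> * f (g r)) absolutely_integrable_on {0<..<1} \<and>
      integral {0<..<1} (\<lambda>r. \<bar>g' r\<bar> * f (g r)) = Beta (real N / 2) (1 / 2)"
    using fabs integral_unique[OF B]
    by (subst has_absolute_integral_change_of_variables_1')
       (use dg inj in \<open>auto simp: img intro: has_field_derivative_at_within\<close>)
  \<comment> \<open>Here 1 - g r = (1 - r)^2 / Q r, so its square root cancels the factor 1 - r of
    g'. The powers of Q add up to -(N/2 - 1) + 1/2 - 2 = -(N + 1)/2.\<close>
  moreover have sub: "\<bar>g' r\<bar> * f (g r) = d ^ N * k r" if "r \<in> {0<..<1}" for r
  proof -
    have r: "0 < r" "r < 1" using that by auto
    have q: "Q r > 0" using Q r by simp
    have "1 - g r = (1 - r)\<^sup>2 / Q r" using q by (simp add: g_def field_simps) (simp add: Q_def)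
    then have "f (g r) = (r * d\<^sup>2 / Q r) powr (real N / 2 - 1) * ((1 - r)\<^sup>2 / Q r) powr (- (1/2))"
      by (simp add: f_def g_def)
    also have "\<dots> = r powr (real N / 2 - 1) * (d\<^sup>2) powr (real N / 2 - 1) / Q r powr (real N / 2 - 1) *
        (((1 - r)\<^sup>2) powr (- (1/2)) / Q r powr (- (1/2)))"
    proof -
      have *: "(x * y / q) powr a = x powr a * y powr a / q powr a" "(y / q) powr a = y powr a / q powr a"
        if "x > 0" "y > 0" "q > 0" for x y q a :: real
        using that by (simp_all add: powr_divide powr_mult)
      have "(1 - r)\<^sup>2 > 0" "d\<^sup>2 > 0" using r d by auto
      then show ?thesis using *(1)[OF r(1) _ q, of "d\<^sup>2"] *(2)[OF r(1) _ q, of "(1 - r)\<^sup>2"] by (simp only:)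
    qed
    also have "((1 - r)\<^sup>2) powr (- (1/2)) = 1 / (1 - r)"
    proof -
      have "((1 - r)\<^sup>2) powr (- (1/2)) = (1 - r) powr (2 * (- (1/2)))"
        using r by (intro power2_powr) auto
      also have "\<dots> = 1 / (1 - r)" using r by (simp add: powr_minus_divide)
      finally show ?thesis .
    qed
    also have "(d\<^sup>2) powr (real N / 2 - 1) = d ^ N / d\<^sup>2"
    proof -
      have "(d\<^sup>2) powr (real N / 2 - 1) = d powr (2 * (real N / 2 - 1))"
        using d by (rule power2_powr)
      also have "2 * (real N / 2 - 1) = real N - 2" by simp
      also have "d powr (real N - 2) = d ^ N / d\<^sup>2"
        using d by (simp add: powr_diff powr_realpow)
      finally show ?thesis .
    qed
    finally have F: "f (g r) = r powr (real N / 2 - 1) * (d ^ N / d\<^sup>2) / Q r powr (real N / 2 - 1) *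
        (1 / (1 - r) / Q r powr (- (1/2)))" .
    have P: "Q r powr (- ((real N + 1) / 2)) = 1 / (Q r powr (real N / 2 - 1) * Q r powr (- (1/2)) * (Q r)\<^sup>2)"
    proof -
      have "Q r powr (real N / 2 - 1) * Q r powr (- (1/2)) * (Q r)\<^sup>2 = Q r powr (real N / 2 - 1 + (- (1/2)) + 2)"
        using q by (simp only: powr_add powr_numeral)
      also have "real N / 2 - 1 + (- (1/2)) + 2 = (real N + 1) / 2" by (simp add: add_divide_distrib)
      finally show ?thesis by (simp only: powr_minus_divide)
    qed
    have "(1 - r) * (1 + r) = 1 - r\<^sup>2" by (simp add: power2_eq_square algebra_simps)
    then have G: "\<bar>g' r\<bar> = d\<^sup>2 * ((1 - r) * (1 + r)) / (Q r)\<^sup>2"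
      using abs_of_pos[OF g'pos[OF r]] by (simp only: g'_def)
    have "\<bar>g' r\<bar> * f (g r) = d ^ N * (r powr (real N / 2 - 1) * (1 + r) * Q r powr (- ((real N + 1) / 2)))"
    proof -
      have "e * (s * t) / q\<^sup>2 * (A * (D / e) / q1 * (1 / s / q2)) = D * (A * t * (1 / (q1 * q2 * q\<^sup>2)))"
        if "e \<noteq> 0" "s \<noteq> 0" for A D e s t q q1 q2 :: real
        using that by (simp add: mult_ac)
      from this[of "d\<^sup>2" "1 - r"] show ?thesis
        unfolding F P G using r d by simp
    qed
    then show ?thesis by (simp only: k_def Q_def)
  qed
  moreover have "set_integrable lebesgue {0<..<1} (\<lambda>r. \<bar>g' r\<bar> * f (g r)) =
      set_integrable lebesgue {0<..<1} (\<lambda>r. d ^ N * k r)"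
    by (rule set_integrable_cong[OF refl refl sub])
  moreover have "integral {0<..<1} (\<lambda>r. \<bar>g' r\<bar> * f (g r)) = integral {0<..<1} (\<lambda>r. d ^ N * k r)"
    by (rule Henstock_Kurzweil_Integration.integral_cong[OF sub])
  ultimately have A: "(\<lambda>r. d ^ N * k r) absolutely_integrable_on {0<..<1}"
      "integral {0<..<1} (\<lambda>r. d ^ N * k r) = Beta (real N / 2) (1 / 2)"
    by auto
  \<comment> \<open>The change of variables takes place on the completed measure; Borel
    measurability of the integrand brings the result back to \<open>lborel\<close>, where Fubini is
    applied.\<close>
  have m: "(\<lambda>r. indicator {0<..<1} r * (d ^ N * k r)) \<in> borel_measurable lborel"
    unfolding k_def by measurable
  have i: "integrable lborel (\<lambda>r. indicator {0<..<1} r * (d ^ N * k r))"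
    using A(1) integrable_completion[OF m] by (simp add: set_integrable_def)
  have l: "(LINT r|lborel. indicator {0<..<1} r * (d ^ N * k r)) = Beta (real N / 2) (1 / 2)"
    using set_lebesgue_integral_eq_integral(2)[OF A(1), unfolded set_lebesgue_integral_def real_scaleR_def]
      A(2) integral_completion[OF m] by (simp only:)
  have eq: "indicator {0<..<1} r * k r = (1 / d ^ N) * (indicator {0<..<1} r * (d ^ N * k r))" for r :: real
    using d by simp
  show "integrable lborel (\<lambda>r. indicator {0<..<1} r * k r)"
    unfolding eq by (rule integrable_mult_right[OF i])
  show "(LINT r|lborel. indicator {0<..<1} r * k r) = Beta (real N / 2) (1 / 2) / d ^ N"
    unfolding eq integral_mult_right_zero l by simp
qed

lemma Digamma_plus_nat:
  fixes x :: real
  assumes "x > 0"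
  shows "Digamma (x + real k) = Digamma x + (\<Sum>i<k. 1 / (x + real i))"
proof (induction k)
  case (Suc k)
  have "Digamma (x + real k + 1) = Digamma (x + real k) + 1 / (x + real k)"
    using assms by (intro Digamma_plus1) auto
  with Suc show ?case by (simp add: algebra_simps)
qed simp

section \<open>The logarithmic operator in integral form\<close>

context sphere_setting
begin

abbreviation log_kernel :: "('a \<Rightarrow> real) \<Rightarrow> 'a \<Rightarrow> 'a \<Rightarrow> real" where
  "log_kernel f z \<zeta> \<equiv> (f z - f \<zeta>) / norm (z - \<zeta>) ^ N"

text \<open>The right-hand side of the integral formula, kept apart from
  \<open>conf_log_laplacian\<close>, which is defined as a limit. The two are identified on Hoelder
  functions by \<open>conf_log_laplacian_eq\<close>, so the spectral argument can work with
  integrals alone.\<close>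

definition log_form :: "('a \<Rightarrow> real) \<Rightarrow> 'a \<Rightarrow> real" where
  "log_form f z = log_c N * (LINT \<zeta>|\<sigma>. log_kernel f z \<zeta>) + log_A N * f z"

lemma riesz_bound:
  assumes "0 < \<gamma>" "\<gamma> \<le> 1"
  shows "\<exists>B\<ge>0. \<forall>z::'a. norm z = 1 \<longrightarrow>
    integrable \<sigma> (\<lambda>\<zeta>. norm (z - \<zeta>) powr (\<gamma> - real N)) \<and>
    (LINT \<zeta>|\<sigma>. norm (z - \<zeta>) powr (\<gamma> - real N)) \<le> B"
proof -
  have "DIM('a) - 1 = N" "\<gamma> \<le> real (DIM('a) - 1)" using DIM N assms by auto
  then show ?thesis using riesz_kernel_bound[where ?'a = 'a, of \<gamma>] assms(1) by metis
qed

lemma norm_diff_measurable: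
  fixes z :: 'a
  shows "(\<lambda>\<zeta>. norm (z - \<zeta>)) \<in> borel_measurable \<sigma>"
  by (rule borel_measurable_sphere_volume) measurable

lemma log_kernel_measurable:
  assumes "f \<in> borel_measurable \<sigma>"
  shows "log_kernel f z \<in> borel_measurable \<sigma>"
proof -
  note [measurable] = assms norm_diff_measurable[of z]
  show ?thesis by measurable
qed

lemma log_kernel_bound:
  assumes f: "\<And>x y. norm x = 1 \<Longrightarrow> norm y = 1 \<Longrightarrow> \<bar>f x - f y\<bar> \<le> C * norm (x - y) powr \<gamma>"
    and z: "norm z = 1" and \<zeta>: "norm \<zeta> = 1"
  shows "\<bar>log_kernel f z \<zeta>\<bar> \<le> C * norm (z - \<zeta>) powr (\<gamma> - real N)"
proof (cases "z = \<zeta>")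
  case False
  then have d: "norm (z - \<zeta>) > 0" by simp
  have "\<bar>log_kernel f z \<zeta>\<bar> = \<bar>f z - f \<zeta>\<bar> / norm (z - \<zeta>) ^ N" by (simp add: abs_divide)
  also have "\<dots> \<le> C * norm (z - \<zeta>) powr \<gamma> / norm (z - \<zeta>) ^ N"
    by (intro divide_right_mono f z \<zeta>) auto
  also have "\<dots> = C * norm (z - \<zeta>) powr (\<gamma> - real N)"
    using d by (simp add: powr_diff powr_realpow)
  finally show ?thesis .
qed simp

lemma log_kernel_integrable:
  assumes f: "\<And>x y. norm x = 1 \<Longrightarrow> norm y = 1 \<Longrightarrow> \<bar>f x - f y\<bar> \<le> C * norm (x - y) powr \<gamma>"
    and \<gamma>: "0 < \<gamma>" "\<gamma> \<le> 1" and z: "norm z = 1"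
  shows "integrable \<sigma> (log_kernel f z)"
proof -
  have "integrable \<sigma> (\<lambda>\<zeta>. norm (z - \<zeta>) powr (\<gamma> - real N))"
    using riesz_bound[OF \<gamma>] z by blast
  from integrable_mult_right[OF this, of C] show ?thesis
  proof (rule Bochner_Integration.integrable_bound)
    show "log_kernel f z \<in> borel_measurable \<sigma>"
      by (intro log_kernel_measurable borel_measurable_sphere_volume_continuous sphere_holder_continuous_on[OF f \<gamma>(1)])
    show "AE \<zeta> in \<sigma>. norm (log_kernel f z \<zeta>) \<le> norm (C * norm (z - \<zeta>) powr (\<gamma> - real N))"
    proof (rule AE_I2)
      fix \<zeta> assume "\<zeta> \<in> space \<sigma>"
      then have "norm \<zeta> = 1" by simp
      from log_kernel_bound[OF f z this]
      show "norm (log_kernel f z \<zeta>) \<le> norm (C * norm (z - \<zeta>) powr (\<gamma> - real N))"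
        unfolding real_norm_def by linarith
    qed
  qed
qed

lemma log_kernel_abs_integral_bound:
  assumes f: "\<And>x y. norm x = 1 \<Longrightarrow> norm y = 1 \<Longrightarrow> \<bar>f x - f y\<bar> \<le> C * norm (x - y) powr \<gamma>"
    and C: "0 \<le> C" and \<gamma>: "0 < \<gamma>" "\<gamma> \<le> 1"
  shows "\<exists>B\<ge>0. \<forall>z. norm z = 1 \<longrightarrow> (LINT \<zeta>|\<sigma>. \<bar>log_kernel f z \<zeta>\<bar>) \<le> B"
proof -
  obtain B where B: "B \<ge> 0" "\<forall>z::'a. norm z = 1 \<longrightarrow>
    integrable \<sigma> (\<lambda>\<zeta>. norm (z - \<zeta>) powr (\<gamma> - real N)) \<and>
    (LINT \<zeta>|\<sigma>. norm (z - \<zeta>) powr (\<gamma> - real N)) \<le> B"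
    using riesz_bound[OF \<gamma>] by blast
  have "(LINT \<zeta>|\<sigma>. \<bar>log_kernel f z \<zeta>\<bar>) \<le> C * B" if z: "norm z = 1" for z
  proof -
    have "(LINT \<zeta>|\<sigma>. \<bar>log_kernel f z \<zeta>\<bar>) \<le> (LINT \<zeta>|\<sigma>. C * norm (z - \<zeta>) powr (\<gamma> - real N))"
    proof (rule integral_mono)
      show "integrable \<sigma> (\<lambda>\<zeta>. \<bar>log_kernel f z \<zeta>\<bar>)"
        by (intro integrable_abs log_kernel_integrable[OF f \<gamma> z])
      show "integrable \<sigma> (\<lambda>\<zeta>. C * norm (z - \<zeta>) powr (\<gamma> - real N))"
        using B(2) z by (intro integrable_mult_right) blast
      show "\<bar>log_kernel f z \<zeta>\<bar> \<le> C * norm (z - \<zeta>) powr (\<gamma> - real N)" if "\<zeta> \<in> space \<sigma>" for \<zeta>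
        by (rule log_kernel_bound[OF f z]) (use that in auto)
    qed
    also have "\<dots> = C * (LINT \<zeta>|\<sigma>. norm (z - \<zeta>) powr (\<gamma> - real N))" by simp
    also have "\<dots> \<le> C * B" using B(2) z C by (intro mult_left_mono) auto
    finally show ?thesis .
  qed
  moreover have "0 \<le> C * B" using C B(1) by simp
  ultimately show ?thesis by blast
qed

lemma antisymmetric_integral_0:
  fixes W :: "'a \<Rightarrow> 'a \<Rightarrow> real"
  assumes W: "integrable (\<sigma> \<Otimes>\<^sub>M \<sigma>) (case_prod W)"
    and anti: "\<And>z \<zeta>. norm z = 1 \<Longrightarrow> norm \<zeta> = 1 \<Longrightarrow> W \<zeta> z = - W z \<zeta>"
  shows "(LINT z|\<sigma>. (LINT \<zeta>|\<sigma>. W z \<zeta>)) = 0"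
proof -
  interpret finite_measure \<sigma> by (rule finite_measure_sphere_volume)
  interpret pair_sigma_finite \<sigma> \<sigma> ..
  have "(LINT z|\<sigma>. (LINT \<zeta>|\<sigma>. W z \<zeta>)) = (LINT \<zeta>|\<sigma>. (LINT z|\<sigma>. W z \<zeta>))"
    by (rule Fubini_integral[OF W, symmetric])
  also have "\<dots> = (LINT \<zeta>|\<sigma>. (LINT z|\<sigma>. - W \<zeta> z))"
    by (intro Bochner_Integration.integral_cong refl anti) auto
  also have "\<dots> = - (LINT z|\<sigma>. (LINT \<zeta>|\<sigma>. W z \<zeta>))" by simp
  finally show ?thesis by simp
qed

text \<open>After cancellation of the diagonal terms the two sides differ by the integral of an
  antisymmetric kernel.\<close>

lemma log_form_symmetric:
  assumes u: "\<And>x y. norm x = 1 \<Longrightarrow> norm y = 1 \<Longrightarrow> \<bar>u x - u y\<bar> \<le> C * norm (x - y) powr \<gamma>"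
    and v: "\<And>x y. norm x = 1 \<Longrightarrow> norm y = 1 \<Longrightarrow> \<bar>v x - v y\<bar> \<le> C' * norm (x - y) powr \<gamma>'"
    and C: "0 \<le> C" "0 \<le> C'" and \<gamma>: "0 < \<gamma>" "\<gamma> \<le> 1" "0 < \<gamma>'" "\<gamma>' \<le> 1"
  shows "(LINT z|\<sigma>. v z * log_form u z - u z * log_form v z) = 0"
proof -
  interpret finite_measure \<sigma> by (rule finite_measure_sphere_volume)
  note partial_integral_measurable = borel_measurable_lebesgue_integral
  interpret pair_sigma_finite \<sigma> \<sigma> ..
  have uc: "continuous_on (sphere 0 1) u" by (rule sphere_holder_continuous_on[OF u \<gamma>(1)])
  have vc: "continuous_on (sphere 0 1) v" by (rule sphere_holder_continuous_on[OF v \<gamma>(3)])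
  note [measurable] = borel_measurable_sphere_volume_continuous[OF uc] borel_measurable_sphere_volume_continuous[OF vc]
  have ui: "integrable \<sigma> (log_kernel u z)" if "norm z = 1" for z
    by (rule log_kernel_integrable[OF u \<gamma>(1,2) that])
  have vi: "integrable \<sigma> (log_kernel v z)" if "norm z = 1" for z
    by (rule log_kernel_integrable[OF v \<gamma>(3,4) that])
  define W where "W z \<zeta> = v z * log_kernel u z \<zeta> - u z * log_kernel v z \<zeta>" for z \<zeta>
  have "\<exists>B\<ge>0. \<forall>z. norm z = 1 \<longrightarrow> (LINT \<zeta>|\<sigma>. \<bar>log_kernel u z \<zeta>\<bar>) \<le> B"
    by (rule log_kernel_abs_integral_bound[OF u C(1) \<gamma>(1,2)])
  then obtain B where B: "\<And>z. norm z = 1 \<Longrightarrow> (LINT \<zeta>|\<sigma>. \<bar>log_kernel u z \<zeta>\<bar>) \<le> B" by blast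
  have "\<exists>B\<ge>0. \<forall>z. norm z = 1 \<longrightarrow> (LINT \<zeta>|\<sigma>. \<bar>log_kernel v z \<zeta>\<bar>) \<le> B"
    by (rule log_kernel_abs_integral_bound[OF v C(2) \<gamma>(3,4)])
  then obtain B' where B': "\<And>z. norm z = 1 \<Longrightarrow> (LINT \<zeta>|\<sigma>. \<bar>log_kernel v z \<zeta>\<bar>) \<le> B'" by blast
  obtain U V where U: "\<And>z. norm z = 1 \<Longrightarrow> \<bar>u z\<bar> \<le> U" and V: "\<And>z. norm z = 1 \<Longrightarrow> \<bar>v z\<bar> \<le> V"
    using continuous_on_sphere_bounded[OF uc] continuous_on_sphere_bounded[OF vc]
    unfolding Ball_def mem_sphere_0 real_norm_def by blast
  have Wi: "integrable \<sigma> (W z)" if "norm z = 1" for z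
    unfolding W_def by (intro Bochner_Integration.integrable_diff integrable_mult_right ui vi that)
  have Wb: "(LINT \<zeta>|\<sigma>. \<bar>W z \<zeta>\<bar>) \<le> V * B + U * B'" if z: "norm z = 1" for z
  proof -
    have U0: "0 \<le> U" "0 \<le> V" using U[OF z] V[OF z] by auto
    have "(LINT \<zeta>|\<sigma>. \<bar>W z \<zeta>\<bar>) \<le> (LINT \<zeta>|\<sigma>. \<bar>v z\<bar> * \<bar>log_kernel u z \<zeta>\<bar> + \<bar>u z\<bar> * \<bar>log_kernel v z \<zeta>\<bar>)"
    proof (rule integral_mono)
      show "\<bar>W z \<zeta>\<bar> \<le> \<bar>v z\<bar> * \<bar>log_kernel u z \<zeta>\<bar> + \<bar>u z\<bar> * \<bar>log_kernel v z \<zeta>\<bar>" for \<zeta>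
        unfolding W_def using abs_triangle_ineq4[of "v z * log_kernel u z \<zeta>" "u z * log_kernel v z \<zeta>"]
        by (simp only: abs_mult)
    qed (intro Bochner_Integration.integrable_add integrable_mult_right integrable_abs Wi ui vi z)+
    also have "\<dots> = \<bar>v z\<bar> * (LINT \<zeta>|\<sigma>. \<bar>log_kernel u z \<zeta>\<bar>) + \<bar>u z\<bar> * (LINT \<zeta>|\<sigma>. \<bar>log_kernel v z \<zeta>\<bar>)"
      by (subst Bochner_Integration.integral_add)
         (simp_all only: integral_mult_right_zero integrable_mult_right integrable_abs ui[OF z] vi[OF z])
    also have "\<dots> \<le> V * B + U * B'"
      using U[OF z] V[OF z] B[OF z] B'[OF z] U0 by (intro add_mono mult_mono) auto
    finally show ?thesis .
  qed
  have [measurable]: "(\<lambda>p. norm (fst p - snd p)) \<in> borel_measurable (\<sigma> \<Otimes>\<^sub>M \<sigma>)"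
  proof -
    have [measurable]: "(\<lambda>x. x) \<in> borel_measurable \<sigma>"
      by (rule borel_measurable_sphere_volume) measurable
    show ?thesis by measurable
  qed
  have Wm: "case_prod W \<in> borel_measurable (\<sigma> \<Otimes>\<^sub>M \<sigma>)"
    unfolding W_def split_beta' by measurable
  \<comment> \<open>The power -N of the distance is not integrable by itself; the Hoelder bounds on
    u and v make the inner integral finite, uniformly in the outer variable, and so permit
    Fubini.\<close>
  have "integrable (\<sigma> \<Otimes>\<^sub>M \<sigma>) (case_prod W)"
  proof (rule Fubini_integrable[OF Wm])
    show "AE x in \<sigma>. integrable \<sigma> (\<lambda>y. case_prod W (x, y))"
      using Wi by (intro AE_I2) auto
    show "integrable \<sigma> (\<lambda>x. LINT y|\<sigma>. norm (case_prod W (x, y)))"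
    proof (rule integrable_sphere_volume_bounded)
      have "(\<lambda>(x, y). norm (W x y)) \<in> borel_measurable (\<sigma> \<Otimes>\<^sub>M \<sigma>)"
        using measurable_compose[OF Wm borel_measurable_norm] by (simp add: split_beta')
      then have "(\<lambda>x. LINT y|\<sigma>. norm (W x y)) \<in> borel_measurable \<sigma>"
        by (rule partial_integral_measurable)
      then show "(\<lambda>x. LINT y|\<sigma>. norm (case_prod W (x, y))) \<in> borel_measurable \<sigma>" by simp
      show "norm (LINT y|\<sigma>. norm (case_prod W (z, y))) \<le> V * B + U * B'" if "z \<in> sphere 0 1" for z
        using Wb[of z] that by simp
    qed
  qed
  then have "(LINT z|\<sigma>. (LINT \<zeta>|\<sigma>. W z \<zeta>)) = 0"
  proof (rule antisymmetric_integral_0)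
    show "W \<zeta> z = - W z \<zeta>" for z \<zeta>
    proof -
      \<comment> \<open>The diagonal product u z * v z occurs in both terms and cancels, which
        exposes the antisymmetry.\<close>
      have "W z \<zeta> = (u z * v \<zeta> - v z * u \<zeta>) / norm (z - \<zeta>) ^ N" for z \<zeta>
        by (simp only: W_def times_divide_eq_right diff_divide_distrib[symmetric]) (simp add: algebra_simps)
      then show ?thesis by (simp add: norm_minus_commute[of \<zeta> z] minus_divide_left)
    qed
  qed
  moreover have "(LINT z|\<sigma>. v z * log_form u z - u z * log_form v z) = (LINT z|\<sigma>. log_c N * (LINT \<zeta>|\<sigma>. W z \<zeta>))"
  proof (rule Bochner_Integration.integral_cong[OF refl])
    fix z assume "z \<in> space \<sigma>"
    then have z: "norm z = 1" by simp
    have "(LINT \<zeta>|\<sigma>. W z \<zeta>) = v z * (LINT \<zeta>|\<sigma>. log_kernel u z \<zeta>) - u z * (LINT \<zeta>|\<sigma>. log_kernel v z \<zeta>)"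
      unfolding W_def using ui[OF z] vi[OF z]
      by (simp only: Bochner_Integration.integral_diff integrable_mult_right integral_mult_right_zero)
    then show "v z * log_form u z - u z * log_form v z = log_c N * (LINT \<zeta>|\<sigma>. W z \<zeta>)"
      by (simp only: log_form_def) (simp add: algebra_simps)
  qed
  ultimately show ?thesis by simp
qed


text \<open>The constant does not depend on the pole \<open>y\<close>; this lets the bound pass
  under the integral defining \<open>proj\<close>. The exponent is written as a power 1 to match the
  Hoelder format.\<close>

lemma zonal_lipschitz:
  "\<exists>C\<ge>0. \<forall>y x x'::'a. norm y = 1 \<longrightarrow> norm x = 1 \<longrightarrow> norm x' = 1 \<longrightarrow>
    \<bar>Z k (y \<bullet> x) - Z k (y \<bullet> x')\<bar> \<le> C * norm (x - x') powr 1"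
proof -
  obtain C where C: "C \<ge> 0" "\<And>t. \<bar>t\<bar> \<le> 1 \<Longrightarrow> \<bar>poly (pderiv (zonal_poly \<nu> k)) t\<bar> \<le> C"
    using poly_bounded_on_interval by metis
  show ?thesis
  proof (intro exI[of _ C] conjI C(1) allI impI)
    fix y x x' :: 'a assume n: "norm y = 1" "norm x = 1" "norm x' = 1"
    have "norm (Z k (y \<bullet> x) - Z k (y \<bullet> x')) \<le> C * norm (y \<bullet> x - y \<bullet> x')"
    proof (rule field_differentiable_bound[of "{-1..1}"])
      show "(Z k has_field_derivative poly (pderiv (zonal_poly \<nu> k)) t) (at t within {-1..1})" for t
        by (rule has_field_derivative_at_within[OF poly_DERIV])
      show "norm (poly (pderiv (zonal_poly \<nu> k)) t) \<le> C" if "t \<in> {-1..1}" for t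
        using C(2)[of t] that by (simp add: abs_le_iff)
    qed (use inner_sphere_bounds[of y x] inner_sphere_bounds[of y x'] n in auto)
    also have "\<dots> \<le> C * norm (x - x')"
      using Cauchy_Schwarz_ineq2[of y "x - x'"] n C(1) by (intro mult_left_mono) (auto simp: inner_diff_right)
    finally show "\<bar>Z k (y \<bullet> x) - Z k (y \<bullet> x')\<bar> \<le> C * norm (x - x') powr 1" by simp
  qed
qed

abbreviation subord :: "real \<Rightarrow> real \<Rightarrow> real" where
  "subord d r \<equiv> r powr (real N / 2 - 1) * (1 + r) * ((1 - r)\<^sup>2 + r * d\<^sup>2) powr (- ((real N + 1) / 2))"

text \<open>Identifies the integrand of \<open>subordination_integral\<close> at d = |z - \<zeta>|
  with a weighted Poisson kernel: 1 - r^2 = (1 - r) (1 + r), and the factor 1 - r goes into the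
  weight.\<close>

lemma subord_poisson:
  fixes z \<zeta> :: 'a
  assumes "norm z = 1" "norm \<zeta> = 1" "r < 1"
  shows "subord (norm (z - \<zeta>)) r = r powr (real N / 2 - 1) / (1 - r) * poisson_kernel r (z \<bullet> \<zeta>)"
proof -
  have "poisson_kernel r (z \<bullet> \<zeta>) = (1 - r) * (1 + r) * ((1 - r)\<^sup>2 + r * (norm (z - \<zeta>))\<^sup>2) powr (- ((real N + 1) / 2))"
  proof -
    have "\<nu> + 1 = (real N + 1) / 2" by (simp add: field_simps)
    moreover have "1 - r\<^sup>2 = (1 - r) * (1 + r)" by (simp add: power2_eq_square algebra_simps)
    ultimately show ?thesis
      unfolding poisson_kernel_def poisson_base[OF assms(1,2)] by (simp only:)
  qed
  then show ?thesis using assms(3) by simp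
qed

text \<open>The subordination kernel is nonnegative, so integrating |H| over r gives Beta times
  |\<open>log_kernel\<close>|, which is integrable in \<zeta> by the Hoelder bound; this is what
  Fubini requires. The term \<open>f z\<close> turns into the area because that is the Poisson
  integral of 1.\<close>

lemma log_kernel_integral_poisson:
  assumes f: "\<And>x y. norm x = 1 \<Longrightarrow> norm y = 1 \<Longrightarrow> \<bar>f x - f y\<bar> \<le> C * norm (x - y) powr \<gamma>"
    and \<gamma>: "0 < \<gamma>" "\<gamma> \<le> 1" and z: "norm z = 1"
  shows "Beta (real N / 2) (1 / 2) * (LINT \<zeta>|\<sigma>. log_kernel f z \<zeta>) =
    (LINT r|lborel. indicator {0<..<1} r * (r powr (real N / 2 - 1) / (1 - r)) * (sphere_area TYPE('a) * f z - poisson r f z))"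
proof -
  interpret finite_measure \<sigma> by (rule finite_measure_sphere_volume)
  interpret pair_sigma_finite \<sigma> "lborel :: real measure" ..
  have fc: "continuous_on (sphere 0 1) f" by (rule sphere_holder_continuous_on[OF f \<gamma>(1)])
  note [measurable] = borel_measurable_sphere_volume_continuous[OF fc] norm_diff_measurable[of z]
  define B where "B = Beta (real N / 2) (1 / 2)"
  have B: "B > 0" unfolding B_def Beta_def using N by (auto intro!: divide_pos_pos mult_pos_pos)
  define H where "H \<zeta> r = (f z - f \<zeta>) * (indicator {0<..<1} r * subord (norm (z - \<zeta>)) r)" for \<zeta> r
  have Hm: "case_prod H \<in> borel_measurable (\<sigma> \<Otimes>\<^sub>M lborel)"
    unfolding H_def split_beta' by measurable
  have Hi: "integrable lborel (H \<zeta>)" and Hint: "(LINT r|lborel. H \<zeta> r) = B * log_kernel f z \<zeta>"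
    and Habs: "(LINT r|lborel. \<bar>H \<zeta> r\<bar>) = B * \<bar>log_kernel f z \<zeta>\<bar>" if \<zeta>: "norm \<zeta> = 1" for \<zeta>
  proof -
    have "integrable lborel (H \<zeta>) \<and> (LINT r|lborel. H \<zeta> r) = B * log_kernel f z \<zeta> \<and>
      (LINT r|lborel. \<bar>H \<zeta> r\<bar>) = B * \<bar>log_kernel f z \<zeta>\<bar>"
    proof (cases "z = \<zeta>")
      case True
      then show ?thesis by (simp add: H_def[abs_def])
    next
      case False
      then have d: "norm (z - \<zeta>) > 0" by simp
      note S = subordination_integral[OF d N]
      have "\<bar>H \<zeta> r\<bar> = \<bar>f z - f \<zeta>\<bar> * (indicator {0<..<1} r * subord (norm (z - \<zeta>)) r)" for r
        by (auto simp: H_def abs_mult indicator_def)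
      then have "(LINT r|lborel. \<bar>H \<zeta> r\<bar>) = \<bar>f z - f \<zeta>\<bar> * (B / norm (z - \<zeta>) ^ N)"
        by (simp only: integral_mult_right_zero S(2) B_def)
      moreover have "(LINT r|lborel. H \<zeta> r) = (f z - f \<zeta>) * (B / norm (z - \<zeta>) ^ N)"
        unfolding H_def by (simp only: integral_mult_right_zero S(2) B_def)
      moreover have "integrable lborel (H \<zeta>)"
        unfolding H_def by (intro integrable_mult_right S(1))
      ultimately show ?thesis by (simp add: abs_divide)
    qed
    then show "integrable lborel (H \<zeta>)" "(LINT r|lborel. H \<zeta> r) = B * log_kernel f z \<zeta>"
      "(LINT r|lborel. \<bar>H \<zeta> r\<bar>) = B * \<bar>log_kernel f z \<zeta>\<bar>" by auto
  qed
  have ki: "integrable \<sigma> (log_kernel f z)" by (rule log_kernel_integrable[OF f \<gamma> z])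
  have Hint2: "integrable (\<sigma> \<Otimes>\<^sub>M lborel) (case_prod H)"
  proof (rule Fubini_integrable[OF Hm])
    show "AE \<zeta> in \<sigma>. integrable lborel (\<lambda>r. case_prod H (\<zeta>, r))"
      using Hi by (intro AE_I2) simp
    have "integrable \<sigma> (\<lambda>\<zeta>. B * \<bar>log_kernel f z \<zeta>\<bar>)"
      by (intro integrable_mult_right integrable_abs ki)
    then show "integrable \<sigma> (\<lambda>\<zeta>. LINT r|lborel. norm (case_prod H (\<zeta>, r)))"
      by (rule Bochner_Integration.integrable_cong[THEN iffD1, OF refl, rotated]) (simp add: Habs)
  qed
  have "B * (LINT \<zeta>|\<sigma>. log_kernel f z \<zeta>) = (LINT \<zeta>|\<sigma>. (LINT r|lborel. H \<zeta> r))"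
    unfolding integral_mult_right_zero[symmetric]
    by (intro Bochner_Integration.integral_cong refl) (simp add: Hint)
  also have "\<dots> = (LINT r|lborel. (LINT \<zeta>|\<sigma>. H \<zeta> r))"
    by (rule Fubini_integral[OF Hint2, symmetric])
  also have "\<dots> = (LINT r|lborel. indicator {0<..<1} r * (r powr (real N / 2 - 1) / (1 - r)) * (sphere_area TYPE('a) * f z - poisson r f z))"
  proof (rule Bochner_Integration.integral_cong[OF refl])
    fix r :: real
    show "(LINT \<zeta>|\<sigma>. H \<zeta> r) = indicator {0<..<1} r * (r powr (real N / 2 - 1) / (1 - r)) * (sphere_area TYPE('a) * f z - poisson r f z)"
    proof (cases "r \<in> {0<..<1}")
      case True
      then have r: "0 \<le> r" "r < 1" by auto
      have kc: "continuous_on (sphere 0 1) (\<lambda>\<zeta>. poisson_kernel r (z \<bullet> \<zeta>))"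
        by (rule poisson_kernel_continuous[OF z r])
      have "(LINT \<zeta>|\<sigma>. H \<zeta> r) = (LINT \<zeta>|\<sigma>. r powr (real N / 2 - 1) / (1 - r) *
          (f z * (poisson_kernel r (z \<bullet> \<zeta>) * 1) - poisson_kernel r (z \<bullet> \<zeta>) * f \<zeta>))"
      proof (intro Bochner_Integration.integral_cong refl)
        fix \<zeta> assume "\<zeta> \<in> space \<sigma>"
        then have \<zeta>: "norm \<zeta> = 1" by simp
        show "H \<zeta> r = r powr (real N / 2 - 1) / (1 - r) *
          (f z * (poisson_kernel r (z \<bullet> \<zeta>) * 1) - poisson_kernel r (z \<bullet> \<zeta>) * f \<zeta>)"
          using True unfolding H_def subord_poisson[OF z \<zeta> r(2)] by (simp add: left_diff_distrib right_diff_distrib diff_divide_distrib mult_ac)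
      qed
      also have "\<dots> = r powr (real N / 2 - 1) / (1 - r) * (f z * poisson r (\<lambda>_. 1) z - poisson r f z)"
      proof -
        have "integrable \<sigma> (\<lambda>\<zeta>. f z * (poisson_kernel r (z \<bullet> \<zeta>) * 1))" "integrable \<sigma> (\<lambda>\<zeta>. poisson_kernel r (z \<bullet> \<zeta>) * f \<zeta>)"
          by (intro integrable_sphere_volume_continuous continuous_intros kc fc)+
        then show ?thesis
          by (simp only: integral_mult_right_zero Bochner_Integration.integral_diff poisson_def)
      qed
      finally show ?thesis using True by (simp add: poisson_1[OF z r] mult.commute)
    qed (simp add: H_def)
  qed
  finally show ?thesis by (simp only: B_def)
qed

text \<open>The source of the factor 2 in the eigenvalues: the area is 2 pi^((N + 1)/2) / Gamma ((N
  + 1)/2), and all Gamma values and powers of pi cancel against \<open>log_c\<close> and the Beta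
  value.\<close>

lemma log_c_area:
  "log_c N * sphere_area TYPE('a) / Beta (real N / 2) (1 / 2) = 2"
proof -
  let ?h = "(real N + 1) / 2"
  have g: "Gamma (real N / 2) > 0" "Gamma ?h > 0" using N by (auto intro!: Gamma_real_pos)
  have "sphere_area TYPE('a) = (real N + 1) * (pi powr ?h / Gamma (?h + 1))"
    by (simp add: sphere_area_def unit_ball_vol_def DIM add.commute)
  also have "Gamma (?h + 1) = ?h * Gamma ?h"
    by (rule Gamma_plus1) (auto simp: nonpos_Ints_def)
  also have "(real N + 1) * (pi powr ?h / (?h * Gamma ?h)) = 2 * pi powr ?h / Gamma ?h"
  proof -
    have "2 * h * (X / (h * G)) = 2 * X / G" if "h \<noteq> 0" for h X G :: real
      using that by simp
    from this[of ?h "pi powr ?h" "Gamma ?h"] show ?thesis by simp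
  qed
  finally have A: "sphere_area TYPE('a) = 2 * pi powr ?h / Gamma ?h" .
  have B: "Beta (real N / 2) (1 / 2) = Gamma (real N / 2) * sqrt pi / Gamma ?h"
    by (simp add: Beta_def Gamma_one_half_real add_divide_distrib)
  have P: "pi powr (- real N / 2) * pi powr ?h = sqrt pi"
  proof -
    have "pi powr (- real N / 2) * pi powr ?h = pi powr (- real N / 2 + ?h)"
      by (rule powr_add[symmetric])
    also have "- real N / 2 + ?h = 1 / 2" by (simp add: field_simps)
    finally show ?thesis by (simp add: powr_half_sqrt)
  qed
  have "log_c N * sphere_area TYPE('a) = 2 * (pi powr (- real N / 2) * pi powr ?h) * Gamma (real N / 2) / Gamma ?h"
    unfolding log_c_def A by (simp add: mult_ac)
  also have "\<dots> = 2 * Beta (real N / 2) (1 / 2)"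
    unfolding P B by simp
  finally have "log_c N * sphere_area TYPE('a) = 2 * Beta (real N / 2) (1 / 2)" .
  moreover have "Beta (real N / 2) (1 / 2) > 0"
    unfolding B using g by (intro divide_pos_pos mult_pos_pos) auto
  ultimately show ?thesis by simp
qed

text \<open>The weight 1 / (1 - r) meets 1 - r^k, and the geometric sum integrates to the
  harmonic-type sum \<open>S\<close>. The term \<open>log_A N\<close> supplies 2 \<psi>(N/2), and
  the recurrence of \<psi> joins the two.\<close>

lemma log_form_single:
  assumes f: "\<And>x y. norm x = 1 \<Longrightarrow> norm y = 1 \<Longrightarrow> \<bar>f x - f y\<bar> \<le> C * norm (x - y) powr \<gamma>"
    and \<gamma>: "0 < \<gamma>" "\<gamma> \<le> 1" and z: "norm z = 1"
    and 0: "\<And>j. j \<noteq> k \<Longrightarrow> proj j f z = 0"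
  shows "log_form f z = 2 * Digamma (real N / 2 + real k) * f z"
proof -
  let ?w = "sphere_area TYPE('a)"
  define S where "S = (\<Sum>i<k. 1 / (real N / 2 + real i))"
  have fc: "continuous_on (sphere 0 1) f" by (rule sphere_holder_continuous_on[OF f \<gamma>(1)])
  have "Beta (real N / 2) (1 / 2) * (LINT \<zeta>|\<sigma>. log_kernel f z \<zeta>) =
    (LINT r|lborel. indicator {0<..<1} r * (r powr (real N / 2 - 1) / (1 - r)) * (?w * f z - poisson r f z))"
    by (rule log_kernel_integral_poisson[OF f \<gamma> z])
  also have "\<dots> = (LINT r|lborel. (\<Sum>i<k. ?w * f z * (indicator {0<..<1} r * r powr (real N / 2 + real i - 1))))"
  proof (rule Bochner_Integration.integral_cong[OF refl])
    fix r :: real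
    show "indicator {0<..<1} r * (r powr (real N / 2 - 1) / (1 - r)) * (?w * f z - poisson r f z) =
      (\<Sum>i<k. ?w * f z * (indicator {0<..<1} r * r powr (real N / 2 + real i - 1)))"
    proof (cases "r \<in> {0<..<1}")
      case True
      then have r: "0 < r" "r < 1" by auto
      \<comment> \<open>Only the k-th projection survives, and it equals \<open>?w * f z\<close>, so
        the Poisson integral is this value damped by r^k.\<close>
      have "?w * f z - poisson r f z = ?w * f z * (1 - r ^ k)"
        using poisson_single[OF fc z _ r(2) 0] r proj_single[OF fc z 0] by (simp add: algebra_simps)
      also have "1 - r ^ k = (1 - r) * (\<Sum>i<k. r ^ i)"
        by (rule one_diff_power_eq)
      finally have "indicator {0<..<1} r * (r powr (real N / 2 - 1) / (1 - r)) * (?w * f z - poisson r f z) =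
         ?w * f z * (r powr (real N / 2 - 1) * (\<Sum>i<k. r ^ i))"
        using True by simp
      also have "r powr (real N / 2 - 1) * (\<Sum>i<k. r ^ i) = (\<Sum>i<k. r powr (real N / 2 + real i - 1))"
        unfolding sum_distrib_left
      proof (intro sum.cong refl)
        fix i
        have "r powr (real N / 2 - 1) * r ^ i = r powr (real N / 2 - 1) * r powr real i"
          using r by (simp add: powr_realpow)
        also have "\<dots> = r powr (real N / 2 - 1 + real i)" by (rule powr_add[symmetric])
        also have "real N / 2 - 1 + real i = real N / 2 + real i - 1" by simp
        finally show "r powr (real N / 2 - 1) * r ^ i = r powr (real N / 2 + real i - 1)" .
      qed
      finally show ?thesis using True by (simp add: sum_distrib_left)
    qed simp
  qed
  also have "\<dots> = (\<Sum>i<k. (LINT r|lborel. ?w * f z * (indicator {0<..<1} r * r powr (real N / 2 + real i - 1))))"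
    by (intro Bochner_Integration.integral_sum integrable_mult_right integral_powr_unit_interval) (use N in auto)
  also have "\<dots> = ?w * f z * S"
  proof -
    have "(LINT r|lborel. ?w * f z * (indicator {0<..<1} r * r powr (real N / 2 + real i - 1))) =
      ?w * f z * (1 / (real N / 2 + real i))" for i
      unfolding integral_mult_right_zero by (subst integral_powr_unit_interval(2)) (use N in auto)
    then show ?thesis by (simp only: S_def sum_distrib_left)
  qed
  finally have I: "Beta (real N / 2) (1 / 2) * (LINT \<zeta>|\<sigma>. log_kernel f z \<zeta>) = ?w * f z * S" .
  \<comment> \<open>Division by zero yields 0 in HOL; were Beta zero, the quotient in
    \<open>log_c_area\<close> would be 0 and not 2.\<close>
  have B: "Beta (real N / 2) (1 / 2) \<noteq> 0"
    using log_c_area by (metis div_by_0 zero_neq_numeral)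
  have "log_c N * (LINT \<zeta>|\<sigma>. log_kernel f z \<zeta>) = log_c N * (?w * f z * S / Beta (real N / 2) (1 / 2))"
    using I B by (simp add: field_simps)
  also have "\<dots> = (log_c N * ?w / Beta (real N / 2) (1 / 2)) * (f z * S)" by simp
  also have "\<dots> = 2 * (f z * S)" unfolding log_c_area ..
  finally have "log_form f z = 2 * (Digamma (real N / 2) + S) * f z"
    by (simp add: log_form_def log_A_def algebra_simps)
  then show ?thesis
    using Digamma_plus_nat[of "real N / 2" k] N by (simp add: S_def)
qed

lemma log_form_zonal:
  fixes y z :: 'a
  assumes y: "norm y = 1" and z: "norm z = 1"
  shows "log_form (\<lambda>\<zeta>. Z k (y \<bullet> \<zeta>)) z = 2 * Digamma (real N / 2 + real k) * Z k (y \<bullet> z)"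
proof -
  obtain C where C: "\<forall>y x x'::'a. norm y = 1 \<longrightarrow> norm x = 1 \<longrightarrow> norm x' = 1 \<longrightarrow>
    \<bar>Z k (y \<bullet> x) - Z k (y \<bullet> x')\<bar> \<le> C * norm (x - x') powr 1"
    using zonal_lipschitz[of k] by blast
  show ?thesis
  proof (rule log_form_single[where C = C and \<gamma> = 1])
    show "\<bar>Z k (y \<bullet> x) - Z k (y \<bullet> x')\<bar> \<le> C * norm (x - x') powr 1" if "norm x = 1" "norm x' = 1" for x x' :: 'a
      using C y that by blast
    show "proj j (\<lambda>\<zeta>. Z k (y \<bullet> \<zeta>)) z = 0" if "j \<noteq> k" for j
      by (rule proj_orthogonal[OF that y z])
  qed (use z in auto)
qed

end

section \<open>The limit of the difference quotients\<close>

lemma abs_exp_minus_1_le: "\<bar>exp x - 1\<bar> \<le> \<bar>x\<bar> * exp \<bar>x\<bar>" for x :: real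
proof (cases "x \<ge> 0")
  case True
  have "1 + (- x) \<le> exp (- x)" by (rule exp_ge_add_one_self)
  then have "exp x * (1 - x) \<le> exp x * exp (- x)" by (intro mult_left_mono) auto
  also have "exp x * exp (- x) = 1" by (simp flip: exp_add)
  finally show ?thesis using True by (simp add: algebra_simps)
next
  case False
  have "1 - exp x \<le> - x" using exp_ge_add_one_self[of x] by linarith
  also have "\<dots> \<le> - x * exp (- x)" using False by (simp add: mult_le_cancel_left1)
  finally show ?thesis using False by simp
qed

text \<open>With L = |ln d|, the factor L is absorbed by (4/\<gamma>) exp (\<gamma> L / 4), and 8 s
  \<le> \<gamma> bounds exp (2 s L) by another exp (\<gamma> L / 4). The product exp (\<gamma> L /
  2) is d^(-\<gamma>/2) for d \<le> 1; for 1 < d \<le> 2 the correction d^\<gamma> costs a factor 2,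
  whence 16.\<close>

lemma abs_powr_minus_1_le:
  fixes d s \<gamma> :: real
  assumes d: "0 < d" "d \<le> 2" and s: "0 < s" "8 * s \<le> \<gamma>" and \<gamma>: "\<gamma> \<le> 1"
  shows "\<bar>d powr (- 2 * s) - 1\<bar> \<le> 16 * s / \<gamma> * d powr (- (\<gamma> / 2))"
proof -
  have \<gamma>0: "\<gamma> > 0" using s by simp
  define L where "L = \<bar>ln d\<bar>"
  have L0: "L \<ge> 0" by (simp add: L_def)
  have "d powr (- 2 * s) = exp (- 2 * s * ln d)"
    using d by (simp add: powr_def)
  then have "\<bar>d powr (- 2 * s) - 1\<bar> \<le> \<bar>- 2 * s * ln d\<bar> * exp \<bar>- 2 * s * ln d\<bar>"
    using abs_exp_minus_1_le[of "- 2 * s * ln d"] by simp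
  also have "\<bar>- 2 * s * ln d\<bar> = 2 * s * L"
    using s by (simp add: L_def abs_mult)
  also have "2 * s * L * exp (2 * s * L) \<le> 2 * s * (4 / \<gamma> * exp (\<gamma> / 4 * L)) * exp (\<gamma> / 4 * L)"
  proof -
    have "\<gamma> / 4 * L \<le> exp (\<gamma> / 4 * L)"
      using exp_ge_add_one_self[of "\<gamma> / 4 * L"] by linarith
    then have "L \<le> 4 / \<gamma> * exp (\<gamma> / 4 * L)"
      using \<gamma>0 by (simp add: field_simps)
    moreover have "2 * s * L \<le> \<gamma> / 4 * L"
      using s L0 by (intro mult_right_mono) auto
    ultimately show ?thesis
      using s L0 \<gamma>0 by (intro mult_mono) auto
  qed
  also have "\<dots> = 8 * s / \<gamma> * exp (\<gamma> / 2 * L)"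
  proof -
    have "exp (\<gamma> / 4 * L) * exp (\<gamma> / 4 * L) = exp (\<gamma> / 2 * L)"
      by (simp flip: exp_add)
    then show ?thesis using \<gamma>0 by (simp add: field_simps)
  qed
  also have "\<dots> \<le> 8 * s / \<gamma> * (2 * d powr (- (\<gamma> / 2)))"
  proof (intro mult_left_mono)
    show "exp (\<gamma> / 2 * L) \<le> 2 * d powr (- (\<gamma> / 2))"
    proof (cases "d \<le> 1")
      case True
      then have "exp (\<gamma> / 2 * L) = d powr (- (\<gamma> / 2))"
        using d by (simp add: L_def powr_def)
      then show ?thesis by simp
    next
      case False
      then have "exp (\<gamma> / 2 * L) = d powr (\<gamma> / 2)"
        using d by (simp add: L_def powr_def)
      also have "\<dots> = d powr \<gamma> * d powr (- (\<gamma> / 2))"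
        by (simp flip: powr_add)
      also have "\<dots> \<le> 2 * d powr (- (\<gamma> / 2))"
      proof (intro mult_right_mono)
        have "d powr \<gamma> \<le> 2 powr \<gamma>" using d \<gamma>0 by (intro powr_mono2) auto
        also have "\<dots> \<le> 2 powr 1" using \<gamma> by (intro powr_mono) auto
        finally show "d powr \<gamma> \<le> 2" by simp
      qed auto
      finally show ?thesis .
    qed
  qed (use s \<gamma>0 in auto)
  finally show ?thesis by simp
qed

text \<open>The factor \<open>s\<close> in \<open>frac_c\<close> makes the singular integral
  contribute at first order; the other factors tend to those of \<open>log_c\<close> because Gamma 2
  = 1.\<close>

lemma frac_c_over_s_tendsto:
  assumes "1 \<le> N"
  shows "((\<lambda>s. frac_c N s / s) \<longlongrightarrow> log_c N) (at_right 0)"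
proof -
  let ?f = "\<lambda>s. 4 powr s * pi powr (- real N / 2) * (Gamma (real N / 2 + s) / Gamma (2 - s)) * (1 - s)"
  have "real N / 2 \<notin> \<int>\<^sub>\<le>\<^sub>0"
  proof -
    have "real N / 2 > 0" using assms by simp
    then show ?thesis by (auto elim!: nonpos_Ints_cases)
  qed
  moreover have G2: "Gamma (2::real) = 1"
    using Gamma_fact[of 1, where ?'a = real] by simp
  moreover have "(2::real) \<notin> \<int>\<^sub>\<le>\<^sub>0" by (auto elim!: nonpos_Ints_cases)
  ultimately have "(?f \<longlongrightarrow> 4 powr 0 * pi powr (- real N / 2) * (Gamma (real N / 2 + 0) / Gamma (2 - 0)) * (1 - 0)) (at_right 0)"
    by (intro tendsto_intros) auto
  then have "(?f \<longlongrightarrow> log_c N) (at_right 0)"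
    by (simp add: G2 log_c_def)
  moreover have "\<forall>\<^sub>F s in at_right 0. ?f s = frac_c N s / s"
    using eventually_at_right_less[of "0::real"] by eventually_elim (simp add: frac_c_def)
  ultimately show ?thesis by (rule Lim_transform_eventually)
qed

text \<open>As \<open>frac_A N 0 = 1\<close>, this is a derivative at 0. Numerator and denominator
  each contribute \<psi>(N/2), which gives the factor 2.\<close>

lemma frac_A_quotient_tendsto:
  assumes "1 \<le> N"
  shows "((\<lambda>s. (frac_A N s - 1) / s) \<longlongrightarrow> log_A N) (at_right 0)"
proof -
  let ?a = "real N / 2"
  have a: "?a > 0" using assms by simp
  have g: "Gamma ?a > 0" by (rule Gamma_real_pos[OF a])
  have "(frac_A N has_field_derivative log_A N) (at 0)"
  proof -
    have nz: "?a + 0 \<notin> \<int>\<^sub>\<le>\<^sub>0" "?a - 0 \<notin> \<int>\<^sub>\<le>\<^sub>0" using a by (auto elim!: nonpos_Ints_cases)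
    have d1: "((\<lambda>s. Gamma (?a + s)) has_field_derivative (Gamma ?a * Digamma ?a)) (at 0)"
      by (rule derivative_eq_intros refl nz | simp)+
    have d2: "((\<lambda>s. Gamma (?a - s)) has_field_derivative (- Gamma ?a * Digamma ?a)) (at 0)"
      by (rule derivative_eq_intros refl nz | simp)+
    have "((\<lambda>s. Gamma (?a + s) / Gamma (?a - s)) has_field_derivative
       (Gamma ?a * Digamma ?a * Gamma (?a - 0) - Gamma (?a + 0) * (- Gamma ?a * Digamma ?a)) / (Gamma (?a - 0) * Gamma (?a - 0))) (at 0)"
      by (rule DERIV_divide[OF d1 d2]) (use g in simp)
    moreover have "(Gamma ?a * Digamma ?a * Gamma (?a - 0) - Gamma (?a + 0) * (- Gamma ?a * Digamma ?a)) / (Gamma (?a - 0) * Gamma (?a - 0)) = log_A N"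
      using g by (simp add: log_A_def field_simps)
    ultimately show ?thesis by (simp only: frac_A_def[abs_def])
  qed
  then have "((\<lambda>s. (frac_A N s - frac_A N 0) / (s - 0)) \<longlongrightarrow> log_A N) (at 0)"
    by (simp add: has_field_derivative_iff)
  moreover have "frac_A N 0 = 1" using g by (simp add: frac_A_def)
  ultimately have "((\<lambda>s. (frac_A N s - 1) / s) \<longlongrightarrow> log_A N) (at 0)" by simp
  then show ?thesis by (rule tendsto_within_subset) simp
qed

text \<open>For q \<ge> 1 the power A^(1/q) is at most max 1 A, so a uniform bound controls all
  exponents, including infinity, with the same constant.\<close>

lemma Lp_norm_le:
  fixes f :: "'m \<Rightarrow> real"
  assumes p: "1 \<le> p" and f: "f \<in> borel_measurable M" and E: "0 \<le> E" "\<And>x. x \<in> space M \<Longrightarrow> \<bar>f x\<bar> \<le> E"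
    and M: "emeasure M (space M) = ennreal A" "0 \<le> A"
  shows "Lp_norm p M f \<le> ennreal (E * max 1 A)"
proof (cases "p = \<infinity>")
  case True
  have "esssup M (\<lambda>x. ennreal \<bar>f x\<bar>) \<le> ennreal E"
    using f E(2) by (intro esssup_I) (auto intro!: AE_I2 ennreal_leI)
  also have "\<dots> \<le> ennreal (E * max 1 A)"
    using mult_left_mono[of 1 "max 1 A" E] E(1) by (intro ennreal_leI) auto
  finally show ?thesis using True by (simp add: Lp_norm_def)
next
  case False
  define q where "q = enn2real p"
  have q: "1 \<le> q"
  proof -
    have "enn2real 1 \<le> enn2real p" using p False by (intro enn2real_mono) (auto simp: top.not_eq_extremum)
    then show ?thesis by (simp add: q_def)
  qed
  define I where "I = (\<integral>\<^sup>+x. ennreal (\<bar>f x\<bar> powr q) \<partial>M)"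
  have "I \<le> (\<integral>\<^sup>+x. ennreal (E powr q) \<partial>M)"
    unfolding I_def using E q by (intro nn_integral_mono ennreal_leI powr_mono2) auto
  also have "\<dots> = ennreal (E powr q * A)"
    using M by (simp add: ennreal_mult')
  finally have I: "I \<le> ennreal (E powr q * A)" .
  then have "I \<noteq> \<infinity>" by (auto simp: top_unique)
  have "enn2real I \<le> E powr q * A"
    using enn2real_mono[OF I] M(2) by simp
  then have "enn2real I powr (1 / q) \<le> (E powr q * A) powr (1 / q)"
    using q by (intro powr_mono2) auto
  also have "\<dots> = E * A powr (1 / q)"
    using q E M(2) by (simp add: powr_mult powr_powr)
  also have "\<dots> \<le> E * max 1 A"
  proof (intro mult_left_mono E(1))
    have "A powr (1 / q) \<le> max 1 A powr (1 / q)" using q M(2) by (intro powr_mono2) auto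
    also have "\<dots> \<le> max 1 A powr 1" using q by (intro powr_mono) auto
    finally show "A powr (1 / q) \<le> max 1 A" by simp
  qed
  finally have "ennreal (enn2real I powr (1 / q)) \<le> ennreal (E * max 1 A)" by (rule ennreal_leI)
  then show ?thesis
    using False \<open>I \<noteq> \<infinity>\<close> by (simp add: Lp_norm_def I_def q_def Let_def)
qed

lemma has_principal_value_unique:
  assumes "has_principal_value z f I" "has_principal_value z f J"
  shows "I = J"
  by (rule tendsto_unique[OF trivial_limit_at_right_real])
     (rule conjunct2[OF assms(1)[unfolded has_principal_value_def]],
      rule conjunct2[OF assms(2)[unfolded has_principal_value_def]])

lemma principal_value_eq: "has_principal_value z f I \<Longrightarrow> principal_value z f = I"
  unfolding principal_value_def using has_principal_value_unique by blast

text \<open>The truncated domains never contain z itself, so pointwise convergence of the truncated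
  integrands at z rests on f z = 0; at every other point they are eventually constant.\<close>

lemma has_principal_value_integrable:
  fixes f :: "'a::euclidean_space \<Rightarrow> real"
  assumes f: "integrable sphere_volume f" and z: "f z = 0"
  shows "has_principal_value z f (LINT \<zeta>|sphere_volume. f \<zeta>)"
  unfolding has_principal_value_def
proof (intro conjI allI impI)
  let ?A = "\<lambda>\<epsilon>. {\<zeta>\<in>sphere 0 1. \<epsilon> < norm (z - \<zeta>)}"
  have A: "?A \<epsilon> \<in> sets sphere_volume" for \<epsilon>
  proof -
    have "?A \<epsilon> = sphere 0 1 \<inter> {\<zeta>. \<epsilon> < norm (z - \<zeta>)}" by auto
    moreover have "{\<zeta>. \<epsilon> < norm (z - \<zeta>)} \<in> sets borel" by measurable
    ultimately show ?thesis by (auto simp: sets_restrict_space)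
  qed
  show si: "set_integrable sphere_volume (?A \<epsilon>) f" for \<epsilon>
    unfolding set_integrable_def by (rule integrable_mult_indicator[OF A f])
  show "((\<lambda>\<epsilon>. LINT \<zeta>:?A \<epsilon>|sphere_volume. f \<zeta>) \<longlongrightarrow> (LINT \<zeta>|sphere_volume. f \<zeta>)) (at_right 0)"
    unfolding tendsto_at_iff_sequentially
  proof (intro allI impI)
    fix X :: "nat \<Rightarrow> real"
    assume X: "\<forall>i. X i \<in> {0<..} - {0}" and X0: "X \<longlonglongrightarrow> 0"
    have "(\<lambda>i. LINT \<zeta>|sphere_volume. indicator (?A (X i)) \<zeta> *\<^sub>R f \<zeta>) \<longlonglongrightarrow> (LINT \<zeta>|sphere_volume. f \<zeta>)"
    proof (rule integral_dominated_convergence[of _ _ _ "\<lambda>\<zeta>. \<bar>f \<zeta>\<bar>"])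
      show "(\<lambda>\<zeta>. indicator (?A (X i)) \<zeta> *\<^sub>R f \<zeta>) \<in> borel_measurable sphere_volume" for i
        using si[of "X i"] unfolding set_integrable_def by (rule borel_measurable_integrable)
      show "AE \<zeta> in sphere_volume. (\<lambda>i. indicator (?A (X i)) \<zeta> *\<^sub>R f \<zeta>) \<longlonglongrightarrow> f \<zeta>"
      proof (rule AE_I2)
        fix \<zeta> assume "\<zeta> \<in> space (sphere_volume :: 'a measure)"
        then have \<zeta>: "norm \<zeta> = 1" by simp
        show "(\<lambda>i. indicator (?A (X i)) \<zeta> *\<^sub>R f \<zeta>) \<longlonglongrightarrow> f \<zeta>"
        proof (cases "\<zeta> = z")
          case False
          then have "\<forall>\<^sub>F i in sequentially. X i < norm (z - \<zeta>)"
            using order_tendstoD(2)[OF X0] by simp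
          then have "\<forall>\<^sub>F i in sequentially. f \<zeta> = indicator (?A (X i)) \<zeta> *\<^sub>R f \<zeta>"
            by eventually_elim (use \<zeta> in \<open>simp add: indicator_def\<close>)
          then show ?thesis by (rule Lim_transform_eventually[OF tendsto_const])
        qed (simp add: z)
      qed
      show "AE \<zeta> in sphere_volume. norm (indicator (?A (X i)) \<zeta> *\<^sub>R f \<zeta>) \<le> \<bar>f \<zeta>\<bar>" for i
        by (intro AE_I2) (simp add: indicator_def)
    qed (use f in auto)
    then show "((\<lambda>\<epsilon>. LINT \<zeta>:?A \<epsilon>|sphere_volume. f \<zeta>) \<circ> X) \<longlonglongrightarrow> (LINT \<zeta>|sphere_volume. f \<zeta>)"
      by (simp add: comp_def set_lebesgue_integral_def)
  qed
qed

context sphere_setting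
begin

text \<open>Lets the measurability of \<open>log_form\<close> follow from the statement for the
  parametrised kernel at s = 0.\<close>

lemma frac_kernel_0: "frac_kernel N 0 u z \<zeta> = log_kernel u z \<zeta>"
proof (cases "z = \<zeta>")
  case False
  then have "norm (z - \<zeta>) powr real N = norm (z - \<zeta>) ^ N" by (intro powr_realpow) auto
  then show ?thesis by (simp add: frac_kernel_def)
qed (simp add: frac_kernel_def)

lemma frac_kernel_measurable:
  assumes "u \<in> borel_measurable \<sigma>"
  shows "frac_kernel N s u z \<in> borel_measurable \<sigma>"
proof -
  note [measurable] = assms norm_diff_measurable[of z]
  show ?thesis unfolding frac_kernel_def[abs_def] by measurable
qed

lemma frac_kernel_integral_measurable:
  assumes [measurable]: "u \<in> borel_measurable \<sigma>"
  shows "(\<lambda>z. LINT \<zeta>|\<sigma>. frac_kernel N s u z \<zeta>) \<in> borel_measurable \<sigma>"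
proof -
  interpret finite_measure \<sigma> by (rule finite_measure_sphere_volume)
  have [measurable]: "(\<lambda>x. x) \<in> borel_measurable \<sigma>"
    by (rule borel_measurable_sphere_volume) measurable
  have "(\<lambda>(z, \<zeta>). frac_kernel N s u z \<zeta>) \<in> borel_measurable (\<sigma> \<Otimes>\<^sub>M \<sigma>)"
    unfolding frac_kernel_def split_beta' by measurable
  then show ?thesis by (rule borel_measurable_lebesgue_integral)
qed

end

section \<open>Uniform convergence for a fixed Hoelder continuous function\<close>

locale sphere_holder_function = sphere_setting N space_type
  for N :: nat and space_type :: "'a::euclidean_space itself" +
  fixes u :: "'a \<Rightarrow> real" and C \<gamma> :: real
  assumes C: "0 \<le> C" and \<gamma>: "0 < \<gamma>" "\<gamma> \<le> 1"
    and holder: "\<And>x y. norm x = 1 \<Longrightarrow> norm y = 1 \<Longrightarrow> \<bar>u x - u y\<bar> \<le> C * norm (x - y) powr \<gamma>"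
begin

lemma u_continuous: "continuous_on (sphere 0 1) u"
  by (rule sphere_holder_continuous_on[OF holder \<gamma>(1)])

lemma u_measurable: "u \<in> borel_measurable \<sigma>"
  by (rule borel_measurable_sphere_volume_continuous[OF u_continuous])

lemma u_bounded: "\<exists>U\<ge>0. \<forall>z. norm z = 1 \<longrightarrow> \<bar>u z\<bar> \<le> U"
proof -
  obtain K where "\<forall>x\<in>sphere 0 1. norm (u x) \<le> K"
    using continuous_on_sphere_bounded[OF u_continuous] by blast
  then show ?thesis by (intro exI[of _ "max K 0"]) (auto intro: max.coboundedI1)
qed

lemma log_kernel_u_integrable: "norm z = 1 \<Longrightarrow> integrable \<sigma> (log_kernel u z)"
  by (rule log_kernel_integrable[OF holder \<gamma>])

lemma log_kernel_integral_bound: "\<exists>B\<ge>0. \<forall>z. norm z = 1 \<longrightarrow> \<bar>LINT \<zeta>|\<sigma>. log_kernel u z \<zeta>\<bar> \<le> B"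
proof -
  have "\<exists>B\<ge>0. \<forall>z. norm z = 1 \<longrightarrow> (LINT \<zeta>|\<sigma>. \<bar>log_kernel u z \<zeta>\<bar>) \<le> B"
    by (rule log_kernel_abs_integral_bound[OF holder C \<gamma>])
  then obtain B where B: "B \<ge> 0 \<and> (\<forall>z. norm z = 1 \<longrightarrow> (LINT \<zeta>|\<sigma>. \<bar>log_kernel u z \<zeta>\<bar>) \<le> B)" ..
  have "\<bar>LINT \<zeta>|\<sigma>. log_kernel u z \<zeta>\<bar> \<le> B" if z: "norm z = 1" for z
    using B[THEN conjunct2, rule_format, OF z] by (rule order_trans[OF integral_abs_bound])
  then show ?thesis by (intro exI[of _ B] conjI allI impI B[THEN conjunct1])
qed

text \<open>The two kernels differ by the factor d^(-2s). Of the Hoelder gain d^\<gamma>, one half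
  is spent on bounding this factor linearly in s; the other half keeps the remaining singularity
  integrable.\<close>

lemma frac_kernel_diff_le:
  assumes z: "norm z = 1" and \<zeta>: "norm \<zeta> = 1" and s: "0 < s" "8 * s \<le> \<gamma>"
  shows "\<bar>frac_kernel N s u z \<zeta> - log_kernel u z \<zeta>\<bar> \<le> s * (16 * C / \<gamma>) * norm (z - \<zeta>) powr (\<gamma> / 2 - real N)"
proof (cases "z = \<zeta>")
  case False
  define d where "d = norm (z - \<zeta>)"
  have d: "0 < d" "d \<le> 2" using False norm_diff_sphere_le[OF z \<zeta>] by (auto simp: d_def)
  have "1 / d powr (real N + 2 * s) = d powr (- 2 * s) / d ^ N"
    using d by (simp add: powr_add powr_minus powr_realpow divide_simps)
  then have "frac_kernel N s u z \<zeta> = log_kernel u z \<zeta> * d powr (- 2 * s)"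
    by (simp add: frac_kernel_def d_def divide_inverse mult_ac)
  then have "frac_kernel N s u z \<zeta> - log_kernel u z \<zeta> = log_kernel u z \<zeta> * (d powr (- 2 * s) - 1)"
    by (simp only: right_diff_distrib mult_1_right)
  then have "\<bar>frac_kernel N s u z \<zeta> - log_kernel u z \<zeta>\<bar> = \<bar>log_kernel u z \<zeta>\<bar> * \<bar>d powr (- 2 * s) - 1\<bar>"
    by (simp only: abs_mult)
  also have "\<dots> \<le> (C * d powr (\<gamma> - real N)) * (16 * s / \<gamma> * d powr (- (\<gamma> / 2)))"
  proof (rule mult_mono)
    show "\<bar>log_kernel u z \<zeta>\<bar> \<le> C * d powr (\<gamma> - real N)"
      unfolding d_def by (rule log_kernel_bound[OF holder z \<zeta>])
    show "\<bar>d powr (- 2 * s) - 1\<bar> \<le> 16 * s / \<gamma> * d powr (- (\<gamma> / 2))"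
      by (rule abs_powr_minus_1_le[OF d s \<gamma>(2)])
  qed (use C in auto)
  also have "\<dots> = s * (16 * C / \<gamma>) * (d powr (\<gamma> - real N) * d powr (- (\<gamma> / 2)))" by simp
  also have "d powr (\<gamma> - real N) * d powr (- (\<gamma> / 2)) = d powr (\<gamma> - real N + - (\<gamma> / 2))"
    by (rule powr_add[symmetric])
  also have "\<gamma> - real N + - (\<gamma> / 2) = \<gamma> / 2 - real N" by simp
  finally show ?thesis by (simp only: d_def)
qed (simp add: frac_kernel_def)

text \<open>For 8 s \<le> \<gamma> the integral converges absolutely, so the principal value is an
  ordinary integral; the error is linear in s with a constant that does not depend on z.\<close>

lemma frac_kernel_integral:
  "\<exists>K\<ge>0. \<forall>s z. 0 < s \<longrightarrow> 8 * s \<le> \<gamma> \<longrightarrow> norm z = 1 \<longrightarrow>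
     integrable \<sigma> (frac_kernel N s u z) \<and>
     \<bar>(LINT \<zeta>|\<sigma>. frac_kernel N s u z \<zeta>) - (LINT \<zeta>|\<sigma>. log_kernel u z \<zeta>)\<bar> \<le> s * K"
proof -
  have g2: "0 < \<gamma> / 2" "\<gamma> / 2 \<le> 1" using \<gamma> by auto
  obtain B where B: "B \<ge> 0" "\<forall>z::'a. norm z = 1 \<longrightarrow>
    integrable \<sigma> (\<lambda>\<zeta>. norm (z - \<zeta>) powr (\<gamma> / 2 - real N)) \<and>
    (LINT \<zeta>|\<sigma>. norm (z - \<zeta>) powr (\<gamma> / 2 - real N)) \<le> B"
    using riesz_bound[OF g2] by blast
  have "integrable \<sigma> (frac_kernel N s u z) \<and>
     \<bar>(LINT \<zeta>|\<sigma>. frac_kernel N s u z \<zeta>) - (LINT \<zeta>|\<sigma>. log_kernel u z \<zeta>)\<bar> \<le> s * (16 * C / \<gamma> * B)"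
    if s: "0 < s" "8 * s \<le> \<gamma>" and z: "norm z = 1" for s z
  proof -
    let ?D = "\<lambda>\<zeta>. frac_kernel N s u z \<zeta> - log_kernel u z \<zeta>"
    let ?R = "\<lambda>\<zeta>. s * (16 * C / \<gamma>) * norm (z - \<zeta>) powr (\<gamma> / 2 - real N)"
    have R: "integrable \<sigma> ?R" using B(2) z by (intro integrable_mult_right) blast
    have bnd: "\<bar>?D \<zeta>\<bar> \<le> ?R \<zeta>" if "\<zeta> \<in> space \<sigma>" for \<zeta>
      using frac_kernel_diff_le[OF z _ s, of \<zeta>] that by simp
    have D: "integrable \<sigma> ?D"
    proof (rule Bochner_Integration.integrable_bound[OF R])
      show "?D \<in> borel_measurable \<sigma>"
        by (intro borel_measurable_diff frac_kernel_measurable log_kernel_measurable u_measurable)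
      show "AE \<zeta> in \<sigma>. norm (?D \<zeta>) \<le> norm (?R \<zeta>)"
      proof (rule AE_I2)
        fix \<zeta> assume "\<zeta> \<in> space \<sigma>"
        from bnd[OF this] show "norm (?D \<zeta>) \<le> norm (?R \<zeta>)"
          unfolding real_norm_def by linarith
      qed
    qed
    from Bochner_Integration.integrable_add[OF D log_kernel_u_integrable[OF z]]
    have i: "integrable \<sigma> (frac_kernel N s u z)" by simp
    have "\<bar>(LINT \<zeta>|\<sigma>. frac_kernel N s u z \<zeta>) - (LINT \<zeta>|\<sigma>. log_kernel u z \<zeta>)\<bar> = \<bar>LINT \<zeta>|\<sigma>. ?D \<zeta>\<bar>"
      by (subst Bochner_Integration.integral_diff[OF i log_kernel_u_integrable[OF z]]) simp
    also have "\<dots> \<le> (LINT \<zeta>|\<sigma>. \<bar>?D \<zeta>\<bar>)" by (rule integral_abs_bound)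
    also have "\<dots> \<le> (LINT \<zeta>|\<sigma>. ?R \<zeta>)"
      by (rule integral_mono[OF integrable_abs[OF D] R bnd])
    also have "\<dots> = s * (16 * C / \<gamma>) * (LINT \<zeta>|\<sigma>. norm (z - \<zeta>) powr (\<gamma> / 2 - real N))" by simp
    also have "\<dots> \<le> s * (16 * C / \<gamma>) * B" using B(2) z C \<gamma> s by (intro mult_left_mono) auto
    finally show ?thesis using i by (simp add: mult.assoc)
  qed
  moreover have "0 \<le> 16 * C / \<gamma> * B" using B(1) C \<gamma> by simp
  ultimately show ?thesis by blast
qed

lemma frac_principal_value:
  assumes "0 < s" "8 * s \<le> \<gamma>" "norm z = 1"
  shows "has_principal_value z (frac_kernel N s u z) (LINT \<zeta>|\<sigma>. frac_kernel N s u z \<zeta>)"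
  by (rule has_principal_value_integrable)
     (use frac_kernel_integral assms in \<open>auto simp: frac_kernel_def[of N s u z z]\<close>)

lemma frac_quotient_eq:
  assumes "0 < s" "8 * s \<le> \<gamma>" "norm z = 1"
  shows "frac_quotient N s u z =
    frac_c N s / s * (LINT \<zeta>|\<sigma>. frac_kernel N s u z \<zeta>) + (frac_A N s - 1) / s * u z"
  using assms(1) unfolding frac_quotient_def conf_frac_laplacian_def
    principal_value_eq[OF frac_principal_value[OF assms]]
  by (simp add: field_simps)

lemma eventually_small: "\<forall>\<^sub>F s in at_right (0::real). 0 < s \<and> 8 * s \<le> \<gamma>"
  using eventually_at_rightI[of 0 "\<gamma> / 8"] \<gamma> by (auto intro!: eventually_at_rightI[of 0 "\<gamma> / 8"])

text \<open>The error bound \<open>E s\<close> is independent of z, so one estimate yields both the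
  pointwise derivative and the convergence in every Lp, including the supremum case.\<close>

lemma frac_quotient_uniform:
  "\<exists>E. (E \<longlongrightarrow> 0) (at_right 0) \<and> (\<forall>s z. 0 < s \<longrightarrow> 8 * s \<le> \<gamma> \<longrightarrow> norm z = 1 \<longrightarrow>
     \<bar>frac_quotient N s u z - log_form u z\<bar> \<le> E s)"
proof -
  obtain K where K: "K \<ge> 0" "\<And>s z. 0 < s \<Longrightarrow> 8 * s \<le> \<gamma> \<Longrightarrow> norm z = 1 \<Longrightarrow>
     \<bar>(LINT \<zeta>|\<sigma>. frac_kernel N s u z \<zeta>) - (LINT \<zeta>|\<sigma>. log_kernel u z \<zeta>)\<bar> \<le> s * K"
    using frac_kernel_integral by blast
  obtain B where B: "B \<ge> 0" "\<And>z. norm z = 1 \<Longrightarrow> \<bar>LINT \<zeta>|\<sigma>. log_kernel u z \<zeta>\<bar> \<le> B"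
    using log_kernel_integral_bound by blast
  obtain U where U: "U \<ge> 0" "\<And>z. norm z = 1 \<Longrightarrow> \<bar>u z\<bar> \<le> U"
    using u_bounded by blast
  let ?E = "\<lambda>s. \<bar>frac_c N s / s\<bar> * (s * K) + \<bar>frac_c N s / s - log_c N\<bar> * B + \<bar>(frac_A N s - 1) / s - log_A N\<bar> * U"
  have "(?E \<longlongrightarrow> \<bar>log_c N\<bar> * (0 * K) + \<bar>log_c N - log_c N\<bar> * B + \<bar>log_A N - log_A N\<bar> * U) (at_right 0)"
    by (intro tendsto_intros frac_c_over_s_tendsto frac_A_quotient_tendsto N)
  then have "(?E \<longlongrightarrow> 0) (at_right 0)" by simp
  moreover have "\<bar>frac_quotient N s u z - log_form u z\<bar> \<le> ?E s"
    if s: "0 < s" "8 * s \<le> \<gamma>" and z: "norm z = 1" for s z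
  proof -
    define c where "c = frac_c N s / s"
    define a where "a = (frac_A N s - 1) / s"
    define I where "I = (LINT \<zeta>|\<sigma>. frac_kernel N s u z \<zeta>)"
    define J where "J = (LINT \<zeta>|\<sigma>. log_kernel u z \<zeta>)"
    \<comment> \<open>Separates the three sources of error: the change of kernel, of the constant in
      front of the integral, and of the zeroth-order coefficient.\<close>
    have "frac_quotient N s u z - log_form u z = c * (I - J) + (c - log_c N) * J + (a - log_A N) * u z"
      unfolding frac_quotient_eq[OF s z] log_form_def c_def[symmetric] a_def[symmetric] I_def[symmetric] J_def[symmetric]
      by (simp add: algebra_simps)
    then have "\<bar>frac_quotient N s u z - log_form u z\<bar> \<le> \<bar>c\<bar> * \<bar>I - J\<bar> + \<bar>c - log_c N\<bar> * \<bar>J\<bar> + \<bar>a - log_A N\<bar> * \<bar>u z\<bar>"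
      by (simp only:) (simp add: abs_mult[symmetric])
    also have "\<dots> \<le> \<bar>c\<bar> * (s * K) + \<bar>c - log_c N\<bar> * B + \<bar>a - log_A N\<bar> * U"
      using K(2)[OF s z] B(2)[OF z] U(2)[OF z] by (intro add_mono mult_left_mono) (auto simp: I_def J_def)
    finally show ?thesis by (simp only: c_def a_def)
  qed
  ultimately show ?thesis by (intro exI[of _ ?E]) blast
qed

lemma frac_quotient_tendsto:
  assumes "norm z = 1"
  shows "((\<lambda>s. frac_quotient N s u z) \<longlongrightarrow> log_form u z) (at_right 0)"
proof -
  obtain E where E: "(E \<longlongrightarrow> 0) (at_right 0)" "\<And>s z. 0 < s \<Longrightarrow> 8 * s \<le> \<gamma> \<Longrightarrow> norm z = 1 \<Longrightarrow>
     \<bar>frac_quotient N s u z - log_form u z\<bar> \<le> E s"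
    using frac_quotient_uniform by blast
  have "((\<lambda>s. frac_quotient N s u z - log_form u z) \<longlongrightarrow> 0) (at_right 0)"
  proof (rule Lim_null_comparison[OF _ E(1)])
    show "\<forall>\<^sub>F s in at_right 0. norm (frac_quotient N s u z - log_form u z) \<le> E s"
      using eventually_small by eventually_elim (use E(2) assms in auto)
  qed
  then show ?thesis by (rule LIM_zero_cancel)
qed

lemma conf_log_laplacian_eq: "norm z = 1 \<Longrightarrow> conf_log_laplacian N u z = log_form u z"
  unfolding conf_log_laplacian_def by (intro tendsto_Lim frac_quotient_tendsto) auto

lemma log_form_measurable: "log_form u \<in> borel_measurable \<sigma>"
proof -
  note [measurable] = u_measurable frac_kernel_integral_measurable[OF u_measurable, of 0]
  have "(\<lambda>z. log_c N * (LINT \<zeta>|\<sigma>. frac_kernel N 0 u z \<zeta>) + log_A N * u z) \<in> borel_measurable \<sigma>"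
    by measurable
  then show ?thesis by (simp only: frac_kernel_0 log_form_def[abs_def])
qed

lemma conf_log_laplacian_measurable: "conf_log_laplacian N u \<in> borel_measurable \<sigma>"
  by (rule measurable_cong[THEN iffD2, OF _ log_form_measurable]) (simp add: conf_log_laplacian_eq)

lemma frac_quotient_measurable:
  assumes "0 < s" "8 * s \<le> \<gamma>"
  shows "frac_quotient N s u \<in> borel_measurable \<sigma>"
proof -
  note [measurable] = u_measurable frac_kernel_integral_measurable[OF u_measurable, of s]
  have "(\<lambda>z. frac_c N s / s * (LINT \<zeta>|\<sigma>. frac_kernel N s u z \<zeta>) + (frac_A N s - 1) / s * u z) \<in> borel_measurable \<sigma>"
    by measurable
  then show ?thesis
    by (rule measurable_cong[THEN iffD2, rotated]) (simp add: frac_quotient_eq[OF assms])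
qed

lemma Lp_convergence:
  assumes p: "1 \<le> p"
  shows "conf_log_laplacian N u \<in> Lp_space p \<sigma>"
    and "\<forall>\<^sub>F s in at_right 0. frac_quotient N s u \<in> Lp_space p \<sigma>"
    and "((\<lambda>s. Lp_norm p \<sigma> (\<lambda>z. frac_quotient N s u z - conf_log_laplacian N u z)) \<longlongrightarrow> 0) (at_right 0)"
proof -
  let ?w = "sphere_area TYPE('a)"
  have w: "emeasure \<sigma> (space \<sigma>) = ennreal ?w" "0 \<le> ?w"
    using sphere_area_pos[where ?'a = 'a] by (auto simp: emeasure_space_sphere_volume)
  note Lp = Lp_norm_le[OF p _ _ _ w]
  obtain B where B: "B \<ge> 0" "\<And>z. norm z = 1 \<Longrightarrow> \<bar>LINT \<zeta>|\<sigma>. log_kernel u z \<zeta>\<bar> \<le> B"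
    using log_kernel_integral_bound by blast
  obtain U where U: "U \<ge> 0" "\<And>z. norm z = 1 \<Longrightarrow> \<bar>u z\<bar> \<le> U"
    using u_bounded by blast
  obtain E where E: "(E \<longlongrightarrow> 0) (at_right 0)" "\<And>s z. 0 < s \<Longrightarrow> 8 * s \<le> \<gamma> \<Longrightarrow> norm z = 1 \<Longrightarrow>
     \<bar>frac_quotient N s u z - log_form u z\<bar> \<le> E s"
    using frac_quotient_uniform by blast
  define L where "L = \<bar>log_c N\<bar> * B + \<bar>log_A N\<bar> * U"
  have L: "\<bar>log_form u z\<bar> \<le> L" if "norm z = 1" for z
  proof -
    have "\<bar>log_form u z\<bar> \<le> \<bar>log_c N\<bar> * \<bar>LINT \<zeta>|\<sigma>. log_kernel u z \<zeta>\<bar> + \<bar>log_A N\<bar> * \<bar>u z\<bar>"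
      unfolding log_form_def by (simp add: abs_mult[symmetric])
    also have "\<dots> \<le> L"
      unfolding L_def using B(2)[OF that] U(2)[OF that] by (intro add_mono mult_left_mono) auto
    finally show ?thesis .
  qed
  have L0: "0 \<le> L" unfolding L_def using B(1) U(1) by simp
  have "Lp_norm p \<sigma> (conf_log_laplacian N u) \<le> ennreal (L * max 1 ?w)"
    using L by (intro Lp conf_log_laplacian_measurable L0) (simp add: conf_log_laplacian_eq)
  then show "conf_log_laplacian N u \<in> Lp_space p \<sigma>"
    using conf_log_laplacian_measurable by (auto simp: Lp_space_def intro: le_less_trans)
  \<comment> \<open>\<open>E s\<close> dominates an absolute value at every point of the sphere; a
    basis vector provides such a point.\<close>
  have E0: "0 \<le> E s" if "0 < s" "8 * s \<le> \<gamma>" for s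
  proof -
    obtain b :: 'a where "b \<in> Basis" using nonempty_Basis by blast
    then show ?thesis using E(2)[OF that, of b] by (auto intro: order_trans[OF abs_ge_zero])
  qed
  show "\<forall>\<^sub>F s in at_right 0. frac_quotient N s u \<in> Lp_space p \<sigma>"
    using eventually_small
  proof eventually_elim
    case (elim s)
    then have s: "0 < s" "8 * s \<le> \<gamma>" by auto
    have "Lp_norm p \<sigma> (frac_quotient N s u) \<le> ennreal ((L + E s) * max 1 ?w)"
    proof (intro Lp frac_quotient_measurable s add_nonneg_nonneg L0 E0)
      fix z assume "z \<in> space \<sigma>"
      then have z: "norm z = 1" by simp
      show "\<bar>frac_quotient N s u z\<bar> \<le> L + E s"
        using L[OF z] E(2)[OF s z] by linarith
    qed
    then show ?case
      using frac_quotient_measurable[OF s] by (auto simp: Lp_space_def intro: le_less_trans)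
  qed
  have "((\<lambda>s. ennreal (E s * max 1 ?w)) \<longlongrightarrow> ennreal (0 * max 1 ?w)) (at_right 0)"
    by (intro tendsto_ennrealI tendsto_intros E(1))
  then have lim: "((\<lambda>s. ennreal (E s * max 1 ?w)) \<longlongrightarrow> 0) (at_right 0)" by simp
  show "((\<lambda>s. Lp_norm p \<sigma> (\<lambda>z. frac_quotient N s u z - conf_log_laplacian N u z)) \<longlongrightarrow> 0) (at_right 0)"
  proof (rule tendsto_sandwich[OF _ _ tendsto_const lim])
    show "\<forall>\<^sub>F s in at_right 0. Lp_norm p \<sigma> (\<lambda>z. frac_quotient N s u z - conf_log_laplacian N u z) \<le> ennreal (E s * max 1 ?w)"
      using eventually_small
    proof eventually_elim
      case (elim s)
      then have s: "0 < s" "8 * s \<le> \<gamma>" by auto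
      show ?case
        using E(2)[OF s]
        by (intro Lp borel_measurable_diff frac_quotient_measurable s conf_log_laplacian_measurable E0)
           (simp add: conf_log_laplacian_eq)
    qed
  qed simp
qed

end

section \<open>Eigenfunctions\<close>

context sphere_setting
begin

lemma sphere_holder_obtain_function:
  fixes f :: "'a \<Rightarrow> real"
  assumes "f \<in> sphere_holder \<beta>" "0 < \<beta>"
  obtains C \<gamma> where "sphere_holder_function N f C \<gamma>"
proof -
  obtain \<gamma> C where g: "0 < \<gamma>" "\<gamma> \<le> 1" "0 \<le> C"
    "\<And>x y. norm x = 1 \<Longrightarrow> norm y = 1 \<Longrightarrow> \<bar>f x - f y\<bar> \<le> C * norm (x - y) powr \<gamma>"
    using sphere_holder_exponent_le_1[OF assms] by blast
  have "sphere_holder_function N f C \<gamma>"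
    by (intro sphere_holder_function.intro sphere_setting_axioms sphere_holder_function_axioms.intro g)
  then show thesis by (rule that)
qed

text \<open>Supplies the Hoelder regularity of a Laplace eigenfunction, which is a multiple of its
  own projection, without a mean value argument along curves in the sphere.\<close>

lemma proj_lipschitz:
  assumes f: "continuous_on (sphere 0 1) f"
  shows "\<exists>C. \<forall>x y. norm x = 1 \<longrightarrow> norm y = 1 \<longrightarrow> \<bar>proj k f x - proj k f y\<bar> \<le> C * norm (x - y) powr 1"
proof -
  obtain C where C: "\<forall>y x x'::'a. norm y = 1 \<longrightarrow> norm x = 1 \<longrightarrow> norm x' = 1 \<longrightarrow>
    \<bar>Z k (y \<bullet> x) - Z k (y \<bullet> x')\<bar> \<le> C * norm (x - x') powr 1"
    using zonal_lipschitz[of k] by blast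
  have fi: "integrable \<sigma> (\<lambda>\<zeta>. \<bar>f \<zeta>\<bar>)"
    by (intro integrable_abs integrable_sphere_volume_continuous f)
  have "\<bar>proj k f x - proj k f y\<bar> \<le> (C * (LINT \<zeta>|\<sigma>. \<bar>f \<zeta>\<bar>)) * norm (x - y) powr 1"
    if xy: "norm x = 1" "norm y = 1" for x y :: 'a
  proof -
    have i: "integrable \<sigma> (\<lambda>\<zeta>. Z k (x \<bullet> \<zeta>) * f \<zeta> - Z k (y \<bullet> \<zeta>) * f \<zeta>)"
      by (intro Bochner_Integration.integrable_diff proj_integrable f)
    have E: "proj k f x - proj k f y = (LINT \<zeta>|\<sigma>. Z k (x \<bullet> \<zeta>) * f \<zeta> - Z k (y \<bullet> \<zeta>) * f \<zeta>)"
      unfolding proj_def by (intro Bochner_Integration.integral_diff[symmetric] proj_integrable f)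
    have "\<bar>proj k f x - proj k f y\<bar> \<le> (LINT \<zeta>|\<sigma>. \<bar>Z k (x \<bullet> \<zeta>) * f \<zeta> - Z k (y \<bullet> \<zeta>) * f \<zeta>\<bar>)"
      unfolding E by (rule integral_abs_bound)
    also have "\<dots> \<le> (LINT \<zeta>|\<sigma>. (C * norm (x - y) powr 1) * \<bar>f \<zeta>\<bar>)"
    proof (rule integral_mono)
      show "integrable \<sigma> (\<lambda>\<zeta>. \<bar>Z k (x \<bullet> \<zeta>) * f \<zeta> - Z k (y \<bullet> \<zeta>) * f \<zeta>\<bar>)"
        by (rule integrable_abs[OF i])
      show "integrable \<sigma> (\<lambda>\<zeta>. (C * norm (x - y) powr 1) * \<bar>f \<zeta>\<bar>)"
        by (rule integrable_mult_right[OF fi])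
      fix \<zeta> assume "\<zeta> \<in> space \<sigma>"
      then have \<zeta>: "norm \<zeta> = 1" by simp
      have "\<bar>Z k (x \<bullet> \<zeta>) - Z k (y \<bullet> \<zeta>)\<bar> \<le> C * norm (x - y) powr 1"
        using C[rule_format, OF \<zeta> xy] by (simp only: inner_commute[of \<zeta> x] inner_commute[of \<zeta> y])
      then have "\<bar>Z k (x \<bullet> \<zeta>) - Z k (y \<bullet> \<zeta>)\<bar> * \<bar>f \<zeta>\<bar> \<le> (C * norm (x - y) powr 1) * \<bar>f \<zeta>\<bar>"
        by (rule mult_right_mono) simp
      then show "\<bar>Z k (x \<bullet> \<zeta>) * f \<zeta> - Z k (y \<bullet> \<zeta>) * f \<zeta>\<bar> \<le> (C * norm (x - y) powr 1) * \<bar>f \<zeta>\<bar>"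
        by (simp only: left_diff_distrib[symmetric] abs_mult)
    qed
    also have "\<dots> = (C * norm (x - y) powr 1) * (LINT \<zeta>|\<sigma>. \<bar>f \<zeta>\<bar>)"
      by (rule integral_mult_right_zero)
    finally show ?thesis by (simp add: mult_ac)
  qed
  then show ?thesis by blast
qed

section \<open>The symbol and the equivalence of the two eigenvalue problems\<close>

abbreviation log_eigval :: "nat \<Rightarrow> real" where
  "log_eigval k \<equiv> 2 * Digamma (real N / 2 + real k)"

lemma log_eigval_inj: "inj log_eigval"
proof (rule linorder_injI)
  fix i j :: nat assume "i < j"
  then have "Digamma (real N / 2 + real i) < Digamma (real N / 2 + real j)"
    using N by (intro Digamma_real_strict_mono) auto
  then show "log_eigval i \<noteq> log_eigval j" by simp
qed

text \<open>Completing the square: k (k + N - 1) + (N - 1)^2 / 4 = (k + (N - 1)/2)^2. This is how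
  the square root in the symbol arises.\<close>

lemma symbol_radicand_eigval: "symbol_radicand N (eigval k) = (real k + \<nu>)\<^sup>2"
  by (simp add: symbol_radicand_def power2_eq_square field_simps)

lemma log_symbol_eigval: "log_symbol N (eigval k) = log_eigval k"
proof -
  have "sqrt (symbol_radicand N (eigval k)) = real k + \<nu>"
    unfolding symbol_radicand_eigval by (rule real_sqrt_unique) (use nu_nonneg in auto)
  moreover have "1 / 2 + (real k + \<nu>) = real N / 2 + real k" by (simp add: field_simps)
  ultimately show ?thesis by (simp only: log_symbol_def)
qed

text \<open>Nonnegative radicands keep the argument of Digamma at least 1/2, where it is strictly
  increasing.\<close>

lemma log_symbol_inj:
  assumes "0 \<le> symbol_radicand N \<mu>" "0 \<le> symbol_radicand N \<mu>'" "log_symbol N \<mu> = log_symbol N \<mu>'"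
  shows "\<mu> = \<mu>'"
proof -
  define a where "a = sqrt (symbol_radicand N \<mu>)"
  define b where "b = sqrt (symbol_radicand N \<mu>')"
  have ab: "0 \<le> a" "0 \<le> b" using assms by (auto simp: a_def b_def)
  have "Digamma (1/2 + a) = Digamma (1/2 + b)"
    using assms(3) by (simp add: log_symbol_def a_def b_def)
  then have "a = b"
    using Digamma_real_strict_mono[of "1/2 + a" "1/2 + b"] Digamma_real_strict_mono[of "1/2 + b" "1/2 + a"] ab
    by (cases a b rule: linorder_cases) auto
  then show ?thesis using assms by (simp add: a_def b_def symbol_radicand_def)
qed

text \<open>No sign of \<mu> is prescribed: the spectral argument forces \<mu> =
  \<open>eigval k\<close>, whose radicand is a square, so the condition on the radicand comes out as
  a conclusion.\<close>

lemma laplace_eigenfunction_imp_log: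
  fixes \<Phi> :: "'a \<Rightarrow> real"
  assumes "laplace_eigenfunction \<mu> \<Phi>"
  shows "0 \<le> symbol_radicand N \<mu> \<and> log_eigenfunction N (log_symbol N \<mu>) \<Phi>"
proof -
  have A: "\<Phi> \<in> sphere_C2 \<and> (\<exists>z\<in>sphere 0 1. \<Phi> z \<noteq> 0) \<and> (\<forall>z\<in>sphere 0 1. - laplace_beltrami \<Phi> z = \<mu> * \<Phi> z)"
    using assms unfolding laplace_eigenfunction_def is_eigenfunction_def .
  then have \<Phi>: "\<Phi> \<in> sphere_C2" by blast
  obtain z0 where z0: "norm z0 = 1" "\<Phi> z0 \<noteq> 0" using A by auto
  have L: "laplace_beltrami \<Phi> z = - \<mu> * \<Phi> z" if "norm z = 1" for z
  proof -
    have "- laplace_beltrami \<Phi> z = \<mu> * \<Phi> z" using A that by auto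
    then show ?thesis by linarith
  qed
  have c: "continuous_on (sphere 0 1) \<Phi>"
    using \<Phi> by (simp add: sphere_C2_def sphere_C1_continuous_on)
  have E: "\<mu> * proj j \<Phi> z = eigval j * proj j \<Phi> z" if z: "norm z = 1" for j z
  proof -
    have "- eigval j * proj j \<Phi> z = proj j (laplace_beltrami \<Phi>) z"
      by (rule proj_laplace[OF \<Phi> z, symmetric])
    also have "\<dots> = proj j (\<lambda>\<zeta>. - \<mu> * \<Phi> \<zeta>) z" by (rule proj_cong) (rule L)
    also have "\<dots> = - \<mu> * proj j \<Phi> z" by (rule proj_cmult)
    finally show ?thesis by (simp only: mult_minus_left neg_equal_iff_equal)
  qed
  have "\<exists>k. \<mu> = eigval k \<and> (\<forall>z. norm z = 1 \<longrightarrow> proj k \<Phi> z = sphere_area TYPE('a) * \<Phi> z \<and>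
    (\<forall>j. j \<noteq> k \<longrightarrow> proj j \<Phi> z = 0))"
    by (rule spectral_uniqueness[OF c z0 eigval_inj E])
  then obtain k where k: "\<mu> = eigval k" and P: "\<And>z. norm z = 1 \<Longrightarrow> proj k \<Phi> z = sphere_area TYPE('a) * \<Phi> z"
    and 0: "\<And>z j. norm z = 1 \<Longrightarrow> j \<noteq> k \<Longrightarrow> proj j \<Phi> z = 0"
    by blast
  obtain C where C: "\<And>x y. norm x = 1 \<Longrightarrow> norm y = 1 \<Longrightarrow> \<bar>proj k \<Phi> x - proj k \<Phi> y\<bar> \<le> C * norm (x - y) powr 1"
    using proj_lipschitz[OF c] by blast
  let ?w = "sphere_area TYPE('a)"
  have w: "?w > 0" by (rule sphere_area_pos)
  have hol: "\<bar>\<Phi> x - \<Phi> y\<bar> \<le> (C / ?w) * norm (x - y) powr 1" if "norm x = 1" "norm y = 1" for x y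
  proof -
    have "?w * \<bar>\<Phi> x - \<Phi> y\<bar> = \<bar>proj k \<Phi> x - proj k \<Phi> y\<bar>"
      using w by (simp add: P that abs_mult flip: right_diff_distrib)
    also have "\<dots> \<le> C * norm (x - y) powr 1" by (rule C[OF that])
    finally show ?thesis using w by (simp add: field_simps)
  qed
  have \<Phi>1: "\<Phi> \<in> sphere_holder 1"
    using hol unfolding sphere_holder_def by (intro CollectI exI[of _ "C / ?w"]) auto
  obtain C' \<gamma> where "sphere_holder_function N \<Phi> C' \<gamma>"
    using sphere_holder_obtain_function[OF \<Phi>1] by auto
  then interpret \<Phi>: sphere_holder_function N space_type \<Phi> C' \<gamma> .
  have "conf_log_laplacian N \<Phi> z = log_symbol N \<mu> * \<Phi> z" if z: "norm z = 1" for z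
    unfolding k log_symbol_eigval \<Phi>.conf_log_laplacian_eq[OF z]
    by (rule log_form_single[OF \<Phi>.holder \<Phi>.\<gamma> z 0[OF z]])
  then have "log_eigenfunction N (log_symbol N \<mu>) \<Phi>"
    unfolding log_eigenfunction_def is_eigenfunction_def using \<Phi>1 z0 by force
  then show ?thesis unfolding k symbol_radicand_eigval by simp
qed

text \<open>The eigenvalue equation is tested against zonal functions, so only the symmetry of the
  logarithmic form is used on \<Phi>. Injectivity of the symbol on nonnegative radicands then
  recovers \<mu> from the logarithmic eigenvalue.\<close>

lemma log_eigenfunction_imp_laplace:
  fixes \<Phi> :: "'a \<Rightarrow> real"
  assumes rad: "0 \<le> symbol_radicand N \<mu>" and "log_eigenfunction N (log_symbol N \<mu>) \<Phi>"
  shows "laplace_eigenfunction \<mu> \<Phi>"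
proof -
  let ?w = "sphere_area TYPE('a)"
  have w: "?w > 0" by (rule sphere_area_pos)
  have A: "\<Phi> \<in> (\<Union>\<beta>\<in>{0<..}. sphere_holder \<beta>) \<and> (\<exists>z\<in>sphere 0 1. \<Phi> z \<noteq> 0) \<and>
     (\<forall>z\<in>sphere 0 1. conf_log_laplacian N \<Phi> z = log_symbol N \<mu> * \<Phi> z)"
    using assms(2) unfolding log_eigenfunction_def is_eigenfunction_def .
  obtain \<beta> where \<beta>: "0 < \<beta>" "\<Phi> \<in> sphere_holder \<beta>" using A by auto
  obtain z0 where z0: "norm z0 = 1" "\<Phi> z0 \<noteq> 0" using A by auto
  have L: "conf_log_laplacian N \<Phi> z = log_symbol N \<mu> * \<Phi> z" if "norm z = 1" for z
    using A that by auto
  obtain C' \<gamma> where "sphere_holder_function N \<Phi> C' \<gamma>"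
    using sphere_holder_obtain_function[OF \<beta>(2,1)] by auto
  then interpret \<Phi>: sphere_holder_function N space_type \<Phi> C' \<gamma> .
  have L': "log_form \<Phi> z = log_symbol N \<mu> * \<Phi> z" if "norm z = 1" for z
    using L[OF that] \<Phi>.conf_log_laplacian_eq[OF that] by simp
  have E: "log_symbol N \<mu> * proj j \<Phi> y = log_eigval j * proj j \<Phi> y" if y: "norm y = 1" for j y
  proof -
    obtain C where C: "0 \<le> C" "\<forall>y x x'::'a. norm y = 1 \<longrightarrow> norm x = 1 \<longrightarrow> norm x' = 1 \<longrightarrow>
      \<bar>Z j (y \<bullet> x) - Z j (y \<bullet> x')\<bar> \<le> C * norm (x - x') powr 1"
      using zonal_lipschitz[of j] by blast
    have C': "\<bar>Z j (y \<bullet> x) - Z j (y \<bullet> x')\<bar> \<le> C * norm (x - x') powr 1" if "norm x = 1" "norm x' = 1" for x x'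
      using C(2) y that by blast
    have "0 = (LINT z|\<sigma>. Z j (y \<bullet> z) * log_form \<Phi> z - \<Phi> z * log_form (\<lambda>\<zeta>. Z j (y \<bullet> \<zeta>)) z)"
      by (rule log_form_symmetric[OF \<Phi>.holder C' \<Phi>.C C(1) \<Phi>.\<gamma>, symmetric]) auto
    also have "\<dots> = (LINT z|\<sigma>. (log_symbol N \<mu> - log_eigval j) * (Z j (y \<bullet> z) * \<Phi> z))"
      by (intro Bochner_Integration.integral_cong refl)
         (simp add: L' log_form_zonal[OF y] algebra_simps)
    also have "\<dots> = (log_symbol N \<mu> - log_eigval j) * proj j \<Phi> y"
      unfolding proj_def by (rule integral_mult_right_zero)
    finally show ?thesis by auto
  qed
  have "\<exists>k. log_symbol N \<mu> = log_eigval k \<and> (\<forall>z. norm z = 1 \<longrightarrow> proj k \<Phi> z = ?w * \<Phi> z \<and>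
    (\<forall>j. j \<noteq> k \<longrightarrow> proj j \<Phi> z = 0))"
    by (rule spectral_uniqueness[OF \<Phi>.u_continuous z0 log_eigval_inj E])
  then obtain k where k: "log_symbol N \<mu> = log_eigval k" and P: "\<And>z. norm z = 1 \<Longrightarrow> proj k \<Phi> z = ?w * \<Phi> z"
    by blast
  have \<mu>: "\<mu> = eigval k"
    by (rule log_symbol_inj[OF rad]) (simp_all only: k log_symbol_eigval symbol_radicand_eigval zero_le_power2)
  \<comment> \<open>Dividing by the area makes \<Phi> agree with the projection of \<open>f\<close>.
    They agree on the sphere only, which is enough for the congruence rules of
    \<open>sphere_C2\<close> and \<open>laplace_beltrami\<close>.\<close>
  define f where "f \<zeta> = (1 / ?w) * \<Phi> \<zeta>" for \<zeta>
  have fc: "continuous_on (sphere 0 1) f"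
    unfolding f_def by (intro continuous_intros \<Phi>.u_continuous)
  have eq: "proj k f z = \<Phi> z" if "norm z = 1" for z
    unfolding f_def proj_cmult P[OF that] using w by simp
  have "\<Phi> \<in> sphere_C2" by (rule sphere_C2_cong[OF proj_C2(1)[OF fc] eq])
  moreover have "laplace_beltrami \<Phi> z = - \<mu> * \<Phi> z" if z: "norm z = 1" for z
    using laplace_beltrami_cong[OF eq z] proj_C2(2)[OF fc z, of k] eq[OF z] by (simp add: \<mu>)
  ultimately show ?thesis
    unfolding laplace_eigenfunction_def is_eigenfunction_def using z0 by force
qed

lemma log_symbol_strict_mono: "strict_mono_on {0<..} (log_symbol N)"
proof (rule strict_mono_onI)
  fix r s :: real assume rs: "r \<in> {0<..}" "s \<in> {0<..}" "r < s"
  have "0 \<le> symbol_radicand N r" "symbol_radicand N r < symbol_radicand N s"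
    using rs by (auto simp: symbol_radicand_def intro!: add_nonneg_nonneg)
  then have "Digamma (1 / 2 + sqrt (symbol_radicand N r)) < Digamma (1 / 2 + sqrt (symbol_radicand N s))"
    by (intro Digamma_real_strict_mono add_pos_nonneg) auto
  then show "log_symbol N r < log_symbol N s" by (simp add: log_symbol_def)
qed

end

theorem theorem1p1:
  fixes N :: nat and \<beta> :: real and u :: "'a::euclidean_space \<Rightarrow> real"
  assumes "DIM('a) = N + 1" and "1 \<le> N"
    and "0 < \<beta>" and "u \<in> sphere_holder \<beta>"
  shows
    "\<comment> \<open>the principal values exist for small \<open>s\<close>\<close>
     (\<forall>\<^sub>F s in at_right 0. \<forall>z\<in>sphere 0 1. \<exists>I. has_principal_value z (frac_kernel N s u z) I)
     \<and>
     \<comment> \<open>the derivative at \<open>s = 0\<close> exists and is given by the integral formula\<close>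
     (\<forall>z\<in>sphere 0 1.
        ((\<lambda>s. frac_quotient N s u z) \<longlongrightarrow> conf_log_laplacian N u z) (at_right 0) \<and>
        integrable sphere_volume (\<lambda>\<zeta>. (u z - u \<zeta>) / norm (z - \<zeta>) ^ N) \<and>
        conf_log_laplacian N u z =
          log_c N * (LINT \<zeta>|sphere_volume. (u z - u \<zeta>) / norm (z - \<zeta>) ^ N) + log_A N * u z)
     \<and>
     \<comment> \<open>(i)\<close>
     (\<forall>p::ennreal. 1 \<le> p \<longrightarrow>
        conf_log_laplacian N u \<in> Lp_space p sphere_volume \<and>
        (\<forall>\<^sub>F s in at_right 0. frac_quotient N s u \<in> Lp_space p sphere_volume) \<and>
        ((\<lambda>s. Lp_norm p sphere_volume (\<lambda>z. frac_quotient N s u z - conf_log_laplacian N u z))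
           \<longlongrightarrow> 0) (at_right 0))
     \<and>
     \<comment> \<open>(ii)\<close>
     (\<forall>(\<Phi> :: 'a \<Rightarrow> real) (\<mu> :: real).
        laplace_eigenfunction \<mu> \<Phi> \<longleftrightarrow>
        0 \<le> symbol_radicand N \<mu> \<and> log_eigenfunction N (log_symbol N \<mu>) \<Phi>)
     \<and>
     strict_mono_on {0<..} (log_symbol N)"
proof -
  interpret sphere_setting N "TYPE('a)"
    by standard (use assms in auto)
  obtain C \<gamma> where "sphere_holder_function N u C \<gamma>"
    using sphere_holder_obtain_function[OF assms(4,3)] by auto
  then interpret sphere_holder_function N "TYPE('a)" u C \<gamma> .
  have "\<forall>\<^sub>F s in at_right 0. \<forall>z\<in>sphere 0 1. \<exists>I. has_principal_value z (frac_kernel N s u z) I"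
    using eventually_small by eventually_elim (use frac_principal_value in force)
  moreover have "((\<lambda>s. frac_quotient N s u z) \<longlongrightarrow> conf_log_laplacian N u z) (at_right 0) \<and>
        integrable sphere_volume (\<lambda>\<zeta>. (u z - u \<zeta>) / norm (z - \<zeta>) ^ N) \<and>
        conf_log_laplacian N u z =
          log_c N * (LINT \<zeta>|sphere_volume. (u z - u \<zeta>) / norm (z - \<zeta>) ^ N) + log_A N * u z"
    if "z \<in> sphere 0 1" for z
    using frac_quotient_tendsto[of z] log_kernel_u_integrable[of z] conf_log_laplacian_eq[of z] that
    by (simp add: log_form_def)
  moreover have "laplace_eigenfunction \<mu> \<Phi> \<longleftrightarrow>
        0 \<le> symbol_radicand N \<mu> \<and> log_eigenfunction N (log_symbol N \<mu>) \<Phi>" for \<Phi> :: "'a \<Rightarrow> real" and \<mu>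
    using laplace_eigenfunction_imp_log log_eigenfunction_imp_laplace by blast
  ultimately show ?thesis
    using Lp_convergence log_symbol_strict_mono by blast
qed

end
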